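(* Let $(a,b)\in\Delta_1$, i.e. $a,b>0$, $a+b=1$, and let $\rho^{(1)}_{(a,b)}=w_+f$ be the limiting probability density of $\boldsymbol X_t/t$ for the walk with parameters $a_1=a_2=\sqrt a$ and normalized initial state $\Psi_0$. Then the 1D limit $\rho_1=\lim_{b\to0}\rho^{(1)}_{(a,b)}$ exists and $$\rho_1=C_{-1}\delta_{-1}+C_{+1}\delta_{+1},\qquad C_{\pm1}=\bigl\|\Psi_0^{(\mp)}\bigr\|^2_{\ell^2(\mathbb Z^2)},$$ where $\delta_{\pm1}$ are Dirac measures. That is, for every bounded continuous function $g$ on $\mathbb R^2$, $$\lim_{b\to0+}\int_{E}g(\boldsymbol v)\rho^{(1)}_{(a,b)}(\boldsymbol v)\,d\boldsymbol v=C_{-1}\,g(-1,-1)+C_{+1}\,g(1,1).$$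
   Context: Model. $\mathcal H=\ell^2(\mathbb Z^2;\mathbb C^2)$, $\Psi=(\Psi^{(+)},\Psi^{(-)})^T$. For $j=1,2$: $(S_j\Psi)^{(\pm)}(\boldsymbol x)=\Psi^{(\pm)}(\boldsymbol x\pm\boldsymbol e_j)$ with $\boldsymbol e_j$ the standard basis; $C_j=\begin{pmatrix}a_j&b_j\\-b_j&a_j\end{pmatrix}$ (acting pointwise), $b_j=\sqrt{1-a_j^2}$; $U=S_2C_2S_1C_1$; $a=a_1a_2$, $b=b_1b_2$. In the regime $a+b=1$ one has $a_1=a_2=\sqrt a$, $b_1=b_2=\sqrt b$, so $b\to0$ is the same as $b_1=b_2\to0$ and $a_1=a_2\to1$. $\Psi_t=U^t\Psi_0$ and $P(\boldsymbol X_t=\boldsymbol x)=\|\Psi_t(\boldsymbol x)\|^2$. 1D limit. "$\rho^{(1)}_{(a,b)}$ has the 1D limit $\rho_1$" means that $\rho_1$ is a one-dimensional distribution (generalized function), understood as a measure on $[-1,1]$, with $\lim_{b\to0+}\int g\rho^{(1)}_{(a,b)}d\boldsymbol v=\int_{[-1,1]}g(v,v)\,\rho_1(dv)$ for every bounded continuous $g$. The density. $E=\{\boldsymbol v:\frac{(v_1+v_2)^2}{4a}+\frac{(v_1-v_2)^2}{4b}\le1\}$, $f(\boldsymbol v)=\frac{1}{\pi^2(1-v_1^2)(1-v_2^2)}I_E(\boldsymbol v)$, with $I_E$ the indicator function of $E$. Let $\mathbb T=\mathbb R/2\pi\mathbb Z$, $\hat\Psi(\boldsymbol k)=\sum_{\boldsymbol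 x}e^{-i\boldsymbol k\cdot\boldsymbol x}\Psi(\boldsymbol x)$, $\hat U(\boldsymbol k)=D(k_2)C_2D(k_1)C_1$, $D(\kappa)=\mathrm{diag}(e^{i\kappa},e^{-i\kappa})$; $l_1=k_2+k_1$, $l_2=k_2-k_1$, $c_i=\cos l_i$, $s_i=\sin l_i$, $\tau=ac_1-bc_2$, $\omega=\arccos\tau$; $|\omega_\pm(\boldsymbol k)\rangle$ unit eigenvectors of $\hat U(\boldsymbol k)$ for $e^{\pm i\omega(\boldsymbol k)}$ (a.e.); $P_\pm(\boldsymbol k)=|\langle\omega_\pm(\boldsymbol k)|\hat\Psi_0(\boldsymbol k)\rangle|^2$; $\boldsymbol v(\boldsymbol k)=\bigl(-\frac{as_1+bs_2}{\sqrt{1-\tau^2}},-\frac{as_1-bs_2}{\sqrt{1-\tau^2}}\bigr)$ (a.e.). The weight is $w_+(\boldsymbol v)=\frac14\sum_{\star=\pm}\sum_{\lambda\in\{0,1\}^2}P_\star(\boldsymbol k^+_\lambda(\boldsymbol v))$, where for $\lambda=(\mu,\nu)$, $\boldsymbol k_\lambda^+$ is the (a.e. defined) inverse of $\boldsymbol v$ restricted to the set of $\boldsymbol k\in\bigcup_{n=1}^4K_{n+4\mu}$ with $c_1+c_2\le0$ if $\nu=0$ and $c_1+c_2\ge0$ if $\nu=1$; this restriction is, up to null sets, a bijection onto $E$. Here $K_n$ is the set of $\boldsymbol k=(\frac{l_1-l_2}2,\frac{l_1+l_2}2)$ with $(l_1,l_2)$ in: $K_1:[0,\pi]^2$; $K_2:[-\pi,0]\times[0,\pi]$;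 $K_3:[-\pi,0]^2$; $K_4:[0,\pi]\times[-\pi,0]$; $K_5:[-2\pi,-\pi]\times[0,\pi]$; $K_6:[-\pi,0]\times[-2\pi,-\pi]$; $K_7:[\pi,2\pi]\times[-\pi,0]$; $K_8:[0,\pi]\times[\pi,2\pi]$.
   Formalization: The weight is taken as w_+(v) = ¼ΣP_⋆(k_λ^+(⋆v)) instead of ¼ΣP_⋆(k_λ^+(v)); as printed, P_+ + P_- = |Ψ̂_0|² is blind to spin, so w_+f is not the limiting density and the claim fails for Ψ_0 = δ_0(1,0)^T. *)

theory Defs
  imports "HOL-Probability.Probability"
begin

text \<open>A state is a function from the lattice to spinors; component 1 of the spinor is the
  (+)-component and component 2 is the (-)-component.\<close>

type_synonym state = "int ^ 2 \<Rightarrow> complex ^ 2"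

definition normalized :: "state \<Rightarrow> bool" where
  "normalized \<Psi> \<longleftrightarrow> ((\<lambda>x. (norm (\<Psi> x))\<^sup>2) has_sum 1) UNIV"

definition comp_norm_sq :: "state \<Rightarrow> 2 \<Rightarrow> real" where
  "comp_norm_sq \<Psi> i = (\<Sum>\<^sub>\<infinity>x. (norm (\<Psi> x $ i))\<^sup>2)"


definition torus_box :: "(real ^ 2) set" where
  "torus_box = cbox (\<chi> i. - pi) (\<chi> i. pi)"

definition fourier_partial :: "state \<Rightarrow> (int ^ 2) set \<Rightarrow> real ^ 2 \<Rightarrow> complex ^ 2" where
  "fourier_partial \<Psi> X k = (\<Sum>x\<in>X. cis (- (\<Sum>j\<in>UNIV. k $ j * of_int (x $ j))) *s \<Psi> x)"

text \<open>For a square-summable state the Fourier series converges unconditionally in the mean-square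
  sense on the torus, and in general not pointwise. The transform is therefore a
  doubly \<open>2\<pi>\<close>-periodic function that is determined up to a null set.\<close>

definition is_fourier :: "state \<Rightarrow> (real ^ 2 \<Rightarrow> complex ^ 2) \<Rightarrow> bool" where
  "is_fourier \<Psi> F \<longleftrightarrow>
     F \<in> borel_measurable lebesgue \<and>
     (\<forall>k j. F (k + axis j (2 * pi)) = F k) \<and>
     ((\<lambda>X. \<integral>\<^sup>+k\<in>torus_box. ennreal ((norm (F k - fourier_partial \<Psi> X k))\<^sup>2) \<partial>lebesgue) \<longlongrightarrow> 0)
       (finite_subsets_at_top UNIV)"

definition fourier :: "state \<Rightarrow> real ^ 2 \<Rightarrow> complex ^ 2" where
  "fourier \<Psi> = (SOME F. is_fourier \<Psi> F)"


definition coin :: "real \<Rightarrow> complex ^ 2 ^ 2" where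
  "coin \<alpha> = (let \<beta> = sqrt (1 - \<alpha>\<^sup>2) in
     vector [vector [of_real \<alpha>, of_real \<beta>], vector [- of_real \<beta>, of_real \<alpha>]])"

definition phase_matrix :: "real \<Rightarrow> complex ^ 2 ^ 2" where
  "phase_matrix \<kappa> = vector [vector [cis \<kappa>, 0], vector [0, cis (- \<kappa>)]]"

definition U_hat :: "real \<Rightarrow> real \<Rightarrow> real ^ 2 \<Rightarrow> complex ^ 2 ^ 2" where
  "U_hat a1 a2 k = phase_matrix (k $ 2) ** coin a2 ** phase_matrix (k $ 1) ** coin a1"

definition l1 :: "real ^ 2 \<Rightarrow> real" where "l1 k = k $ 2 + k $ 1"
definition l2 :: "real ^ 2 \<Rightarrow> real" where "l2 k = k $ 2 - k $ 1"

definition tau :: "real \<Rightarrow> real \<Rightarrow> real ^ 2 \<Rightarrow> real" where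
  "tau a b k = a * cos (l1 k) - b * cos (l2 k)"

definition omega :: "real \<Rightarrow> real \<Rightarrow> real ^ 2 \<Rightarrow> real" where
  "omega a b k = arccos (tau a b k)"

text \<open>From here on the parameters satisfy \<open>a + b = 1\<close>, so that both coins are \<open>coin (sqrt a)\<close>, with
  off-diagonal entries \<open>sqrt (1 - a) = sqrt b\<close>. The sign \<open>s\<close> ranges over \<open>1\<close> and \<open>-1\<close>. For almost
  every \<open>k\<close> the two eigenvalues are distinct, so that the unit eigenvectors are unique up to a phase,
  which does not affect \<open>band_weight\<close>.\<close>

definition eigvec :: "real \<Rightarrow> real \<Rightarrow> real \<Rightarrow> real ^ 2 \<Rightarrow> complex ^ 2" where
  "eigvec a b s k = (SOME u. norm u = 1 \<and>
     U_hat (sqrt a) (sqrt a) k *v u = cis (s * omega a b k) *s u)"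

definition cinner2 :: "complex ^ 2 \<Rightarrow> complex ^ 2 \<Rightarrow> complex" where
  "cinner2 u w = (\<Sum>i\<in>UNIV. cnj (u $ i) * w $ i)"

definition band_weight :: "real \<Rightarrow> real \<Rightarrow> state \<Rightarrow> real \<Rightarrow> real ^ 2 \<Rightarrow> real" where
  "band_weight a b \<Psi> s k = (cmod (cinner2 (eigvec a b s k) (fourier \<Psi> k)))\<^sup>2"

definition velocity :: "real \<Rightarrow> real \<Rightarrow> real ^ 2 \<Rightarrow> real ^ 2" where
  "velocity a b k = vector
     [- (a * sin (l1 k) + b * sin (l2 k)) / sqrt (1 - (tau a b k)\<^sup>2),
      - (a * sin (l1 k) - b * sin (l2 k)) / sqrt (1 - (tau a b k)\<^sup>2)]"

text \<open>The index of \<open>l_rect\<close> and \<open>K_set\<close> runs from 1 to 8.\<close>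

definition l_rect :: "nat \<Rightarrow> (real \<times> real) set" where
  "l_rect n =
    [{0..pi} \<times> {0..pi},
     {-pi..0} \<times> {0..pi},
     {-pi..0} \<times> {-pi..0},
     {0..pi} \<times> {-pi..0},
     {-2*pi..-pi} \<times> {0..pi},
     {-pi..0} \<times> {-2*pi..-pi},
     {pi..2*pi} \<times> {-pi..0},
     {0..pi} \<times> {pi..2*pi}] ! (n - 1)"

definition K_set :: "nat \<Rightarrow> (real ^ 2) set" where
  "K_set n = (\<lambda>(y1, y2). vector [(y1 - y2) / 2, (y1 + y2) / 2]) ` l_rect n"

definition branch_domain :: "nat \<Rightarrow> nat \<Rightarrow> (real ^ 2) set" where
  "branch_domain \<mu> \<nu> = {k \<in> (\<Union>n\<in>{1..4}. K_set (n + 4 * \<mu>)).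
     if \<nu> = 0 then cos (l1 k) + cos (l2 k) \<le> 0 else cos (l1 k) + cos (l2 k) \<ge> 0}"

text \<open>The velocity map is injective on \<open>branch_domain\<close>, with image the ellipse below, only up to null
  sets; \<open>inv_into\<close> is the inverse at almost every point of the ellipse.\<close>

definition k_branch :: "real \<Rightarrow> real \<Rightarrow> nat \<Rightarrow> nat \<Rightarrow> real ^ 2 \<Rightarrow> real ^ 2" where
  "k_branch a b \<mu> \<nu> = inv_into (branch_domain \<mu> \<nu>) (velocity a b)"

text \<open>The band with eigenvalue \<open>cis (s * omega a b k)\<close> moves with group velocity
  \<open>s *\<^sub>R velocity a b k\<close>. Hence its contribution at \<open>v\<close> comes from the wave vectors \<open>k\<close> with
  \<open>velocity a b k = s *\<^sub>R v\<close>, and the branches are evaluated at \<open>s *\<^sub>R v\<close>. If both bands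
  were evaluated at \<open>v\<close>, their sum would be the squared norm of the Fourier transform, which does not
  distinguish the two spin components and is not the weight of the limit law.\<close>

definition w_plus :: "real \<Rightarrow> real \<Rightarrow> state \<Rightarrow> real ^ 2 \<Rightarrow> real" where
  "w_plus a b \<Psi> v = 1 / 4 * (\<Sum>s\<in>{1, -1}. \<Sum>\<mu>\<in>{0, 1}. \<Sum>\<nu>\<in>{0, 1}.
     band_weight a b \<Psi> s (k_branch a b \<mu> \<nu> (s *\<^sub>R v)))"

definition ellipse :: "real \<Rightarrow> real \<Rightarrow> (real ^ 2) set" where
  "ellipse a b = {v. (v $ 1 + v $ 2)\<^sup>2 / (4 * a) + (v $ 1 - v $ 2)\<^sup>2 / (4 * b) \<le> 1}"

definition f_density :: "real \<Rightarrow> real \<Rightarrow> real ^ 2 \<Rightarrow> real" where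
  "f_density a b v =
     1 / (pi\<^sup>2 * (1 - (v $ 1)\<^sup>2) * (1 - (v $ 2)\<^sup>2)) * indicator (ellipse a b) v"

definition rho :: "state \<Rightarrow> real \<Rightarrow> real \<Rightarrow> real ^ 2 \<Rightarrow> real" where
  "rho \<Psi> a b v = w_plus a b \<Psi> v * f_density a b v"


text \<open>The parameter of the family is \<open>b\<close>, with \<open>a = 1 - b\<close>. Integrals are taken with respect to the
  completed Lebesgue measure because the densities are determined only almost everywhere.\<close>

definition has_1D_limit :: "(real \<Rightarrow> real \<Rightarrow> real ^ 2 \<Rightarrow> real) \<Rightarrow> real measure \<Rightarrow> bool" where
  "has_1D_limit \<rho> M \<longleftrightarrow>
     finite_measure M \<and> sets M = sets borel \<and> emeasure M (- {-1..1}) = 0 \<and>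
     (\<forall>g :: real ^ 2 \<Rightarrow> real. continuous_on UNIV g \<longrightarrow> bounded (range g) \<longrightarrow>
        ((\<lambda>b. LINT v|lebesgue. g v * \<rho> (1 - b) b v) \<longlongrightarrow>
           (LINT u:{-1..1}|M. g (vector [u, u]))) (at_right 0))"

definition two_diracs :: "real \<Rightarrow> real \<Rightarrow> real measure" where
  "two_diracs C\<^sub>m C\<^sub>p = measure_of UNIV (sets borel)
     (\<lambda>A. ennreal C\<^sub>m * emeasure (return borel (-1)) A + ennreal C\<^sub>p * emeasure (return borel 1) A)"

end

(* On each of the four branches the velocity map v is a bijection onto the interior of the ellipse
   (up to null sets), with Jacobian (1 - v1^2) (1 - v2^2), which is exactly the reciprocal of the
   density f up to the factor 1 / pi^2. Reflecting v for the second band, the integral of g rho is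
   therefore (4 pi^2)^(-1) times the sum over both signs s of the integrals of
   g(s v(k)) |<omega_s(k), Psi(k)>|^2 over the union of the branch domains, which does not depend
   on b and is a fundamental domain of the torus. As b tends to 0 the matrix U(k) becomes
   diag(exp(i l1), exp(-i l1)) and s v(k) becomes (-1, -1) on the band of the first spin component
   and (1, 1) on the band of the second one. The integrand is dominated by a multiple of
   |Psi(k)|^2, so that the integrals converge, and Plancherel's identity evaluates the limit. *)
theory Submission
  imports Defs
begin

section \<open>Fundamental domains of the torus\<close>

text \<open>As \<open>b\<close> tends to 0 the ellipse shrinks to a segment, so the densities tend
  to 0 almost everywhere while their mass persists, and dominated convergence fails in the velocity
  variable. In the wave vector the domain is fixed and the weights are bounded by Cauchy-Schwarz,
  uniformly in \<open>b\<close>. Three objects come from a choice operator and must be controlled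
  before use: \<open>fourier\<close>, whose existence as a mean-square limit is the Riesz-Fischer
  theorem; \<open>eigvec\<close>, which is traded for a phase-independent formula of the weight; and
  \<open>k_branch\<close>, an inverse on closed domains on which the velocity is injective only
  after the removal of a null set. The cancellation of the Jacobian is exact because
  \<open>a + b = 1\<close> turns it into polynomial identities in the cosines of \<open>l1\<close>
  and \<open>l2\<close>. That the branches tile the torus is a matter of parity: the period lattice
  moves the pair of \<open>l1\<close> and \<open>l2\<close> only by multiples of the period with
  even sum, so the square for \<open>\<mu> = 0\<close> covers half of the torus, and its quadrants,
  moved by odd pairs, cover the other half for \<open>\<mu> = 1\<close>.\<close>

lemma
  fixes t :: "'a::euclidean_space"
  shows measurable_add_lebesgue: "(+) t \<in> lebesgue \<rightarrow>\<^sub>M lebesgue"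
    and distr_add_lebesgue: "distr lebesgue lebesgue ((+) t) = lebesgue"
proof -
  \<comment> \<open>Written as a diagonal affine map with all scale factors 1, the translation has
    Jacobian factor 1 in the affine change of variables.\<close>
  have T: "(\<lambda>x::'a. t + (\<Sum>j\<in>Basis. (1 * (x \<bullet> j)) *\<^sub>R j)) = (+) t"
    by (simp add: euclidean_representation)
  show "(+) t \<in> lebesgue \<rightarrow>\<^sub>M lebesgue"
    using lebesgue_affine_measurable[of "\<lambda>_. 1" t] unfolding T by simp
  have "(lebesgue :: 'a measure) = density (distr lebesgue lebesgue ((+) t)) (\<lambda>_. 1)"
    using lebesgue_affine_euclidean[of "\<lambda>_. 1" t] unfolding T by simp
  then show "distr lebesgue lebesgue ((+) t) = lebesgue"
    by (simp add: density_1)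
qed

lemma nn_integral_add_lebesgue:
  fixes t :: "'a::euclidean_space"
  assumes "h \<in> borel_measurable lebesgue"
  shows "(\<integral>\<^sup>+x. h (t + x) \<partial>lebesgue) = (\<integral>\<^sup>+x. h x \<partial>lebesgue)"
  by (subst (2) distr_add_lebesgue[of t, symmetric], subst nn_integral_distr)
     (use assms measurable_add_lebesgue in auto)

definition lattice_vec :: "int ^ 2 \<Rightarrow> real ^ 2" where
  "lattice_vec n = (\<chi> i. 2 * pi * of_int (n $ i))"

lemma lattice_vec_uminus: "lattice_vec (- n) = - lattice_vec n"
  by (simp add: lattice_vec_def vec_eq_iff)

text \<open>Uniqueness is asked only almost everywhere, so that closed sets qualify although they
  meet their own translates along boundary faces.\<close>

definition fundamental_domain :: "(real ^ 2) set \<Rightarrow> bool" where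
  "fundamental_domain T \<longleftrightarrow> T \<in> sets lebesgue \<and> (AE k in lebesgue. \<exists>!n. lattice_vec n + k \<in> T)"

lemma suminf_indicator_unique:
  assumes "\<exists>!n. P n"
  shows "(\<integral>\<^sup>+n. (if P n then 1 else 0) \<partial>count_space UNIV) = (1::ennreal)"
proof -
  from assms obtain m where m: "P n \<longleftrightarrow> n = m" for n by auto
  have "(\<integral>\<^sup>+n. (if P n then 1 else 0) \<partial>count_space UNIV) = (\<integral>\<^sup>+n. indicator {m} n \<partial>count_space UNIV)"
    by (intro nn_integral_cong) (auto simp: m)
  then show ?thesis by (subst (asm) nn_integral_indicator) auto
qed

text \<open>Almost everywhere exactly one lattice translate of the point lies in \<open>T2\<close>,
  so the sum of the indicators can be inserted as a factor 1; Tonelli then exchanges sum and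
  integral.\<close>

lemma nn_integral_tile:
  assumes T1: "T1 \<in> sets lebesgue" and T2: "fundamental_domain T2"
    and h: "h \<in> borel_measurable lebesgue"
  shows "(\<integral>\<^sup>+k\<in>T1. h k \<partial>lebesgue) =
    (\<integral>\<^sup>+n. \<integral>\<^sup>+k. h k * indicator T1 k * indicator T2 (lattice_vec n + k) \<partial>lebesgue \<partial>count_space UNIV)"
proof -
  have T2': "T2 \<in> sets lebesgue" and AE: "AE k in lebesgue. \<exists>!n. lattice_vec n + k \<in> T2"
    using T2 by (auto simp: fundamental_domain_def)
  have ind: "(\<lambda>k. indicator T2 (lattice_vec n + k) :: ennreal) \<in> borel_measurable lebesgue" for n
    using measurable_compose[OF measurable_add_lebesgue[of "lattice_vec n"] borel_measurable_indicator[OF T2']]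
    by simp
  have "(\<integral>\<^sup>+k\<in>T1. h k \<partial>lebesgue) = (\<integral>\<^sup>+k. \<integral>\<^sup>+n. h k * indicator T1 k * indicator T2 (lattice_vec n + k)
      \<partial>count_space UNIV \<partial>lebesgue)"
  proof (rule nn_integral_cong_AE, use AE in eventually_elim)
    fix k assume *: "\<exists>!n. lattice_vec n + k \<in> T2"
    show "h k * indicator T1 k = (\<integral>\<^sup>+n. h k * indicator T1 k * indicator T2 (lattice_vec n + k) \<partial>count_space UNIV)"
      using suminf_indicator_unique[OF *] by (simp add: nn_integral_cmult indicator_def of_bool_def)
  qed
  also have "\<dots> = (\<integral>\<^sup>+n. \<integral>\<^sup>+k. h k * indicator T1 k * indicator T2 (lattice_vec n + k) \<partial>lebesgue \<partial>count_space UNIV)"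
    using h T1 ind by (intro nn_integral_count_space_nn_integral) auto
  finally show ?thesis .
qed

text \<open>Tiling expands each side into integrals of \<open>h\<close> over the part of one domain
  that a lattice shift carries into the other. Translating the term for \<open>n\<close> by its own
  shift, which leaves \<open>h\<close> unchanged, exchanges the two domains and turns
  \<open>n\<close> into \<open>- n\<close>.\<close>

lemma nn_integral_fundamental_domain_eq:
  assumes T1: "fundamental_domain T1" and T2: "fundamental_domain T2"
    and h: "h \<in> borel_measurable lebesgue" and per: "\<And>n k. h (lattice_vec n + k) = h k"
  shows "(\<integral>\<^sup>+k\<in>T1. h k \<partial>lebesgue) = (\<integral>\<^sup>+k\<in>T2. h k \<partial>lebesgue)"
proof -
  have T: "T1 \<in> sets lebesgue" "T2 \<in> sets lebesgue"
    using T1 T2 by (auto simp: fundamental_domain_def)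
  have ind: "(\<lambda>k. indicator T1 (lattice_vec n + k) :: ennreal) \<in> borel_measurable lebesgue" for n
    using measurable_compose[OF measurable_add_lebesgue[of "lattice_vec n"] borel_measurable_indicator[OF T(1)]]
    by simp
  have "(\<integral>\<^sup>+k\<in>T1. h k \<partial>lebesgue) =
    (\<integral>\<^sup>+n. \<integral>\<^sup>+k. h k * indicator T1 k * indicator T2 (lattice_vec n + k) \<partial>lebesgue \<partial>count_space UNIV)"
    by (rule nn_integral_tile[OF T(1) T2 h])
  also have "\<dots> = (\<integral>\<^sup>+n. \<integral>\<^sup>+k. h k * indicator T2 k * indicator T1 (lattice_vec (-n) + k) \<partial>lebesgue \<partial>count_space UNIV)"
  proof (rule nn_integral_cong)
    fix n :: "int ^ 2"
    have "(\<integral>\<^sup>+k. h k * indicator T2 k * indicator T1 (lattice_vec (-n) + k) \<partial>lebesgue)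
      = (\<integral>\<^sup>+k. h (lattice_vec n + k) * indicator T2 (lattice_vec n + k) * indicator T1 (lattice_vec (-n) + (lattice_vec n + k)) \<partial>lebesgue)"
      using h T ind by (subst nn_integral_add_lebesgue) auto
    also have "\<dots> = (\<integral>\<^sup>+k. h k * indicator T1 k * indicator T2 (lattice_vec n + k) \<partial>lebesgue)"
      by (simp add: per lattice_vec_uminus mult_ac)
    finally show "(\<integral>\<^sup>+k. h k * indicator T1 k * indicator T2 (lattice_vec n + k) \<partial>lebesgue) =
       (\<integral>\<^sup>+k. h k * indicator T2 k * indicator T1 (lattice_vec (-n) + k) \<partial>lebesgue)" by simp
  qed
  also have "\<dots> = (\<integral>\<^sup>+n. \<integral>\<^sup>+k. h k * indicator T2 k * indicator T1 (lattice_vec n + k) \<partial>lebesgue \<partial>count_space UNIV)"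
    by (rule nn_integral_bij_count_space[of uminus UNIV UNIV]) (auto intro: bij_uminus)
  also have "\<dots> = (\<integral>\<^sup>+k\<in>T2. h k \<partial>lebesgue)"
    by (rule nn_integral_tile[OF T(2) T1 h, symmetric])
  finally show ?thesis .
qed

lemma periodic_lattice:
  fixes F :: "real ^ 2 \<Rightarrow> 'a"
  assumes per: "\<And>k j. F (k + axis j (2 * pi)) = F k"
  shows "F (lattice_vec n + k) = F k"
proof -
  have nat: "F (k + axis j (2 * pi * of_nat m)) = F k" for k j m
  proof (induction m)
    case (Suc m)
    have "k + axis j (2 * pi * of_nat (Suc m)) = (k + axis j (2 * pi * of_nat m)) + axis j (2 * pi)"
      by (simp add: vec_eq_iff axis_def algebra_simps)
    then show ?case using Suc per by metis
  qed (simp add: axis_def vec_eq_iff zero_vec_def[symmetric] flip: zero_vec_def)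
  have int: "F (k + axis j (2 * pi * of_int m)) = F k" for k j m
  proof (cases "m \<ge> 0")
    case True
    then show ?thesis using nat[of k j "nat m"] by simp
  next
    case False
    have "k = (k + axis j (2 * pi * of_int m)) + axis j (2 * pi * of_nat (nat (- m)))"
      using False by (simp add: vec_eq_iff axis_def algebra_simps)
    then show ?thesis using nat[of "k + axis j (2 * pi * of_int m)" j "nat (- m)"] by metis
  qed
  have "lattice_vec n + k = (k + axis 1 (2 * pi * of_int (n $ 1))) + axis 2 (2 * pi * of_int (n $ 2))"
    by (simp add: vec_eq_iff forall_2 lattice_vec_def axis_def)
  then show ?thesis using int by metis
qed

text \<open>The interval has the length of one period, so only its two endpoints can be hit by
  different translates. They are congruent, hence excluding \<open>c\<close> for all translates
  excludes both.\<close>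

lemma unique_lattice_shift:
  fixes x c :: real
  assumes "\<And>n::int. x + 2 * pi * of_int n \<noteq> c"
  shows "\<exists>!n::int. x + 2 * pi * of_int n \<in> {c .. c + 2 * pi}"
proof -
  define m where "m = \<lceil>(c - x) / (2 * pi)\<rceil>"
  have m: "of_int m - 1 < (c - x) / (2 * pi)" "(c - x) / (2 * pi) \<le> of_int m"
    unfolding m_def by linarith+
  have "c \<le> x + 2 * pi * of_int m" "x + 2 * pi * of_int m \<le> c + 2 * pi"
    using m by (simp_all add: field_simps)
  moreover have "n = m" if "x + 2 * pi * of_int n \<in> {c .. c + 2 * pi}" for n :: int
  proof -
    have "x + 2 * pi * of_int (n - 1) \<noteq> c" "x + 2 * pi * of_int n \<noteq> c" using assms by blast+
    then have "c < x + 2 * pi * of_int n" "x + 2 * pi * of_int n < c + 2 * pi"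
      using that by (auto simp: algebra_simps)
    then have "of_int (n - 1) < (c - x) / (2 * pi)" "(c - x) / (2 * pi) < of_int n"
      by (simp_all add: field_simps)
    then show "n = m" unfolding m_def by linarith
  qed
  ultimately show ?thesis by auto
qed

lemma AE_not_hyperplane_countable:
  fixes C :: "real set"
  assumes "countable C"
  shows "AE k in lebesgue. (k :: real ^ 2) $ i \<notin> C"
proof -
  have "negligible (\<Union>c\<in>C. {k :: real ^ 2. k $ i = c})"
    using assms proof (intro negligible_countable_Union countable_image; clarify)
    fix c assume "c \<in> C"
    have "(axis i 1 :: real ^ 2) \<in> Basis" by simp
    from negligible_standard_hyperplane[OF this, of c]
    show "negligible {k :: real ^ 2. k $ i = c}" by (simp add: inner_axis)
  qed
  then show ?thesis
    by (intro AE_I'[of "\<Union>c\<in>C. {k :: real ^ 2. k $ i = c}"]) (auto simp: negligible_iff_null_sets)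
qed

text \<open>Uniqueness can fail only if some translate of a coordinate hits the lower face, which
  happens on countably many hyperplanes. Elsewhere the two coordinates are shifted
  independently.\<close>

lemma fundamental_domain_cbox:
  fixes c :: "real ^ 2"
  shows "fundamental_domain (cbox c (c + (\<chi> i. 2 * pi)))"
  unfolding fundamental_domain_def
proof
  have cnt: "countable (range (\<lambda>n::int. c $ i - 2 * pi * of_int n))" for i by auto
  show "AE k in lebesgue. \<exists>!n. lattice_vec n + k \<in> cbox c (c + (\<chi> i. 2 * pi))"
    using AE_not_hyperplane_countable[OF cnt, of 1 1] AE_not_hyperplane_countable[OF cnt, of 2 2]
  proof eventually_elim
    fix k :: "real ^ 2"
    assume "k $ 1 \<notin> range (\<lambda>n::int. c $ 1 - 2 * pi * of_int n)" "k $ 2 \<notin> range (\<lambda>n::int. c $ 2 - 2 * pi * of_int n)"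
    then have ne: "k $ i + 2 * pi * of_int n \<noteq> c $ i" for n :: int and i
      using exhaust_2[of i] by (auto simp: image_iff algebra_simps)
    have U: "\<exists>!n::int. k $ i + 2 * pi * of_int n \<in> {c $ i .. c $ i + 2 * pi}" for i
      by (rule unique_lattice_shift) (rule ne)
    obtain m where m: "k $ i + 2 * pi * of_int n \<in> {c $ i .. c $ i + 2 * pi} \<longleftrightarrow> n = m i" for i n
      using U by metis
    have "lattice_vec n + k \<in> cbox c (c + (\<chi> i. 2 * pi)) \<longleftrightarrow> n = (\<chi> i. m i)" for n
      using m by (simp add: mem_box_cart lattice_vec_def vec_eq_iff add.commute)
    then show "\<exists>!n. lattice_vec n + k \<in> cbox c (c + (\<chi> i. 2 * pi))" by auto
  qed
qed auto

lemma fundamental_domain_torus_box: "fundamental_domain torus_box"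
  using fundamental_domain_cbox[of "\<chi> i. - pi"]
  by (simp add: torus_box_def plus_vec_def)

section \<open>Orthogonality of the Fourier modes\<close>

definition kdot :: "real ^ 2 \<Rightarrow> int ^ 2 \<Rightarrow> real" where
  "kdot k x = (\<Sum>j\<in>UNIV. k $ j * of_int (x $ j))"

lemma kdot_add: "kdot (k + k') x = kdot k x + kdot k' x"
  by (simp add: kdot_def algebra_simps sum.distrib)

lemma kdot_diff: "kdot k (x - y) = kdot k x - kdot k y"
  by (simp add: kdot_def algebra_simps sum_subtractf)

lemma kdot_axis: "kdot (axis j c) x = c * of_int (x $ j)"
  by (simp add: kdot_def axis_def if_distrib if_distribR sum.delta cong: if_cong)

lemma continuous_kdot [continuous_intros]: "continuous_on S (\<lambda>k. kdot k x)"
  unfolding kdot_def by (intro continuous_intros)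

lemma set_integrable_torus_box:
  fixes f :: "real ^ 2 \<Rightarrow> 'a::{banach, second_countable_topology}"
  assumes "continuous_on UNIV f"
  shows "set_integrable lebesgue torus_box f"
proof -
  have "set_integrable lborel torus_box f"
    unfolding set_integrable_def
    by (rule borel_integrable_compact) (auto simp: torus_box_def intro: continuous_on_subset[OF assms])
  then show ?thesis
    unfolding set_integrable_def by (intro integrable_completion[THEN iffD2]) auto
qed

lemma set_nn_integral_eq_set_integral:
  fixes f :: "'a \<Rightarrow> real"
  assumes "set_integrable M A f" "\<And>x. 0 \<le> f x"
  shows "(\<integral>\<^sup>+x\<in>A. ennreal (f x) \<partial>M) = ennreal (LINT x:A|M. f x)"
proof -
  have "(\<integral>\<^sup>+x\<in>A. ennreal (f x) \<partial>M) = (\<integral>\<^sup>+x. ennreal (indicator A x *\<^sub>R f x) \<partial>M)"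
    by (intro nn_integral_cong) (auto simp: indicator_def)
  then show ?thesis
    using assms unfolding set_integrable_def set_lebesgue_integral_def
    by (simp add: nn_integral_eq_integral)
qed

text \<open>Translating the fundamental domain by half a period of the cosine changes its sign.\<close>

lemma integral_cos_kdot:
  assumes "m \<noteq> 0"
  shows "(LINT k:torus_box|lebesgue. cos (kdot k m + \<phi>)) = 0"
proof -
  obtain j where j: "m $ j \<noteq> 0" using assms by (auto simp: vec_eq_iff)
  define t :: "real ^ 2" where "t = axis j (pi / of_int (m $ j))"
  have t: "kdot t m = pi" using j by (simp add: t_def kdot_axis)
  define c :: "real ^ 2" where "c = (\<chi> i. - pi)"
  define w :: "real ^ 2" where "w = (\<chi> i. 2 * pi)"
  have box: "torus_box = cbox c (c + w)" by (simp add: torus_box_def c_def w_def plus_vec_def)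
  have T': "(t + k \<in> cbox (t + c) (t + c + w)) = (k \<in> torus_box)" for k
    by (auto simp: box mem_box_cart)
  have fd: "fundamental_domain (cbox (t + c) (t + c + w))" "fundamental_domain torus_box"
    using fundamental_domain_cbox fundamental_domain_torus_box by (auto simp: w_def)
  \<comment> \<open>The added 1 makes the integrand nonnegative, so that the comparison of
    fundamental domains applies; it cancels at the end.\<close>
  define h where "h k = ennreal (1 + cos (kdot k m + \<phi>))" for k
  have [measurable]: "(\<lambda>k. kdot k m) \<in> borel_measurable lebesgue"
    by (intro measurable_completion borel_measurable_continuous_onI continuous_intros)
      (auto intro!: borel_measurable_continuous_onI continuous_intros)
  have h: "h \<in> borel_measurable lebesgue" unfolding h_def by measurable
  have per: "h (lattice_vec n + k) = h k" for n k
  proof (rule periodic_lattice)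
    fix k j
    have "kdot (k + axis j (2 * pi)) m + \<phi> = (kdot k m + \<phi>) + 2 * pi * of_int (m $ j)"
      by (simp add: kdot_add kdot_axis)
    then show "h (k + axis j (2 * pi)) = h k" unfolding h_def
      by (simp only: cos_add sin_int_2pin cos_int_2pin) simp
  qed
  have int: "set_integrable lebesgue torus_box (\<lambda>k. cos (kdot k m + \<phi>))" "set_integrable lebesgue torus_box (\<lambda>k. 1::real)"
    by (auto intro!: set_integrable_torus_box continuous_intros)
  have "(\<integral>\<^sup>+k\<in>torus_box. h k \<partial>lebesgue) = (\<integral>\<^sup>+k\<in>cbox (t + c) (t + c + w). h k \<partial>lebesgue)"
    by (rule nn_integral_fundamental_domain_eq) (use fd h per in auto)
  also have "\<dots> = (\<integral>\<^sup>+k. h (t + k) * indicator (cbox (t + c) (t + c + w)) (t + k) \<partial>lebesgue)"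
    by (intro nn_integral_add_lebesgue[symmetric] borel_measurable_times_ennreal h borel_measurable_indicator) simp
  also have "\<dots> = (\<integral>\<^sup>+k\<in>torus_box. ennreal (1 - cos (kdot k m + \<phi>)) \<partial>lebesgue)"
  proof (rule nn_integral_cong)
    fix k
    have "kdot (t + k) m + \<phi> = (kdot k m + \<phi>) + pi" by (simp add: kdot_add t)
    then have "h (t + k) = ennreal (1 - cos (kdot k m + \<phi>))" unfolding h_def by (simp only: cos_periodic_pi) simp
    then show "h (t + k) * indicator (cbox (t + c) (t + c + w)) (t + k) = ennreal (1 - cos (kdot k m + \<phi>)) * indicator torus_box k"
      using T'[of k] by (simp add: indicator_def)
  qed
  finally have eq: "(\<integral>\<^sup>+k\<in>torus_box. ennreal (1 + cos (kdot k m + \<phi>)) \<partial>lebesgue) =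
      (\<integral>\<^sup>+k\<in>torus_box. ennreal (1 - cos (kdot k m + \<phi>)) \<partial>lebesgue)" unfolding h_def .
  have pos: "0 \<le> 1 + cos x" "0 \<le> 1 - cos x" for x :: real
    using cos_ge_minus_one[of x] cos_le_one[of x] by linarith+
  have ge: "0 \<le> (LINT k:torus_box|lebesgue. 1 + cos (kdot k m + \<phi>))" "0 \<le> (LINT k:torus_box|lebesgue. 1 - cos (kdot k m + \<phi>))"
    unfolding set_lebesgue_integral_def by (intro integral_nonneg_AE; use pos in \<open>auto simp: indicator_def\<close>)+
  have "(LINT k:torus_box|lebesgue. 1 + cos (kdot k m + \<phi>)) = (LINT k:torus_box|lebesgue. 1 - cos (kdot k m + \<phi>))"
    using eq pos ge int by (subst (asm) (1 2) set_nn_integral_eq_set_integral)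
      (auto intro!: set_integral_add set_integral_diff)
  then show ?thesis using int by (simp add: set_integral_add set_integral_diff)
qed

lemma measure_torus_box: "measure lebesgue torus_box = 4 * pi\<^sup>2"
  unfolding torus_box_def measure_completion[OF sets_lborel[THEN equalityD2, THEN subsetD, OF borel_closed[OF closed_cbox]]]
  by (subst content_cbox_cart) (auto simp: interval_eq_empty_cart prod_constant power2_eq_square)

text \<open>The argument of the coefficient \<open>c\<close> becomes the phase of a cosine, which is
  why the cosine integral was computed with an arbitrary phase.\<close>

lemma integral_Re_cis_kdot:
  "(LINT k:torus_box|lebesgue. Re (c * cis (kdot k m))) = (if m = 0 then 4 * pi\<^sup>2 * Re c else 0)"
proof (cases "m = 0")
  case True
  have "(LINT k:torus_box|lebesgue. Re c) = 4 * pi\<^sup>2 * Re c"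
    by (subst set_integral_const) (auto simp: measure_torus_box, auto simp: torus_box_def emeasure_lborel_cbox_eq)
  then show ?thesis using True by (simp add: kdot_def)
next
  case False
  have "Re (c * cis (kdot k m)) = cmod c * cos (kdot k m + Arg c)" for k
  proof -
    have "c * cis (kdot k m) = rcis (cmod c) (Arg c) * rcis 1 (kdot k m)"
      by (simp add: rcis_cmod_Arg cis_rcis_eq)
    then show ?thesis by (simp add: rcis_mult add.commute)
  qed
  then show ?thesis using False integral_cos_kdot[OF False] by simp
qed

lemma fourier_partial_nth:
  "fourier_partial \<Psi> X k $ i = (\<Sum>x\<in>X. cis (- kdot k x) * \<Psi> x $ i)"
  by (simp add: fourier_partial_def kdot_def)

lemma continuous_on_cis_comp [continuous_intros]:
  "continuous_on S f \<Longrightarrow> continuous_on S (\<lambda>x. cis (f x))"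
  unfolding cis_conv_exp by (intro continuous_intros)

lemma continuous_fourier_partial: "continuous_on S (fourier_partial \<Psi> X)"
proof -
  have "continuous_on S (\<lambda>k. \<chi> i. fourier_partial \<Psi> X k $ i)"
    unfolding fourier_partial_nth by (intro continuous_intros)
  then show ?thesis by simp
qed

text \<open>Expanding the squared modulus gives a double sum of modes with frequency
  \<open>y - x\<close>, of which only the diagonal survives integration.\<close>

lemma integral_norm_fourier_partial_nth:
  assumes "finite X"
  shows "(LINT k:torus_box|lebesgue. (norm (fourier_partial \<Psi> X k $ i))\<^sup>2)
    = 4 * pi\<^sup>2 * (\<Sum>x\<in>X. (norm (\<Psi> x $ i))\<^sup>2)"
proof -
  have *: "(norm (fourier_partial \<Psi> X k $ i))\<^sup>2 =
     (\<Sum>x\<in>X. \<Sum>y\<in>X. Re (\<Psi> x $ i * cnj (\<Psi> y $ i) * cis (kdot k (y - x))))" for k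
  proof -
    have "(norm (fourier_partial \<Psi> X k $ i))\<^sup>2 = Re (fourier_partial \<Psi> X k $ i * cnj (fourier_partial \<Psi> X k $ i))"
      by (metis Re_complex_of_real complex_norm_square)
    also have "\<dots> = (\<Sum>x\<in>X. \<Sum>y\<in>X. Re ((cis (- kdot k x) * \<Psi> x $ i) * cnj (cis (- kdot k y) * \<Psi> y $ i)))"
      by (simp only: fourier_partial_nth cnj_sum sum_product Re_sum)
    also have "\<dots> = (\<Sum>x\<in>X. \<Sum>y\<in>X. Re (\<Psi> x $ i * cnj (\<Psi> y $ i) * cis (kdot k (y - x))))"
    proof (intro sum.cong refl)
      fix x y
      have "cis (- kdot k x) * cis (kdot k y) = cis (kdot k (y - x))" by (simp add: cis_mult kdot_diff)
      then show "Re ((cis (- kdot k x) * \<Psi> x $ i) * cnj (cis (- kdot k y) * \<Psi> y $ i)) = Re (\<Psi> x $ i * cnj (\<Psi> y $ i) * cis (kdot k (y - x)))"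
        by (simp only: complex_cnj_mult cis_cnj minus_minus mult_ac) (metis mult.assoc mult.commute)
    qed
    finally show ?thesis .
  qed
  have "(LINT k:torus_box|lebesgue. (norm (fourier_partial \<Psi> X k $ i))\<^sup>2) =
     (\<Sum>x\<in>X. \<Sum>y\<in>X. LINT k:torus_box|lebesgue. Re (\<Psi> x $ i * cnj (\<Psi> y $ i) * cis (kdot k (y - x))))"
    unfolding * set_lebesgue_integral_def scaleR_sum_right
  proof (subst Bochner_Integration.integral_sum, goal_cases)
    case (1 x)
    have "set_integrable lebesgue torus_box (\<lambda>k. \<Sum>y\<in>X. Re (\<Psi> x $ i * cnj (\<Psi> y $ i) * cis (kdot k (y - x))))"
      by (intro set_integrable_torus_box continuous_intros)
    then show ?case by (simp add: set_integrable_def scaleR_sum_right sum_distrib_left)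
  next
    case 2
    show ?case
    proof (intro sum.cong refl, subst Bochner_Integration.integral_sum, goal_cases)
      case (1 x y)
      have "set_integrable lebesgue torus_box (\<lambda>k. Re (\<Psi> x $ i * cnj (\<Psi> y $ i) * cis (kdot k (y - x))))"
        by (intro set_integrable_torus_box continuous_intros)
      then show ?case by (simp add: set_integrable_def)
    qed simp
  qed
  also have "\<dots> = (\<Sum>x\<in>X. \<Sum>y\<in>X. if x = y then 4 * pi\<^sup>2 * (norm (\<Psi> x $ i))\<^sup>2 else 0)"
    unfolding integral_Re_cis_kdot
    by (intro sum.cong refl) (auto simp flip: complex_norm_square of_real_power)
  also have "\<dots> = 4 * pi\<^sup>2 * (\<Sum>x\<in>X. (norm (\<Psi> x $ i))\<^sup>2)"
    using assms by (simp add: sum.delta' sum_distrib_left)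
  finally show ?thesis .
qed

lemma nn_integral_norm_fourier_partial_nth:
  assumes "finite X"
  shows "(\<integral>\<^sup>+k\<in>torus_box. ennreal ((norm (fourier_partial \<Psi> X k $ i))\<^sup>2) \<partial>lebesgue)
    = ennreal (4 * pi\<^sup>2 * (\<Sum>x\<in>X. (norm (\<Psi> x $ i))\<^sup>2))"
  using assms by (subst set_nn_integral_eq_set_integral)
    (auto simp: integral_norm_fourier_partial_nth intro!: set_integrable_torus_box continuous_intros continuous_fourier_partial)

lemma norm_sq_vec2: "(norm (z :: complex ^ 2))\<^sup>2 = (norm (z $ 1))\<^sup>2 + (norm (z $ 2))\<^sup>2"
  by (simp add: norm_vec_def L2_set_def sum_2)

lemma nn_integral_norm_fourier_partial:
  assumes "finite X"
  shows "(\<integral>\<^sup>+k\<in>torus_box. ennreal ((norm (fourier_partial \<Psi> X k))\<^sup>2) \<partial>lebesgue)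
    = ennreal (4 * pi\<^sup>2 * (\<Sum>x\<in>X. (norm (\<Psi> x))\<^sup>2))"
proof -
  have int: "set_integrable lebesgue torus_box (\<lambda>k. (norm (fourier_partial \<Psi> X k $ i))\<^sup>2)" for i
    by (intro set_integrable_torus_box continuous_intros continuous_fourier_partial)
  show ?thesis
    using assms int
    by (subst set_nn_integral_eq_set_integral)
      (auto simp: norm_sq_vec2 set_integral_add integral_norm_fourier_partial_nth sum.distrib algebra_simps
         intro!: set_integral_add)
qed

section \<open>The Fourier transform on square-summable states\<close>

definition square_summable :: "state \<Rightarrow> bool" where
  "square_summable \<Psi> \<longleftrightarrow> (\<lambda>x. (norm (\<Psi> x))\<^sup>2) summable_on UNIV"

text \<open>As a single partial sum of a state with coefficients 1, 0 and -1, the difference falls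
  under the identity already known for finite sums.\<close>

lemma fourier_partial_diff:
  assumes "finite X" "finite Y"
  shows "fourier_partial \<Psi> X k - fourier_partial \<Psi> Y k =
    fourier_partial (\<lambda>x. (of_bool (x \<in> X) - of_bool (x \<in> Y)) *s \<Psi> x) (X \<union> Y) k"
proof (rule vec_eq_iff[THEN iffD2], rule allI)
  fix i
  have "(\<Sum>x\<in>X. cis (- kdot k x) * \<Psi> x $ i) = (\<Sum>x\<in>X \<union> Y. of_bool (x \<in> X) * (cis (- kdot k x) * \<Psi> x $ i))"
    using assms by (intro sum.mono_neutral_cong_left) auto
  moreover have "(\<Sum>x\<in>Y. cis (- kdot k x) * \<Psi> x $ i) = (\<Sum>x\<in>X \<union> Y. of_bool (x \<in> Y) * (cis (- kdot k x) * \<Psi> x $ i))"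
    using assms by (intro sum.mono_neutral_cong_left) auto
  ultimately show "(fourier_partial \<Psi> X k - fourier_partial \<Psi> Y k) $ i =
    fourier_partial (\<lambda>x. (of_bool (x \<in> X) - of_bool (x \<in> Y)) *s \<Psi> x) (X \<union> Y) k $ i"
    by (simp add: fourier_partial_nth algebra_simps flip: sum_subtractf)
qed

lemma nn_integral_fourier_partial_diff:
  assumes "finite X" "finite Y"
  shows "(\<integral>\<^sup>+k\<in>torus_box. ennreal ((norm (fourier_partial \<Psi> X k - fourier_partial \<Psi> Y k))\<^sup>2) \<partial>lebesgue)
    = ennreal (4 * pi\<^sup>2 * (\<Sum>x\<in>(X - Y) \<union> (Y - X). (norm (\<Psi> x))\<^sup>2))"
proof -
  have "(\<Sum>x\<in>X \<union> Y. (norm ((of_bool (x \<in> X) - of_bool (x \<in> Y)) *s \<Psi> x :: complex ^ 2))\<^sup>2)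
      = (\<Sum>x\<in>(X - Y) \<union> (Y - X). (norm (\<Psi> x))\<^sup>2)"
    using assms by (intro sum.mono_neutral_cong_right) (auto simp: norm_sq_vec2)
  then show ?thesis
    using assms by (simp add: fourier_partial_diff nn_integral_norm_fourier_partial)
qed

text \<open>Choose \<open>M\<close> to carry all but \<open>e\<close> of the total; by nonnegativity
  a finite set disjoint from it can add at most \<open>e\<close>.\<close>

lemma summable_on_tail:
  fixes N :: "'a \<Rightarrow> real"
  assumes "N summable_on UNIV" "\<And>x. 0 \<le> N x" "0 < e"
  shows "\<exists>M. finite M \<and> (\<forall>Z. finite Z \<longrightarrow> Z \<inter> M = {} \<longrightarrow> sum N Z \<le> e)"
proof -
  have "(N has_sum infsum N UNIV) UNIV" using assms(1) by simp
  then have "(sum N \<longlongrightarrow> infsum N UNIV) (finite_subsets_at_top UNIV)" by (simp add: has_sum_def)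
  then have "\<forall>\<^sub>F X in finite_subsets_at_top UNIV. infsum N UNIV - e < sum N X"
    using assms(3) by (intro order_tendstoD(1)) auto
  then obtain M where M: "finite M" "\<And>X. finite X \<Longrightarrow> M \<subseteq> X \<Longrightarrow> infsum N UNIV - e < sum N X"
    by (auto simp: eventually_finite_subsets_at_top)
  have "sum N Z \<le> e" if "finite Z" "Z \<inter> M = {}" for Z
  proof -
    have "sum N Z + sum N M = sum N (Z \<union> M)" using that M by (simp add: sum.union_disjoint)
    also have "\<dots> \<le> infsum N UNIV"
      using that M assms by (intro finite_sum_le_infsum) auto
    finally show ?thesis using M(2)[of M] M(1) by simp
  qed
  then show ?thesis using M(1) by blast
qed

lemma borel_measurable_fourier_partial [measurable]:
  "fourier_partial \<Psi> X \<in> borel_measurable lebesgue"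
  by (intro measurable_completion) (auto intro!: borel_measurable_continuous_onI continuous_fourier_partial)

lemma torus_box_sets [measurable]: "torus_box \<in> sets lebesgue"
  by (simp add: torus_box_def)

lemma emeasure_torus_box: "emeasure lebesgue torus_box = ennreal (4 * pi\<^sup>2)"
  by (subst emeasure_eq_ennreal_measure)
    (auto simp: measure_torus_box, auto simp: torus_box_def emeasure_lborel_cbox_eq)

lemma fourier_partial_periodic: "fourier_partial \<Psi> X (k + axis j (2 * pi)) = fourier_partial \<Psi> X k"
proof -
  have "cis (- kdot (k + axis j (2 * pi)) x) = cis (- kdot k x)" for x
  proof -
    have "cis (- kdot (k + axis j (2 * pi)) x) = cis (- kdot k x) * cis (2 * pi * of_int (- (x $ j)))"
      by (simp add: kdot_add kdot_axis cis_mult)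
    also have "cis (2 * pi * of_int (- (x $ j))) = 1" by (rule cis_multiple_2pi) auto
    finally show ?thesis by simp
  qed
  then show ?thesis by (simp add: vec_eq_iff fourier_partial_nth)
qed

text \<open>Without this existence the choice in \<open>fourier\<close> would carry no information.
  Along the increasing sets \<open>X n\<close> the partial sums converge almost everywhere, because
  their consecutive distances are summable in mean. Fatou's lemma then bounds the mean-square
  distance of the limit to every partial sum over a finite set containing \<open>M m\<close>, which
  is convergence along the whole net and not just along the sequence.\<close>

lemma riesz_fischer:
  assumes "square_summable \<Psi>"
  shows "\<exists>F. is_fourier \<Psi> F"
proof -
  let ?N = "\<lambda>x. (norm (\<Psi> x))\<^sup>2"
  \<comment> \<open>The rate 1/4 leaves a summable (1/2)^n after the weight 2^n used below to pass
    from squared distances to distances.\<close>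
  have "\<forall>n::nat. \<exists>M. finite M \<and> (\<forall>Z. finite Z \<longrightarrow> Z \<inter> M = {} \<longrightarrow> sum ?N Z \<le> (1/4)^n)"
    using assms unfolding square_summable_def by (intro allI summable_on_tail) auto
  then obtain M where fin: "\<And>n. finite (M n)"
    and M: "\<And>n Z. finite Z \<Longrightarrow> Z \<inter> M n = {} \<Longrightarrow> sum ?N Z \<le> (1/4)^n"
    by metis
  define X where "X n = (\<Union>m\<le>n. M m)" for n
  have X: "finite (X n)" "m \<le> n \<Longrightarrow> M m \<subseteq> X n" for m n using fin by (auto simp: X_def)
  let ?f = "fourier_partial \<Psi>"
  have D: "(\<integral>\<^sup>+k\<in>torus_box. ennreal ((norm (?f Y k - ?f Z k))\<^sup>2) \<partial>lebesgue) \<le> ennreal (4 * pi\<^sup>2 * (1/4)^n)"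
    if "finite Y" "finite Z" "M n \<subseteq> Y" "M n \<subseteq> Z" for Y Z n
  proof -
    have "sum ?N ((Y - Z) \<union> (Z - Y)) \<le> (1/4)^n" using that by (intro M) auto
    then show ?thesis using that by (subst nn_integral_fourier_partial_diff) (auto intro!: ennreal_leI mult_left_mono)
  qed
  define d where "d n k = norm (?f (X (Suc n)) k - ?f (X n) k)" for n k
  have [measurable]: "d n \<in> borel_measurable lebesgue" for n unfolding d_def by measurable
  have d1: "(\<integral>\<^sup>+k\<in>torus_box. ennreal (d n k) \<partial>lebesgue) \<le> ennreal (8 * pi\<^sup>2 * (1/2)^n)" for n
  proof -
    \<comment> \<open>This pointwise bound takes the place of Cauchy-Schwarz on the box: either
      \<open>d n k\<close> is below (1/2)^n, or multiplying it by 2^n * \<open>d n k\<close>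
      enlarges it.\<close>
    have "d n k \<le> 2^n * (d n k)\<^sup>2 + (1/2)^n" for k
    proof (cases "d n k * 2^n \<le> 1")
      case True
      then have "d n k \<le> (1/2)^n" by (simp add: power_one_over field_simps)
      then show ?thesis by (simp add: add_increasing)
    next
      case False
      then have "d n k * 1 \<le> d n k * (d n k * 2^n)" by (intro mult_left_mono) (auto simp: d_def)
      then have "d n k \<le> 2^n * (d n k)\<^sup>2" by (simp add: power2_eq_square algebra_simps)
      then show ?thesis by (simp add: add_increasing2)
    qed
    then have "(\<integral>\<^sup>+k\<in>torus_box. ennreal (d n k) \<partial>lebesgue) \<le>
      (\<integral>\<^sup>+k. ennreal (2^n) * (ennreal ((d n k)\<^sup>2) * indicator torus_box k) + ennreal ((1/2)^n) * indicator torus_box k \<partial>lebesgue)"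
      by (intro nn_integral_mono) (auto simp: indicator_def ennreal_leI simp flip: ennreal_mult ennreal_plus)
    also have "\<dots> = ennreal (2^n) * (\<integral>\<^sup>+k\<in>torus_box. ennreal ((d n k)\<^sup>2) \<partial>lebesgue) + ennreal ((1/2)^n) * ennreal (4 * pi\<^sup>2)"
      by (subst nn_integral_add) (auto simp: nn_integral_cmult nn_integral_cmult_indicator emeasure_torus_box)
    also have "\<dots> \<le> ennreal (2^n) * ennreal (4 * pi\<^sup>2 * (1/4)^n) + ennreal ((1/2)^n) * ennreal (4 * pi\<^sup>2)"
      unfolding d_def by (intro add_mono mult_left_mono D X) auto
    also have "\<dots> = ennreal (8 * pi\<^sup>2 * (1/2)^n)"
    proof -
      have "(2::real)^n * (1/4)^n = (1/2)^n" by (simp flip: power_mult_distrib)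
      then have "2^n * (4 * pi\<^sup>2 * (1/4)^n) + (1/2)^n * (4 * pi\<^sup>2) = 8 * pi\<^sup>2 * (1/2)^n"
        by (simp add: algebra_simps)
      then show ?thesis by (simp flip: ennreal_mult ennreal_plus)
    qed
    finally show ?thesis .
  qed
  have "(\<integral>\<^sup>+k. (\<Sum>n. ennreal (d n k) * indicator torus_box k) \<partial>lebesgue) = (\<Sum>n. \<integral>\<^sup>+k\<in>torus_box. ennreal (d n k) \<partial>lebesgue)"
    by (intro nn_integral_suminf) auto
  also have "\<dots> \<le> (\<Sum>n. ennreal (8 * pi\<^sup>2 * (1/2)^n))"
    by (intro suminf_le d1) auto
  also have "\<dots> < \<infinity>"
    by (subst suminf_ennreal2) (auto intro!: summable_mult)
  finally have "AE k in lebesgue. (\<Sum>n. ennreal (d n k) * indicator torus_box k) \<noteq> \<infinity>"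
    by (intro nn_integral_noteq_infinite) auto
  then have conv: "AE k in lebesgue. k \<in> torus_box \<longrightarrow> convergent (\<lambda>n. ?f (X n) k)"
  proof eventually_elim
    fix k assume *: "(\<Sum>n. ennreal (d n k) * indicator torus_box k) \<noteq> \<infinity>"
    show "k \<in> torus_box \<longrightarrow> convergent (\<lambda>n. ?f (X n) k)"
    proof
      assume "k \<in> torus_box"
      then have "summable (\<lambda>n. d n k)" using * by (intro summable_suminf_not_top) (auto simp: d_def)
      then have "summable (\<lambda>n. ?f (X (Suc n)) k - ?f (X n) k)"
        unfolding d_def by (rule summable_norm_cancel)
      then have "convergent (\<lambda>n. \<Sum>i<n. ?f (X (Suc i)) k - ?f (X i) k)"
        by (simp add: summable_iff_convergent)
      then have "convergent (\<lambda>n. ?f (X n) k - ?f (X 0) k)"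
        by (simp add: sum_lessThan_telescope[of "\<lambda>n. ?f (X n) k"])
      from convergent_add[OF this convergent_const[of "?f (X 0) k"]]
      show "convergent (\<lambda>n. ?f (X n) k)" by simp
    qed
  qed
  \<comment> \<open>The value of \<open>lim\<close> depends on the sequence alone, also where the
    sequence diverges. Hence \<open>F\<close> inherits periodicity at every point, as
    \<open>is_fourier\<close> demands.\<close>
  define F where "F k = lim (\<lambda>n. ?f (X n) k)" for k
  have F_meas [measurable]: "F \<in> borel_measurable lebesgue" unfolding F_def by measurable
  have bound: "(\<integral>\<^sup>+k\<in>torus_box. ennreal ((norm (F k - ?f Y k))\<^sup>2) \<partial>lebesgue) \<le> ennreal (4 * pi\<^sup>2 * (1/4)^m)"
    if Y: "finite Y" "M m \<subseteq> Y" for Y m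
  proof -
    \<comment> \<open>The index is shifted by \<open>m\<close> so that every
      \<open>X (n + m)\<close> contains \<open>M m\<close> and the bound \<open>D\<close> holds for
      all terms.\<close>
    let ?u = "\<lambda>n k. ennreal ((norm (?f (X (n + m)) k - ?f Y k))\<^sup>2) * indicator torus_box k"
    have "(\<integral>\<^sup>+k\<in>torus_box. ennreal ((norm (F k - ?f Y k))\<^sup>2) \<partial>lebesgue) = (\<integral>\<^sup>+k. liminf (\<lambda>n. ?u n k) \<partial>lebesgue)"
    proof (rule nn_integral_cong_AE, use conv in eventually_elim)
      fix k assume *: "k \<in> torus_box \<longrightarrow> convergent (\<lambda>n. ?f (X n) k)"
      show "ennreal ((norm (F k - ?f Y k))\<^sup>2) * indicator torus_box k = liminf (\<lambda>n. ?u n k)"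
      proof (cases "k \<in> torus_box")
        case True
        then have "(\<lambda>n. ?f (X n) k) \<longlonglongrightarrow> F k" using * by (simp add: F_def convergent_LIMSEQ_iff)
        then have "(\<lambda>n. ?f (X (n + m)) k) \<longlonglongrightarrow> F k" by (rule LIMSEQ_ignore_initial_segment)
        then have "(\<lambda>n. ennreal ((norm (?f (X (n + m)) k - ?f Y k))\<^sup>2)) \<longlonglongrightarrow> ennreal ((norm (F k - ?f Y k))\<^sup>2)"
          by (intro tendsto_intros)
        from lim_imp_Liminf[OF _ this] True show ?thesis by simp
      qed (simp add: Liminf_const)
    qed
    also have "\<dots> \<le> liminf (\<lambda>n. \<integral>\<^sup>+k. ?u n k \<partial>lebesgue)"
      by (intro nn_integral_liminf) measurable
    also have "\<dots> \<le> liminf (\<lambda>n::nat. ennreal (4 * pi\<^sup>2 * (1/4)^m))"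
      by (intro Liminf_mono always_eventually allI D X Y) auto
    finally show ?thesis by (simp add: Liminf_const)
  qed
  have "((\<lambda>Y. \<integral>\<^sup>+k\<in>torus_box. ennreal ((norm (F k - ?f Y k))\<^sup>2) \<partial>lebesgue) \<longlongrightarrow> 0) (finite_subsets_at_top UNIV)"
  proof (rule order_tendstoI)
    fix a :: ennreal assume a: "0 < a"
    have "(\<lambda>m. ennreal (4 * pi\<^sup>2 * (1/4)^m)) \<longlonglongrightarrow> ennreal (4 * pi\<^sup>2 * 0)"
      by (intro tendsto_ennrealI tendsto_intros LIMSEQ_power_zero) auto
    then have "\<forall>\<^sub>F m in sequentially. ennreal (4 * pi\<^sup>2 * (1/4)^m) < a"
      using a by (intro order_tendstoD) auto
    then obtain m where m: "ennreal (4 * pi\<^sup>2 * (1/4)^m) < a" by (auto simp: eventually_sequentially)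
    show "\<forall>\<^sub>F Y in finite_subsets_at_top UNIV. (\<integral>\<^sup>+k\<in>torus_box. ennreal ((norm (F k - ?f Y k))\<^sup>2) \<partial>lebesgue) < a"
      unfolding eventually_finite_subsets_at_top
      by (rule exI[of _ "M m"]) (use fin bound m in \<open>auto intro: le_less_trans\<close>)
  qed simp
  then have "is_fourier \<Psi> F"
    unfolding is_fourier_def using F_meas by (auto simp: F_def fourier_partial_periodic)
  then show ?thesis by blast
qed

lemma is_fourier_fourier: "square_summable \<Psi> \<Longrightarrow> is_fourier \<Psi> (fourier \<Psi>)"
  unfolding fourier_def by (rule someI_ex[OF riesz_fischer])

section \<open>Plancherel's identity for each spin component\<close>

lemma norm_sq_le_weighted:
  fixes p q :: "'a::real_normed_vector"
  assumes "e > 0"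
  shows "(norm p)\<^sup>2 \<le> (1 + e) * (norm q)\<^sup>2 + (1 + 1 / e) * (norm (p - q))\<^sup>2"
proof -
  have "norm p \<le> norm q + norm (p - q)" by (metis norm_triangle_sub add.commute)
  then have "(norm p)\<^sup>2 \<le> (norm q + norm (p - q))\<^sup>2" by (intro power_mono) auto
  \<comment> \<open>Young's inequality for the cross term. The free weight \<open>e\<close> keeps
    the factor of the main term as close to 1 as desired, at the cost of a large factor on the
    error.\<close>
  moreover have "0 \<le> (e * norm q - norm (p - q))\<^sup>2 / e" using assms by simp
  moreover have "(e * norm q - norm (p - q))\<^sup>2 / e = e * (norm q)\<^sup>2 + (1 / e) * (norm (p - q))\<^sup>2 - 2 * norm q * norm (p - q)"
    using assms by (simp add: field_simps power2_eq_square)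
  ultimately show ?thesis by (simp add: algebra_simps power2_eq_square)
qed

text \<open>The bound \<open>r\<close> is kept apart from \<open>p - q\<close> because the
  difference of one spin component will be dominated by the norm of the whole vector, whose mean
  square is what is known to tend to 0.\<close>

lemma set_nn_integral_weighted:
  fixes p q :: "'a \<Rightarrow> complex" and r :: "'a \<Rightarrow> real"
  assumes [measurable]: "p \<in> borel_measurable M" "q \<in> borel_measurable M" "r \<in> borel_measurable M" "A \<in> sets M"
    and "e > 0" and "\<And>x. norm (p x - q x) \<le> r x"
  shows "(\<integral>\<^sup>+x\<in>A. ennreal ((norm (p x))\<^sup>2) \<partial>M) \<le>
    ennreal (1 + e) * (\<integral>\<^sup>+x\<in>A. ennreal ((norm (q x))\<^sup>2) \<partial>M) + ennreal (1 + 1 / e) * (\<integral>\<^sup>+x\<in>A. ennreal ((r x)\<^sup>2) \<partial>M)"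
proof -
  have "(norm (p x))\<^sup>2 \<le> (1 + e) * (norm (q x))\<^sup>2 + (1 + 1 / e) * (r x)\<^sup>2" for x
    using norm_sq_le_weighted[OF assms(5), of "p x" "q x"] power_mono[OF assms(6)[of x], of 2] assms(5)
    by (smt (verit) mult_left_mono norm_ge_zero divide_pos_pos)
  then have "(\<integral>\<^sup>+x\<in>A. ennreal ((norm (p x))\<^sup>2) \<partial>M) \<le>
     (\<integral>\<^sup>+x. ennreal (1 + e) * (ennreal ((norm (q x))\<^sup>2) * indicator A x) + ennreal (1 + 1 / e) * (ennreal ((r x)\<^sup>2) * indicator A x) \<partial>M)"
    using assms(5) by (intro nn_integral_mono) (auto simp: indicator_def ennreal_leI simp flip: ennreal_mult ennreal_plus)
  also have "\<dots> = ennreal (1 + e) * (\<integral>\<^sup>+x\<in>A. ennreal ((norm (q x))\<^sup>2) \<partial>M) + ennreal (1 + 1 / e) * (\<integral>\<^sup>+x\<in>A. ennreal ((r x)\<^sup>2) \<partial>M)"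
    by (subst nn_integral_add) (auto simp: nn_integral_cmult)
  finally show ?thesis .
qed

lemma ennreal_le_factor:
  assumes "\<And>e. e > 0 \<Longrightarrow> x \<le> ennreal (1 + e) * ennreal r" "0 \<le> r"
  shows "x \<le> ennreal r"
proof (rule ennreal_le_epsilon)
  fix e :: real assume e: "0 < e"
  \<comment> \<open>Dividing by \<open>r + 1\<close> instead of \<open>r\<close> also covers
    \<open>r = 0\<close>, and r / (r + 1) is at most 1.\<close>
  have "x \<le> ennreal (1 + e / (r + 1)) * ennreal r" using e assms(2) by (intro assms) auto
  also have "\<dots> = ennreal (r + e * (r / (r + 1)))" using e assms(2) by (simp add: algebra_simps flip: ennreal_mult)
  also have "\<dots> \<le> ennreal (r + e * 1)" using e assms(2) by (intro ennreal_leI add_left_mono mult_left_mono) auto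
  finally show "x \<le> ennreal r + ennreal e" using e assms(2) by simp
qed

text \<open>The weighted inequality is used in both directions between \<open>F\<close> and a
  partial sum. Along the net of finite sets the error integral vanishes for fixed \<open>e\<close>,
  and afterwards \<open>e\<close> is let go to 0.\<close>

lemma plancherel_nth:
  assumes sq: "square_summable \<Psi>" and F: "is_fourier \<Psi> F"
  shows "(\<integral>\<^sup>+k\<in>torus_box. ennreal ((norm (F k $ i))\<^sup>2) \<partial>lebesgue) = ennreal (4 * pi\<^sup>2 * comp_norm_sq \<Psi> i)"
proof -
  let ?L = "finite_subsets_at_top (UNIV :: (int ^ 2) set)"
  let ?f = "fourier_partial \<Psi>"
  let ?A = "\<integral>\<^sup>+k\<in>torus_box. ennreal ((norm (F k $ i))\<^sup>2) \<partial>lebesgue"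
  let ?B = "\<lambda>X. \<integral>\<^sup>+k\<in>torus_box. ennreal ((norm (?f X k $ i))\<^sup>2) \<partial>lebesgue"
  let ?D = "\<lambda>X. \<integral>\<^sup>+k\<in>torus_box. ennreal ((norm (F k - ?f X k))\<^sup>2) \<partial>lebesgue"
  let ?S = "4 * pi\<^sup>2 * comp_norm_sq \<Psi> i"
  have [measurable]: "F \<in> borel_measurable lebesgue" and D: "(?D \<longlongrightarrow> 0) ?L"
    using F by (auto simp: is_fourier_def)
  have [measurable]: "(\<lambda>x. h x $ i) \<in> borel_measurable lebesgue"
    if "h \<in> borel_measurable lebesgue" for h :: "real ^ 2 \<Rightarrow> complex ^ 2"
    by (rule measurable_compose[OF that]) (auto intro!: borel_measurable_continuous_onI continuous_intros)
  have "(\<lambda>x. (norm (\<Psi> x $ i))\<^sup>2) summable_on UNIV"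
  proof (rule summable_on_comparison_test)
    show "(\<lambda>x. (norm (\<Psi> x))\<^sup>2) summable_on UNIV" using sq by (simp add: square_summable_def)
  qed (auto intro!: power_mono component_le_norm_cart simp: Finite_Cartesian_Product.norm_nth_le)
  then have S: "((\<lambda>x. (norm (\<Psi> x $ i))\<^sup>2) has_sum comp_norm_sq \<Psi> i) UNIV"
    by (simp add: comp_norm_sq_def)
  have S0: "0 \<le> ?S" unfolding comp_norm_sq_def by (simp add: infsum_nonneg)
  have fin: "\<forall>\<^sub>F X in ?L. finite X" by (rule eventually_finite_subsets_at_top_weakI) simp
  have B: "(?B \<longlongrightarrow> ennreal ?S) ?L"
  proof (rule Lim_transform_eventually)
    show "((\<lambda>X. ennreal (4 * pi\<^sup>2 * (\<Sum>x\<in>X. (norm (\<Psi> x $ i))\<^sup>2))) \<longlongrightarrow> ennreal ?S) ?L"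
      using S unfolding has_sum_def by (intro tendsto_ennrealI tendsto_intros)
    show "\<forall>\<^sub>F X in ?L. ennreal (4 * pi\<^sup>2 * (\<Sum>x\<in>X. (norm (\<Psi> x $ i))\<^sup>2)) = ?B X"
      using fin by eventually_elim (simp add: nn_integral_norm_fourier_partial_nth)
  qed
  have nth: "norm (F k $ i - ?f X k $ i) \<le> norm (F k - ?f X k)" "norm (?f X k $ i - F k $ i) \<le> norm (F k - ?f X k)" for X k
    using Finite_Cartesian_Product.norm_nth_le[of "F k - ?f X k" i] by (auto simp: norm_minus_commute)
  have "?A \<le> ennreal (1 + e) * ennreal ?S" if e: "e > 0" for e
  proof (rule tendsto_lowerbound)
    have "((\<lambda>X. ennreal (1 + e) * ?B X + ennreal (1 + 1 / e) * ?D X) \<longlongrightarrow> ennreal (1 + e) * ennreal ?S + ennreal (1 + 1 / e) * 0) ?L"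
      by (intro tendsto_add ennreal_tendsto_cmult B D) auto
    then show "((\<lambda>X. ennreal (1 + e) * ?B X + ennreal (1 + 1 / e) * ?D X) \<longlongrightarrow> ennreal (1 + e) * ennreal ?S) ?L" by simp
    show "\<forall>\<^sub>F X in ?L. ?A \<le> ennreal (1 + e) * ?B X + ennreal (1 + 1 / e) * ?D X"
      by (intro always_eventually allI set_nn_integral_weighted e nth) measurable
  qed simp
  then have le: "?A \<le> ennreal ?S" by (rule ennreal_le_factor) (use S0 in auto)
  \<comment> \<open>The upper bound makes the integral finite, so it can serve as the real
    right-hand side in the reverse comparison.\<close>
  then obtain a where a: "?A = ennreal a" "0 \<le> a" by (cases ?A) (auto simp: top_unique)
  have "ennreal ?S \<le> ennreal (1 + e) * ennreal a" if e: "e > 0" for e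
  proof (rule tendsto_le)
    have "((\<lambda>X. ennreal (1 + e) * ?A + ennreal (1 + 1 / e) * ?D X) \<longlongrightarrow> ennreal (1 + e) * ?A + ennreal (1 + 1 / e) * 0) ?L"
      by (intro tendsto_add ennreal_tendsto_cmult tendsto_const D) auto
    then show "((\<lambda>X. ennreal (1 + e) * ?A + ennreal (1 + 1 / e) * ?D X) \<longlongrightarrow> ennreal (1 + e) * ennreal a) ?L" by (simp add: a)
    show "\<forall>\<^sub>F X in ?L. ?B X \<le> ennreal (1 + e) * ?A + ennreal (1 + 1 / e) * ?D X"
      by (intro always_eventually allI set_nn_integral_weighted e nth) measurable
  qed (use B in simp_all)
  then have "ennreal ?S \<le> ?A" unfolding a(1) by (rule ennreal_le_factor) (use a in auto)
  then show ?thesis using le by simp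
qed

section \<open>The spectral weights of the two bands\<close>

text \<open>This is the sine of \<open>omega\<close>: half the distance between the two eigenvalues,
  and the denominator in \<open>velocity\<close>.\<close>

definition sig :: "real \<Rightarrow> real \<Rightarrow> real ^ 2 \<Rightarrow> real" where
  "sig a b k = sqrt (1 - (tau a b k)\<^sup>2)"

definition U_diag :: "real \<Rightarrow> real \<Rightarrow> real ^ 2 \<Rightarrow> complex" where
  "U_diag a b k = of_real a * cis (l1 k) - of_real b * cis (l2 k)"

definition U_offdiag :: "real \<Rightarrow> real \<Rightarrow> real ^ 2 \<Rightarrow> complex" where
  "U_offdiag a b k = of_real (2 * sqrt (a * b) * cos (k $ 1)) * cis (k $ 2)"

text \<open>With \<open>a + b = 1\<close> the off-diagonal coin entry is \<open>sqrt b\<close>. The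
  product has the standard SU(2) shape, in which the upper row fixes the lower one.\<close>

lemma U_hat_eq:
  assumes "0 \<le> a" "0 \<le> b" "a + b = 1"
  shows "U_hat (sqrt a) (sqrt a) k = vector [vector [U_diag a b k, U_offdiag a b k],
    vector [- cnj (U_offdiag a b k), cnj (U_diag a b k)]]"
proof -
  have q: "sqrt (1 - (sqrt a)\<^sup>2) = sqrt b" using assms by (auto intro!: arg_cong[where f = sqrt])
  define p q where pq: "p = complex_of_real (sqrt a)" "q = complex_of_real (sqrt b)"
  have a: "complex_of_real a = p * p" and b: "complex_of_real b = q * q"
    and ab: "complex_of_real (sqrt (a * b)) = p * q"
    using assms by (auto simp: pq real_sqrt_mult simp flip: of_real_mult)
  have c: "2 * complex_of_real (cos (k $ 1)) = cis (k $ 1) + cis (- k $ 1)"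
    by (simp add: complex_eq_iff)
  have l: "cis (l1 k) = cis (k $ 2) * cis (k $ 1)" "cis (l2 k) = cis (k $ 2) * cis (- k $ 1)"
    "cis (- l1 k) = cis (- k $ 2) * cis (- k $ 1)" "cis (- l2 k) = cis (- k $ 2) * cis (k $ 1)"
    by (simp_all add: l1_def l2_def cis_mult)
  have cnj: "cnj p = p" "cnj q = q" by (auto simp: pq)
  have off: "U_offdiag a b k = p * q * (cis (k $ 1) + cis (- k $ 1)) * cis (k $ 2)"
    unfolding U_offdiag_def c[symmetric] by (simp add: ab)
  show ?thesis
    unfolding U_hat_def coin_def Let_def q phase_matrix_def U_diag_def off
    by (simp add: vec_eq_iff forall_2 matrix_matrix_mult_def sum_2 a b l cis_cnj cnj algebra_simps flip: pq)
qed

text \<open>The second claim is the determinant condition. The cross term of the diagonal entry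
  cancels against the off-diagonal one because \<open>l1 k - l2 k\<close> is twice
  \<open>k $ 1\<close>, and what remains is the square of \<open>a + b\<close>.\<close>

lemma U_diag_offdiag:
  assumes "0 \<le> a" "0 \<le> b" "a + b = 1"
  shows "Re (U_diag a b k) = tau a b k"
    and "(Im (U_diag a b k))\<^sup>2 + (cmod (U_offdiag a b k))\<^sup>2 = 1 - (tau a b k)\<^sup>2"
proof -
  show "Re (U_diag a b k) = tau a b k" by (simp add: U_diag_def tau_def)
  have k1: "2 * (cos (k $ 1))\<^sup>2 = 1 + cos (l1 k - l2 k)"
    unfolding l1_def l2_def using cos_double_cos[of "k $ 1"] by (simp add: mult_2[symmetric])
  have "(cmod (U_offdiag a b k))\<^sup>2 = 4 * (a * b) * (cos (k $ 1))\<^sup>2"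
    using assms by (simp add: U_offdiag_def norm_mult power_mult_distrib abs_mult)
  also have "\<dots> = 2 * (a * b) * (1 + cos (l1 k - l2 k))" by (simp flip: k1)
  finally have off: "(cmod (U_offdiag a b k))\<^sup>2 = 2 * (a * b) * (1 + cos (l1 k - l2 k))" .
  have im: "Im (U_diag a b k) = a * sin (l1 k) - b * sin (l2 k)" by (simp add: U_diag_def)
  have "(Im (U_diag a b k))\<^sup>2 + (tau a b k)\<^sup>2 = a\<^sup>2 * ((cos (l1 k))\<^sup>2 + (sin (l1 k))\<^sup>2) + b\<^sup>2 * ((cos (l2 k))\<^sup>2 + (sin (l2 k))\<^sup>2)
      - 2 * (a * b) * cos (l1 k - l2 k)"
    unfolding cos_diff im tau_def by algebra
  then have "(Im (U_diag a b k))\<^sup>2 + (tau a b k)\<^sup>2 + (cmod (U_offdiag a b k))\<^sup>2 = (a + b)\<^sup>2"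
    unfolding off by (simp add: power2_eq_square algebra_simps)
  then show "(Im (U_diag a b k))\<^sup>2 + (cmod (U_offdiag a b k))\<^sup>2 = 1 - (tau a b k)\<^sup>2"
    using assms by simp
qed

text \<open>The eigenvalue and the diagonal entries share the real part \<tau>, so their differences
  are purely imaginary. Subtracting the diagonal terms on both sides leaves the two stated
  relations.\<close>

lemma su2_eigenvector_iff:
  fixes \<alpha> \<beta> :: complex and u :: "complex ^ 2"
  assumes "s = 1 \<or> s = -1" "Re \<alpha> = \<tau>" "\<tau>\<^sup>2 \<le> 1"
  shows "vector [vector [\<alpha>, \<beta>], vector [- cnj \<beta>, cnj \<alpha>]] *v u = cis (s * arccos \<tau>) *s u \<longleftrightarrow>
    \<beta> * u $ 2 = \<i> * of_real (s * sqrt (1 - \<tau>\<^sup>2) - Im \<alpha>) * u $ 1 \<and>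
    cnj \<beta> * u $ 1 = - \<i> * of_real (s * sqrt (1 - \<tau>\<^sup>2) + Im \<alpha>) * u $ 2"
proof -
  have t: "-1 \<le> \<tau>" "\<tau> \<le> 1" using assms(3) abs_square_le_1[of \<tau>] by auto
  have ev: "cis (s * arccos \<tau>) = Complex \<tau> (s * sqrt (1 - \<tau>\<^sup>2))"
    using assms(1) t by (auto simp: complex_eq_iff sin_arccos)
  have e1: "Complex \<tau> (s * sqrt (1 - \<tau>\<^sup>2)) = \<alpha> + \<i> * of_real (s * sqrt (1 - \<tau>\<^sup>2) - Im \<alpha>)"
    using assms(2) by (simp add: complex_eq_iff)
  have e2: "Complex \<tau> (s * sqrt (1 - \<tau>\<^sup>2)) = cnj \<alpha> + \<i> * of_real (s * sqrt (1 - \<tau>\<^sup>2) + Im \<alpha>)"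
    using assms(2) by (simp add: complex_eq_iff)
  have "vector [vector [\<alpha>, \<beta>], vector [- cnj \<beta>, cnj \<alpha>]] *v u = cis (s * arccos \<tau>) *s u \<longleftrightarrow>
    \<alpha> * u $ 1 + \<beta> * u $ 2 = Complex \<tau> (s * sqrt (1 - \<tau>\<^sup>2)) * u $ 1 \<and>
    - cnj \<beta> * u $ 1 + cnj \<alpha> * u $ 2 = Complex \<tau> (s * sqrt (1 - \<tau>\<^sup>2)) * u $ 2"
    by (simp add: vec_eq_iff forall_2 matrix_vector_mult_def sum_2 ev)
  also have "\<dots> \<longleftrightarrow> \<alpha> * u $ 1 + \<beta> * u $ 2 = (\<alpha> + \<i> * of_real (s * sqrt (1 - \<tau>\<^sup>2) - Im \<alpha>)) * u $ 1 \<and>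
    - cnj \<beta> * u $ 1 + cnj \<alpha> * u $ 2 = (cnj \<alpha> + \<i> * of_real (s * sqrt (1 - \<tau>\<^sup>2) + Im \<alpha>)) * u $ 2"
    using e1 e2 by simp
  also have "\<dots> \<longleftrightarrow> \<beta> * u $ 2 = \<i> * of_real (s * sqrt (1 - \<tau>\<^sup>2) - Im \<alpha>) * u $ 1 \<and>
    cnj \<beta> * u $ 1 = - \<i> * of_real (s * sqrt (1 - \<tau>\<^sup>2) + Im \<alpha>) * u $ 2"
  proof -
    have "- p + q = q + r \<longleftrightarrow> p = - r" for p q r :: complex
      by (metis add.commute add_left_cancel minus_equation_iff)
    then show ?thesis by (simp only: distrib_right add_left_cancel mult_minus_left)
  qed
  finally show ?thesis .
qed

lemma su2_eigenvector_exists: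
  fixes \<alpha> \<beta> :: complex
  assumes s: "s = 1 \<or> s = -1" and \<alpha>: "Re \<alpha> = \<tau>" and t: "\<tau>\<^sup>2 < 1"
    and det: "(Im \<alpha>)\<^sup>2 + (cmod \<beta>)\<^sup>2 = 1 - \<tau>\<^sup>2"
  shows "\<exists>u :: complex ^ 2. norm u = 1 \<and>
    vector [vector [\<alpha>, \<beta>], vector [- cnj \<beta>, cnj \<alpha>]] *v u = cis (s * arccos \<tau>) *s u"
proof -
  define \<sigma> where "\<sigma> = sqrt (1 - \<tau>\<^sup>2)"
  have \<sigma>: "0 < \<sigma>" "\<sigma>\<^sup>2 = 1 - \<tau>\<^sup>2" using t by (auto simp: \<sigma>_def)
  have "\<beta> * cnj \<beta> = of_real ((cmod \<beta>)\<^sup>2)" by (metis complex_norm_square)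
  also have "(cmod \<beta>)\<^sup>2 = (s * \<sigma> - Im \<alpha>) * (s * \<sigma> + Im \<alpha>)"
    using det \<sigma> s by (auto simp: algebra_simps power2_eq_square)
  finally have \<beta>: "\<beta> * cnj \<beta> = of_real (s * \<sigma> - Im \<alpha>) * of_real (s * \<sigma> + Im \<alpha>)" by simp
  \<comment> \<open>By the determinant condition the two relations are dependent, so solving one
    solves both. Each gives an explicit witness; the first could be zero when
    \<open>s * \<sigma> = Im \<alpha>\<close>, and then the second has a nonzero entry because
    \<sigma> is positive.\<close>
  have "\<exists>w :: complex ^ 2. w \<noteq> 0 \<and> \<beta> * w $ 2 = \<i> * of_real (s * \<sigma> - Im \<alpha>) * w $ 1 \<and>
    cnj \<beta> * w $ 1 = - \<i> * of_real (s * \<sigma> + Im \<alpha>) * w $ 2"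
  proof (cases "s * \<sigma> - Im \<alpha> = 0")
    case False
    then have "\<i> * of_real (s * \<sigma> - Im \<alpha>) \<noteq> 0" by (metis complex_i_not_zero mult_eq_0_iff of_real_eq_0_iff)
    then show ?thesis
      using \<beta> by (intro exI[of _ "vector [\<beta>, \<i> * of_real (s * \<sigma> - Im \<alpha>)]"]) (auto simp: vec_eq_iff forall_2 mult_ac)
  next
    case True
    then have "s * \<sigma> + Im \<alpha> \<noteq> 0" using s \<sigma> by auto
    then have "\<i> * of_real (s * \<sigma> + Im \<alpha>) \<noteq> 0" by (metis complex_i_not_zero mult_eq_0_iff of_real_eq_0_iff)
    then show ?thesis
      using \<beta> by (intro exI[of _ "vector [- \<i> * of_real (s * \<sigma> + Im \<alpha>), cnj \<beta>]"]) (auto simp: vec_eq_iff forall_2 mult_ac)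
  qed
  then obtain w :: "complex ^ 2" where w: "w \<noteq> 0" "\<beta> * w $ 2 = \<i> * of_real (s * \<sigma> - Im \<alpha>) * w $ 1"
    "cnj \<beta> * w $ 1 = - \<i> * of_real (s * \<sigma> + Im \<alpha>) * w $ 2" by blast
  define u where "u = (1 / norm w) *\<^sub>R w"
  have "\<beta> * u $ 2 = \<i> * of_real (s * \<sigma> - Im \<alpha>) * u $ 1 \<and> cnj \<beta> * u $ 1 = - \<i> * of_real (s * \<sigma> + Im \<alpha>) * u $ 2"
  proof -
    have c: "u $ i = complex_of_real (1 / norm w) * w $ i" for i
      unfolding u_def vector_scaleR_component by (rule scaleR_conv_of_real)
    show ?thesis unfolding c using w(2,3) by algebra
  qed
  moreover have "norm u = 1" using w by (simp add: u_def)
  ultimately show ?thesis using su2_eigenvector_iff[OF s \<alpha>] t unfolding \<sigma>_def by (intro exI[of _ u]) auto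
qed

text \<open>The squared inner product depends on \<open>u\<close> only through the moduli of its
  entries and the product of one entry with the conjugate of the other. The eigenvector relations
  and the norm determine all of these, so the arbitrary phase disappears and the result is the
  entries of the spectral projection.\<close>

lemma su2_eigenvector_weight:
  fixes \<alpha> \<beta> :: complex and u w :: "complex ^ 2"
  assumes s: "s = 1 \<or> s = -1" and \<alpha>: "Re \<alpha> = \<tau>" and t: "\<tau>\<^sup>2 < 1"
    and u: "norm u = 1" "vector [vector [\<alpha>, \<beta>], vector [- cnj \<beta>, cnj \<alpha>]] *v u = cis (s * arccos \<tau>) *s u"
  defines "\<sigma> \<equiv> sqrt (1 - \<tau>\<^sup>2)"
  shows "(cmod (cinner2 u w))\<^sup>2 = (1 + s * Im \<alpha> / \<sigma>) / 2 * (cmod (w $ 1))\<^sup>2 + (1 - s * Im \<alpha> / \<sigma>) / 2 * (cmod (w $ 2))\<^sup>2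
    + s / \<sigma> * Re (\<i> * cnj \<beta> * w $ 1 * cnj (w $ 2))"
proof -
  have \<sigma>: "0 < \<sigma>" using t by (auto simp: \<sigma>_def)
  have ss: "s * s = 1" using s by auto
  let ?x = "u $ 1" and ?y = "u $ 2"
  have E: "\<beta> * ?y = \<i> * of_real (s * \<sigma> - Im \<alpha>) * ?x" "cnj \<beta> * ?x = - \<i> * of_real (s * \<sigma> + Im \<alpha>) * ?y"
    using su2_eigenvector_iff[OF s \<alpha>, of \<beta> u] t u by (auto simp: \<sigma>_def)
  have E2: "\<beta> * cnj ?x = \<i> * of_real (s * \<sigma> + Im \<alpha>) * cnj ?y"
    using arg_cong[OF E(2), of cnj] by (simp only: complex_cnj_mult complex_cnj_minus complex_cnj_i complex_cnj_cnj complex_cnj_complex_of_real) simp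
  define X Y where XY: "X = (cmod ?x)\<^sup>2" "Y = (cmod ?y)\<^sup>2"
  have X: "?x * cnj ?x = of_real X" and Y: "?y * cnj ?y = of_real Y"
    unfolding XY by (metis complex_norm_square)+
  have one: "X + Y = 1" using u(1) norm_sq_vec2[of u] by (simp add: XY)
  have "\<i> * of_real ((s * \<sigma> - Im \<alpha>) * X) = (\<i> * of_real (s * \<sigma> - Im \<alpha>) * ?x) * cnj ?x" by (simp add: X[symmetric])
  also have "\<dots> = (\<beta> * cnj ?x) * ?y" using E(1) by algebra
  also have "\<dots> = \<i> * of_real ((s * \<sigma> + Im \<alpha>) * Y)" by (simp add: E2 Y[symmetric] mult_ac)
  finally have "(s * \<sigma> - Im \<alpha>) * X = (s * \<sigma> + Im \<alpha>) * Y"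
    by (metis complex_i_not_zero mult_left_cancel of_real_eq_iff)
  then have "s * \<sigma> * (X - Y) = Im \<alpha> * (X + Y)" by (simp add: algebra_simps)
  then have "s * (s * \<sigma> * (X - Y)) = s * Im \<alpha>" by (simp add: one)
  then have "\<sigma> * (X - Y) = s * Im \<alpha>" using ss by (metis mult.assoc mult_1)
  then have "X - Y = s * Im \<alpha> / \<sigma>" using \<sigma> by (simp add: field_simps)
  then have XY': "X = (1 + s * Im \<alpha> / \<sigma>) / 2" "Y = (1 - s * Im \<alpha> / \<sigma>) / 2"
  proof -
    have "x = (1 + d) / 2 \<and> y = (1 - d) / 2" if "x - y = d" "x + y = 1" for x y d :: real
      using that by (simp add: field_simps)
    from this[OF \<open>X - Y = _\<close> one] show "X = (1 + s * Im \<alpha> / \<sigma>) / 2" "Y = (1 - s * Im \<alpha> / \<sigma>) / 2" by auto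
  qed
  have "\<beta> = \<beta> * of_real (X + Y)" by (simp add: one)
  also have "\<dots> = (\<beta> * cnj ?x) * ?x + (\<beta> * ?y) * cnj ?y" by (simp add: X[symmetric] Y[symmetric] algebra_simps)
  also have "\<dots> = 2 * \<i> * of_real (s * \<sigma>) * (?x * cnj ?y)"
    unfolding E(1) E2 by (simp add: algebra_simps)
  finally have "cnj \<beta> = - 2 * \<i> * of_real (s * \<sigma>) * (cnj ?x * ?y)"
    by (metis complex_cnj_cnj complex_cnj_complex_of_real complex_cnj_i complex_cnj_minus complex_cnj_mult complex_cnj_numeral mult_minus_left mult_minus_right)
  then have c: "\<i> * cnj \<beta> = 2 * of_real (s * \<sigma>) * (cnj ?x * ?y)" by simp
  have "s / \<sigma> * Re (\<i> * cnj \<beta> * w $ 1 * cnj (w $ 2)) = Re (of_real (s / \<sigma>) * (\<i> * cnj \<beta> * w $ 1 * cnj (w $ 2)))"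
    by (simp only: Re_complex_of_real times_complex.simps Im_complex_of_real mult_zero_left diff_zero)
  also have "of_real (s / \<sigma>) * (\<i> * cnj \<beta> * w $ 1 * cnj (w $ 2)) = (of_real (s / \<sigma> * (s * \<sigma>)) * 2) * (cnj ?x * ?y * w $ 1 * cnj (w $ 2))"
    unfolding c by (simp only: of_real_mult mult_ac)
  also have "s / \<sigma> * (s * \<sigma>) = 1" using \<sigma> ss by simp
  finally have r: "s / \<sigma> * Re (\<i> * cnj \<beta> * w $ 1 * cnj (w $ 2)) = 2 * Re (cnj ?x * ?y * w $ 1 * cnj (w $ 2))" by simp
  have "(cmod (cinner2 u w))\<^sup>2 = X * (cmod (w $ 1))\<^sup>2 + Y * (cmod (w $ 2))\<^sup>2 + 2 * Re (cnj ?x * ?y * w $ 1 * cnj (w $ 2))"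
    unfolding XY cinner2_def sum_2 cmod_power2 by (simp add: power2_eq_square algebra_simps)
  then show ?thesis unfolding r XY' .
qed

lemma eigvec_props:
  assumes ab: "0 \<le> a" "0 \<le> b" "a + b = 1" and s: "s = 1 \<or> s = -1" and t: "(tau a b k)\<^sup>2 < 1"
  shows "norm (eigvec a b s k) = 1"
    and "U_hat (sqrt a) (sqrt a) k *v eigvec a b s k = cis (s * omega a b k) *s eigvec a b s k"
proof -
  have "\<exists>u. norm u = 1 \<and> U_hat (sqrt a) (sqrt a) k *v u = cis (s * omega a b k) *s u"
    unfolding U_hat_eq[OF ab] omega_def
    by (rule su2_eigenvector_exists[OF s _ t]) (use U_diag_offdiag[OF ab] in auto)
  from someI_ex[OF this] show "norm (eigvec a b s k) = 1"
    "U_hat (sqrt a) (sqrt a) k *v eigvec a b s k = cis (s * omega a b k) *s eigvec a b s k"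
    unfolding eigvec_def by auto
qed

lemma band_weight_eq:
  assumes ab: "0 \<le> a" "0 \<le> b" "a + b = 1" and s: "s = 1 \<or> s = -1" and t: "(tau a b k)\<^sup>2 < 1"
  shows "band_weight a b \<Psi> s k =
    (1 + s * Im (U_diag a b k) / sig a b k) / 2 * (cmod (fourier \<Psi> k $ 1))\<^sup>2
    + (1 - s * Im (U_diag a b k) / sig a b k) / 2 * (cmod (fourier \<Psi> k $ 2))\<^sup>2
    + s / sig a b k * Re (\<i> * cnj (U_offdiag a b k) * fourier \<Psi> k $ 1 * cnj (fourier \<Psi> k $ 2))"
  unfolding band_weight_def sig_def
  by (rule su2_eigenvector_weight[OF s U_diag_offdiag(1)[OF ab] t])
    (use eigvec_props[OF ab s t] in \<open>auto simp: U_hat_eq[OF ab] omega_def\<close>)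

text \<open>By Lagrange's identity the defect is the square of a 2 by 2 determinant formed from the
  moduli.\<close>

lemma cinner2_le: "(cmod (cinner2 u w))\<^sup>2 \<le> (norm u)\<^sup>2 * (norm w)\<^sup>2"
proof -
  have "cmod (cinner2 u w) \<le> cmod (u $ 1) * cmod (w $ 1) + cmod (u $ 2) * cmod (w $ 2)"
    unfolding cinner2_def sum_2 by (rule order_trans[OF norm_triangle_ineq]) (simp add: norm_mult)
  then have "(cmod (cinner2 u w))\<^sup>2 \<le> (cmod (u $ 1) * cmod (w $ 1) + cmod (u $ 2) * cmod (w $ 2))\<^sup>2"
    by (intro power_mono) auto
  moreover have "(norm u)\<^sup>2 * (norm w)\<^sup>2 - (cmod (u $ 1) * cmod (w $ 1) + cmod (u $ 2) * cmod (w $ 2))\<^sup>2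
     = (cmod (u $ 1) * cmod (w $ 2) - cmod (u $ 2) * cmod (w $ 1))\<^sup>2"
    unfolding norm_sq_vec2 by (simp add: power2_eq_square algebra_simps)
  ultimately show ?thesis by (smt (verit) zero_le_power2)
qed

lemma band_weight_le:
  assumes "0 \<le> a" "0 \<le> b" "a + b = 1" "s = 1 \<or> s = -1" "(tau a b k)\<^sup>2 < 1"
  shows "band_weight a b \<Psi> s k \<le> (norm (fourier \<Psi> k))\<^sup>2"
  using cinner2_le[of "eigvec a b s k" "fourier \<Psi> k"] eigvec_props(1)[OF assms]
  by (simp add: band_weight_def)

section \<open>The branch domains\<close>

definition l_region :: "nat \<Rightarrow> (real \<times> real) set" where
  "l_region \<mu> = (\<Union>n\<in>{1..4}. l_rect (n + 4 * \<mu>))"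

lemma l_region_0: "l_region 0 = {-pi..pi} \<times> {-pi..pi}"
proof -
  have "{1..4::nat} = {1, 2, 3, 4}" by auto
  then show ?thesis using pi_gt_zero by (auto simp: l_region_def l_rect_def)
qed

lemma l_region_1: "l_region 1 = ({-2*pi..-pi} \<times> {0..pi}) \<union> ({-pi..0} \<times> {-2*pi..-pi})
    \<union> ({pi..2*pi} \<times> {-pi..0}) \<union> ({0..pi} \<times> {pi..2*pi})"
proof -
  have "{1..4::nat} = {1, 2, 3, 4}" by auto
  then show ?thesis by (simp add: l_region_def l_rect_def Un_assoc)
qed

lemma sin_signs:
  fixes x :: real
  shows "-pi \<le> x \<Longrightarrow> x \<le> 0 \<Longrightarrow> sin x \<le> 0" "-2*pi \<le> x \<Longrightarrow> x \<le> -pi \<Longrightarrow> 0 \<le> sin x"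
    "pi \<le> x \<Longrightarrow> x \<le> 2*pi \<Longrightarrow> sin x \<le> 0"
  using sin_ge_zero[of "-x"] sin_ge_zero[of "x + 2*pi"] sin_ge_zero[of "x - pi"] by auto

text \<open>Each of the four rectangles of the second region is a quadrant of the first one, moved by a
  period in one of the two coordinates.\<close>

definition quadrant_shift :: "real \<Rightarrow> real \<Rightarrow> int \<times> int" where
  "quadrant_shift y1 y2 = (if sin y2 > 0 then if sin y1 > 0 then (1, 0) else (0, 1)
     else if sin y1 > 0 then (0, -1) else (-1, 0))"

lemma sin_sign_excludes:
  fixes y :: real
  shows "sin y > 0 \<Longrightarrow> \<not> (-pi \<le> y \<and> y \<le> 0) \<and> \<not> (pi \<le> y \<and> y \<le> 2*pi)"
    "sin y < 0 \<Longrightarrow> \<not> (-2*pi \<le> y \<and> y \<le> -pi) \<and> \<not> (0 \<le> y \<and> y \<le> pi)"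
  using sin_signs[of y] sin_ge_zero[of y] by linarith+

text \<open>The signs of the two sines do not change under periods. They single out one rectangle of
  the second region and one quadrant of the first, and \<open>quadrant_shift\<close> is the shift
  between these two.\<close>

lemma l_region_1_iff:
  assumes "sin y1 \<noteq> 0" "sin y2 \<noteq> 0"
  shows "(y1, y2) \<in> l_region 1 \<longleftrightarrow>
    (y1 + 2 * pi * of_int (fst (quadrant_shift y1 y2)), y2 + 2 * pi * of_int (snd (quadrant_shift y1 y2))) \<in> l_region 0"
proof -
  note n = sin_sign_excludes
  consider "sin y1 > 0" "sin y2 > 0" | "sin y1 < 0" "sin y2 > 0" | "sin y1 < 0" "sin y2 < 0" | "sin y1 > 0" "sin y2 < 0"
    using assms by linarith
  then show ?thesis
  proof cases
    case 1
    have "sin (y1 + 2*pi) = sin y1" "sin (y2) = sin y2" by (simp_all add: sin_diff)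
    then have "sin (y1 + 2*pi) > 0" "sin (y2) > 0" using 1 by simp_all
    note e = n(1)[OF 1(1)] n(1)[OF 1(2)] n(1)[OF this(1)] n(1)[OF this(2)]
    have "quadrant_shift y1 y2 = (1, 0)" using 1 by (simp add: quadrant_shift_def)
    then show ?thesis unfolding l_region_0 l_region_1 using e pi_gt_zero by simp linarith
  next
    case 2
    have "sin (y1) = sin y1" "sin (y2 + 2*pi) = sin y2" by (simp_all add: sin_diff)
    then have "sin (y1) < 0" "sin (y2 + 2*pi) > 0" using 2 by simp_all
    note e = n(2)[OF 2(1)] n(1)[OF 2(2)] n(2)[OF this(1)] n(1)[OF this(2)]
    have "quadrant_shift y1 y2 = (0, 1)" using 2 by (simp add: quadrant_shift_def)
    then show ?thesis unfolding l_region_0 l_region_1 using e pi_gt_zero by simp linarith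
  next
    case 3
    have "sin (y1 - 2*pi) = sin y1" "sin (y2) = sin y2" by (simp_all add: sin_diff)
    then have "sin (y1 - 2*pi) < 0" "sin (y2) < 0" using 3 by simp_all
    note e = n(2)[OF 3(1)] n(2)[OF 3(2)] n(2)[OF this(1)] n(2)[OF this(2)]
    have "quadrant_shift y1 y2 = (-1, 0)" using 3 by (simp add: quadrant_shift_def)
    then show ?thesis unfolding l_region_0 l_region_1 using e pi_gt_zero by simp linarith
  next
    case 4
    have "sin (y1) = sin y1" "sin (y2 - 2*pi) = sin y2" by (simp_all add: sin_diff)
    then have "sin (y1) > 0" "sin (y2 - 2*pi) < 0" using 4 by simp_all
    note e = n(1)[OF 4(1)] n(2)[OF 4(2)] n(1)[OF this(1)] n(2)[OF this(2)]
    have "quadrant_shift y1 y2 = (0, -1)" using 4 by (simp add: quadrant_shift_def)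
    then show ?thesis unfolding l_region_0 l_region_1 using e pi_gt_zero by simp linarith
  qed
qed

lemma sin_cos_add_int_periods [simp]:
  "sin (x + 2 * pi * of_int n) = sin x" "cos (x + 2 * pi * of_int n) = cos x"
  by (simp_all add: sin_add cos_add)

text \<open>Each region is a transversal for independent shifts of the two coordinates by full
  periods, and the two representatives differ by \<open>quadrant_shift\<close>. The periods of
  \<open>k\<close> induce only some of these shifts; that restriction is treated later.\<close>

lemma l_region_representative:
  assumes "sin y1 \<noteq> 0" "sin y2 \<noteq> 0"
  obtains i j :: int where
    "\<And>m n. (y1 + 2 * pi * of_int m, y2 + 2 * pi * of_int n) \<in> l_region 0 \<longleftrightarrow> m = i \<and> n = j"
    "\<And>m n. (y1 + 2 * pi * of_int m, y2 + 2 * pi * of_int n) \<in> l_region 1 \<longleftrightarrow>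
      m = i - fst (quadrant_shift y1 y2) \<and> n = j - snd (quadrant_shift y1 y2)"
proof -
  have "\<exists>i. \<forall>m::int. y + 2 * pi * of_int m \<in> {-pi..pi} \<longleftrightarrow> m = i" if "sin y \<noteq> 0" for y :: real
  proof -
    have "y + 2 * pi * of_int m \<noteq> - pi" for m :: int
    proof
      assume "y + 2 * pi * of_int m = - pi"
      then have "sin (y + 2 * pi * of_int m) = 0" by simp
      then show False using that by simp
    qed
    from unique_lattice_shift[of y "- pi", OF this] show ?thesis by auto
  qed
  then obtain i j :: int where ij: "\<And>m. y1 + 2 * pi * of_int m \<in> {-pi..pi} \<longleftrightarrow> m = i"
    "\<And>m. y2 + 2 * pi * of_int m \<in> {-pi..pi} \<longleftrightarrow> m = j"
    using assms by metis
  have 0: "(y1 + 2 * pi * of_int m, y2 + 2 * pi * of_int n) \<in> l_region 0 \<longleftrightarrow> m = i \<and> n = j" for m n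
    using ij[of m] ij[of n] by (simp add: l_region_0)
  have "(y1 + 2 * pi * of_int m, y2 + 2 * pi * of_int n) \<in> l_region 1 \<longleftrightarrow>
      m = i - fst (quadrant_shift y1 y2) \<and> n = j - snd (quadrant_shift y1 y2)" for m n
  proof -
    have q: "quadrant_shift (y1 + 2 * pi * of_int m) (y2 + 2 * pi * of_int n) = quadrant_shift y1 y2"
      by (simp add: quadrant_shift_def)
    have "(y1 + 2 * pi * of_int m, y2 + 2 * pi * of_int n) \<in> l_region 1 \<longleftrightarrow>
      (y1 + 2 * pi * of_int (m + fst (quadrant_shift y1 y2)), y2 + 2 * pi * of_int (n + snd (quadrant_shift y1 y2))) \<in> l_region 0"
      using assms by (subst l_region_1_iff)
        (simp_all only: q sin_cos_add_int_periods of_int_add distrib_left add.assoc not_False_eq_True)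
    then show ?thesis unfolding 0 by auto
  qed
  with 0 show ?thesis using that by blast
qed

lemma K_set_iff: "k \<in> K_set n \<longleftrightarrow> (l1 k, l2 k) \<in> l_rect n"
proof
  assume "(l1 k, l2 k) \<in> l_rect n"
  moreover have "k = (\<lambda>(y1, y2). vector [(y1 - y2) / 2, (y1 + y2) / 2]) (l1 k, l2 k)"
    by (simp add: vec_eq_iff forall_2 l1_def l2_def)
  ultimately show "k \<in> K_set n" unfolding K_set_def by blast
qed (auto simp: K_set_def l1_def l2_def add_divide_distrib diff_divide_distrib)

lemma branch_domain_iff: "k \<in> branch_domain \<mu> \<nu> \<longleftrightarrow> (l1 k, l2 k) \<in> l_region \<mu> \<and>
    (if \<nu> = 0 then cos (l1 k) + cos (l2 k) \<le> 0 else cos (l1 k) + cos (l2 k) \<ge> 0)"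
  by (auto simp: branch_domain_def K_set_iff l_region_def)

text \<open>Nonzero sines keep the point off the edges of the rectangles and, for positive
  \<open>a\<close>, make \<open>sig\<close> positive. The third condition avoids the border between
  \<open>\<nu> = 0\<close> and \<open>\<nu> = 1\<close>, where the Jacobian vanishes as
  well.\<close>

definition generic :: "real ^ 2 \<Rightarrow> bool" where
  "generic k \<longleftrightarrow> sin (l1 k) \<noteq> 0 \<and> sin (l2 k) \<noteq> 0 \<and> cos (l1 k) + cos (l2 k) \<noteq> 0"

definition branch_core :: "nat \<Rightarrow> nat \<Rightarrow> (real ^ 2) set" where
  "branch_core \<mu> \<nu> = {k \<in> branch_domain \<mu> \<nu>. generic k}"

text \<open>All exceptional points lie on countably many lines. For the third condition this follows
  from the product formula 2 cos(k1) cos(k2) for the sum of the cosines.\<close>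

lemma AE_generic: "AE k in lebesgue. generic k"
proof -
  have *: "AE k in lebesgue. sin (w \<bullet> k) \<noteq> 0" if "w \<noteq> 0" for w :: "real ^ 2"
  proof -
    have "negligible (\<Union>i\<in>UNIV. {k :: real ^ 2. w \<bullet> k = of_int i * pi})"
      by (intro negligible_countable_Union) (auto intro!: negligible_hyperplane that)
    moreover have "{k. \<not> sin (w \<bullet> k) \<noteq> 0} \<subseteq> (\<Union>i\<in>UNIV. {k. w \<bullet> k = of_int i * pi})"
      by (auto simp: sin_zero_iff_int2)
    ultimately show ?thesis by (intro AE_I') (auto simp: negligible_iff_null_sets)
  qed
  have l: "l1 k = vector [1, 1] \<bullet> k" "l2 k = vector [-1, 1] \<bullet> k" for k
    by (simp_all add: l1_def l2_def inner_vec_def sum_2)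
  have nz: "vector [1, 1] \<noteq> (0 :: real ^ 2)" "vector [-1, 1] \<noteq> (0 :: real ^ 2)"
    by (auto simp: vec_eq_iff forall_2)
  have cnt: "countable (range (\<lambda>n::int. (of_int n + 1/2) * pi))" by simp
  have cos0: "x \<in> range (\<lambda>n::int. (of_int n + 1/2) * pi)" if cx: "cos x = 0" for x :: real
  proof -
    from cx have "sin (x - pi/2) = 0" by (simp add: sin_diff)
    then obtain i :: int where "x - pi/2 = of_int i * pi" by (auto simp: sin_zero_iff_int2)
    then show ?thesis by (auto simp: algebra_simps image_iff intro!: exI[of _ i])
  qed
  have sum: "cos (l1 k) + cos (l2 k) = 2 * cos (k $ 1) * cos (k $ 2)" for k
    by (simp add: l1_def l2_def cos_add cos_diff)
  show ?thesis
    using *[OF nz(1)] *[OF nz(2)] AE_not_hyperplane_countable[OF cnt, of 1] AE_not_hyperplane_countable[OF cnt, of 2]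
    by eventually_elim (auto simp: generic_def l sum[unfolded l] dest!: cos0)
qed

lemma l_lattice_vec:
  "l1 (lattice_vec n + k) = l1 k + 2 * pi * of_int (n $ 2 + n $ 1)"
  "l2 (lattice_vec n + k) = l2 k + 2 * pi * of_int (n $ 2 - n $ 1)"
  by (simp_all add: l1_def l2_def lattice_vec_def algebra_simps)

lemma generic_lattice_vec: "generic (lattice_vec n + k) \<longleftrightarrow> generic k"
  unfolding generic_def l_lattice_vec sin_cos_add_int_periods ..

lemma continuous_on_l [continuous_intros]: "continuous_on S l1" "continuous_on S l2"
  unfolding l1_def[abs_def] l2_def[abs_def] by (intro continuous_intros)+

lemma borel_measurable_l [measurable]: "l1 \<in> borel_measurable borel" "l2 \<in> borel_measurable borel"
  by (intro borel_measurable_continuous_onI continuous_intros)+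

lemma l_region_closed: "\<mu> \<le> 1 \<Longrightarrow> closed (l_region \<mu>)"
  by (cases "\<mu> = 0") (auto simp: l_region_0 l_region_1[simplified One_nat_def] le_Suc_eq intro!: closed_Un closed_Times)

lemma branch_domain_closed: "\<mu> \<le> 1 \<Longrightarrow> closed (branch_domain \<mu> \<nu>)"
proof -
  assume \<mu>: "\<mu> \<le> 1"
  have "closed ((\<lambda>k. (l1 k, l2 k)) -` l_region \<mu>)"
    using l_region_closed[OF \<mu>] by (intro closed_vimage continuous_intros)
  moreover have "closed {k. cos (l1 k) + cos (l2 k) \<le> 0}" "closed {k. 0 \<le> cos (l1 k) + cos (l2 k)}"
    by (intro closed_Collect_le continuous_intros)+
  moreover have "branch_domain \<mu> \<nu> = (\<lambda>k. (l1 k, l2 k)) -` l_region \<mu> \<inter>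
    (if \<nu> = 0 then {k. cos (l1 k) + cos (l2 k) \<le> 0} else {k. 0 \<le> cos (l1 k) + cos (l2 k)})"
    by (auto simp: branch_domain_iff)
  ultimately show ?thesis by (auto intro: closed_Int)
qed

lemma branch_core_sets: "\<mu> \<le> 1 \<Longrightarrow> branch_core \<mu> \<nu> \<in> sets lebesgue"
proof -
  assume \<mu>: "\<mu> \<le> 1"
  have "branch_core \<mu> \<nu> = branch_domain \<mu> \<nu> \<inter> {k. generic k}" by (auto simp: branch_core_def)
  moreover have "{k. generic k} \<in> sets borel"
    unfolding generic_def by measurable
  ultimately show ?thesis
    using branch_domain_closed[OF \<mu>] by (metis borel_closed lborelD sets.Int sets_completionI_sets sets_lborel)
qed

section \<open>The four branches together as a fundamental domain\<close>

definition cores :: "(real ^ 2) set" where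
  "cores = (\<Union>\<mu>\<in>{0, 1}. \<Union>\<nu>\<in>{0, 1}. branch_core \<mu> \<nu>)"

text \<open>\<open>quadrant_shift\<close> is never the zero pair, so no generic point represents its
  class in both regions; \<open>\<nu>\<close> is then read off from the sign of the nonzero sum of
  cosines.\<close>

lemma branch_core_disjoint:
  assumes "k \<in> branch_core \<mu> \<nu>" "k \<in> branch_core \<mu>' \<nu>'" "\<mu> \<in> {0, 1}" "\<mu>' \<in> {0, 1}" "\<nu> \<in> {0, 1}" "\<nu>' \<in> {0, 1}"
  shows "\<mu> = \<mu>' \<and> \<nu> = \<nu>'"
proof
  have g: "sin (l1 k) \<noteq> 0" "sin (l2 k) \<noteq> 0" "cos (l1 k) + cos (l2 k) \<noteq> 0"
    using assms(1) by (auto simp: branch_core_def generic_def)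
  obtain i j :: int where ij: "\<And>m n. (l1 k + 2 * pi * of_int m, l2 k + 2 * pi * of_int n) \<in> l_region 0 \<longleftrightarrow> m = i \<and> n = j"
    "\<And>m n. (l1 k + 2 * pi * of_int m, l2 k + 2 * pi * of_int n) \<in> l_region 1 \<longleftrightarrow>
      m = i - fst (quadrant_shift (l1 k) (l2 k)) \<and> n = j - snd (quadrant_shift (l1 k) (l2 k))"
    using l_region_representative[OF g(1,2)] by blast
  have "quadrant_shift (l1 k) (l2 k) \<noteq> (0, 0)" by (auto simp: quadrant_shift_def)
  then have "\<not> ((l1 k, l2 k) \<in> l_region 0 \<and> (l1 k, l2 k) \<in> l_region 1)"
    using ij[of 0 0] by (auto simp: prod_eq_iff)
  then show "\<mu> = \<mu>'" using assms by (auto simp: branch_core_def branch_domain_iff)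
  show "\<nu> = \<nu>'" using assms g by (auto simp: branch_core_def branch_domain_iff)
qed

lemma cores_iff: "k \<in> cores \<longleftrightarrow> generic k \<and> ((l1 k, l2 k) \<in> l_region 0 \<or> (l1 k, l2 k) \<in> l_region 1)"
  by (auto simp: cores_def branch_core_def branch_domain_iff)

text \<open>Lattice vectors act by shifts of \<open>l1\<close> and \<open>l2\<close> whose two
  multiples of the period have an even sum. The shifts into the two regions are (i, j) and (i - e1,
  j - e2) with e1 + e2 odd, so exactly one of them is available.\<close>

lemma fundamental_domain_cores: "fundamental_domain cores"
  unfolding fundamental_domain_def
proof
  show "cores \<in> sets lebesgue" unfolding cores_def using branch_core_sets by (intro sets.finite_UN) auto
  show "AE k in lebesgue. \<exists>!n. lattice_vec n + k \<in> cores"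
    using AE_generic
  proof eventually_elim
    fix k assume gen: "generic k"
    then have g: "sin (l1 k) \<noteq> 0" "sin (l2 k) \<noteq> 0" by (auto simp: generic_def)
    obtain i j :: int where ij: "\<And>m n. (l1 k + 2 * pi * of_int m, l2 k + 2 * pi * of_int n) \<in> l_region 0 \<longleftrightarrow> m = i \<and> n = j"
      "\<And>m n. (l1 k + 2 * pi * of_int m, l2 k + 2 * pi * of_int n) \<in> l_region 1 \<longleftrightarrow>
        m = i - fst (quadrant_shift (l1 k) (l2 k)) \<and> n = j - snd (quadrant_shift (l1 k) (l2 k))"
      using l_region_representative[OF g] by blast
    define e1 e2 where e: "e1 = fst (quadrant_shift (l1 k) (l2 k))" "e2 = snd (quadrant_shift (l1 k) (l2 k))"
    have odd_e: "odd (e1 + e2)" by (auto simp: e quadrant_shift_def)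
    have iff: "lattice_vec n + k \<in> cores \<longleftrightarrow> (n $ 2 + n $ 1 = i \<and> n $ 2 - n $ 1 = j) \<or>
        (n $ 2 + n $ 1 = i - e1 \<and> n $ 2 - n $ 1 = j - e2)" for n
      unfolding cores_iff generic_lattice_vec l_lattice_vec ij e using gen by simp
    \<comment> \<open>Prescribed values of sum and difference come from integers exactly when they
      have equal parity.\<close>
    have solve: "(p + q = x \<and> p - q = y) \<longleftrightarrow> even (x + y) \<and> p = (x + y) div 2 \<and> q = (x - y) div 2" for p q x y :: int
      by presburger
    have "lattice_vec n + k \<in> cores \<longleftrightarrow> (if even (i + j)
       then n = vector [(i - j) div 2, (i + j) div 2]
       else n = vector [((i - e1) - (j - e2)) div 2, ((i - e1) + (j - e2)) div 2])" for n
      unfolding iff solve vec_eq_iff forall_2 using odd_e by (auto simp: even_diff)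
    then show "\<exists>!n. lattice_vec n + k \<in> cores" by (cases "even (i + j)") auto
  qed
qed

section \<open>The velocity map is a bijection from each branch onto the ellipse\<close>

text \<open>Besides positivity, this form supplies the geometry: divided by its left side it becomes
  the equation that places the velocity inside the ellipse.\<close>

lemma one_minus_tau_sq:
  assumes "a + b = 1"
  shows "1 - (tau a b k)\<^sup>2 = a * (sin (l1 k))\<^sup>2 + b * (sin (l2 k))\<^sup>2 + a * b * (cos (l1 k) + cos (l2 k))\<^sup>2"
proof -
  have "(sin (l1 k))\<^sup>2 = 1 - (cos (l1 k))\<^sup>2" "(sin (l2 k))\<^sup>2 = 1 - (cos (l2 k))\<^sup>2" by (simp_all add: sin_squared_eq)
  moreover have "b = 1 - a" using assms by simp
  ultimately show ?thesis unfolding tau_def by algebra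
qed

locale coin_params =
  fixes a b :: real
  assumes a_pos: "0 < a" and b_pos: "0 < b" and ab1: "a + b = 1"
begin

abbreviation \<sigma> :: "real ^ 2 \<Rightarrow> real" where "\<sigma> \<equiv> sig a b"
abbreviation V :: "real ^ 2 \<Rightarrow> real ^ 2" where "V \<equiv> velocity a b"

lemma tau_sq_less:
  assumes "sin (l1 k) \<noteq> 0"
  shows "(tau a b k)\<^sup>2 < 1"
proof -
  have "0 < a * (sin (l1 k))\<^sup>2" "0 \<le> b * (sin (l2 k))\<^sup>2" "0 \<le> a * b * (cos (l1 k) + cos (l2 k))\<^sup>2"
    using assms a_pos b_pos by auto
  then show ?thesis using one_minus_tau_sq[OF ab1, of k] by linarith
qed

lemma sig_pos: "sin (l1 k) \<noteq> 0 \<Longrightarrow> 0 < \<sigma> k"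
  using tau_sq_less by (simp add: sig_def)

lemma sig_sq: "(\<sigma> k)\<^sup>2 = 1 - (tau a b k)\<^sup>2"
proof -
  have "0 \<le> a * (sin (l1 k))\<^sup>2 + b * (sin (l2 k))\<^sup>2 + a * b * (cos (l1 k) + cos (l2 k))\<^sup>2"
    using a_pos b_pos by simp
  then show ?thesis unfolding sig_def one_minus_tau_sq[OF ab1] by simp
qed

lemma velocity_sum_diff:
  "(V k $ 1 + V k $ 2) / 2 = - a * sin (l1 k) / \<sigma> k"
  "(V k $ 1 - V k $ 2) / 2 = - b * sin (l2 k) / \<sigma> k"
  by (simp_all add: velocity_def sig_def add_divide_distrib diff_divide_distrib)

text \<open>The defining function of the ellipse in the half sum and the half difference of the
  velocity components, which are its principal axes.\<close>

definition Q :: "real \<Rightarrow> real \<Rightarrow> real" where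
  "Q x y = 1 - x\<^sup>2 / a - y\<^sup>2 / b"

text \<open>The two removed axes correspond to vanishing sines of \<open>l1\<close> and
  \<open>l2\<close>, the boundary of the ellipse to a vanishing sum of cosines.\<close>

definition ellipse_core :: "(real ^ 2) set" where
  "ellipse_core = {v. 0 < Q ((v $ 1 + v $ 2) / 2) ((v $ 1 - v $ 2) / 2) \<and> v $ 1 + v $ 2 \<noteq> 0 \<and> v $ 1 - v $ 2 \<noteq> 0}"

lemma ellipse_iff: "v \<in> ellipse a b \<longleftrightarrow> 0 \<le> Q ((v $ 1 + v $ 2) / 2) ((v $ 1 - v $ 2) / 2)"
  using a_pos b_pos by (simp add: ellipse_def Q_def power_divide) linarith

text \<open>The identity for \<open>1 - tau^2\<close>, divided by itself. The velocity thereby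
  determines the modulus of the sum of cosines over \<open>sig\<close>; the missing sign is what
  \<open>\<nu>\<close> records.\<close>

lemma velocity_Q:
  assumes "0 < \<sigma> k"
  shows "Q (- a * sin (l1 k) / \<sigma> k) (- b * sin (l2 k) / \<sigma> k) = a * b * ((cos (l1 k) + cos (l2 k)) / \<sigma> k)\<^sup>2"
proof -
  have "(\<sigma> k)\<^sup>2 = a * (sin (l1 k))\<^sup>2 + b * (sin (l2 k))\<^sup>2 + a * b * (cos (l1 k) + cos (l2 k))\<^sup>2"
    unfolding sig_sq by (rule one_minus_tau_sq[OF ab1])
  then have "1 = (a * (sin (l1 k))\<^sup>2 + b * (sin (l2 k))\<^sup>2 + a * b * (cos (l1 k) + cos (l2 k))\<^sup>2) / (\<sigma> k)\<^sup>2"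
    using assms by (metis divide_self less_irrefl power_not_zero)
  then have 1: "1 - a * (sin (l1 k))\<^sup>2 / (\<sigma> k)\<^sup>2 - b * (sin (l2 k))\<^sup>2 / (\<sigma> k)\<^sup>2 = a * b * (cos (l1 k) + cos (l2 k))\<^sup>2 / (\<sigma> k)\<^sup>2"
    unfolding add_divide_distrib by linarith
  have "Q (- a * sin (l1 k) / \<sigma> k) (- b * sin (l2 k) / \<sigma> k) = 1 - a * (sin (l1 k))\<^sup>2 / (\<sigma> k)\<^sup>2 - b * (sin (l2 k))\<^sup>2 / (\<sigma> k)\<^sup>2"
    using a_pos b_pos by (simp add: Q_def power2_eq_square mult_ac)
  with 1 show ?thesis by (simp add: power_divide)
qed

text \<open>The quotient \<open>tau / sig\<close> is the cotangent of \<open>omega\<close>. This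
  relation recovers it from the velocity once the signed quotient of the sum of cosines by
  \<open>sig\<close> is known.\<close>

lemma velocity_cot:
  assumes "0 < \<sigma> k"
  shows "2 * (a * b) * ((cos (l1 k) + cos (l2 k)) / \<sigma> k) * (tau a b k / \<sigma> k) =
    a - b - (- a * sin (l1 k) / \<sigma> k)\<^sup>2 + (- b * sin (l2 k) / \<sigma> k)\<^sup>2"
proof -
  have "(sin (l1 k))\<^sup>2 = 1 - (cos (l1 k))\<^sup>2" "(sin (l2 k))\<^sup>2 = 1 - (cos (l2 k))\<^sup>2" by (simp_all add: sin_squared_eq)
  moreover have "b = 1 - a" using ab1 by simp
  ultimately have "2 * (a * b) * (cos (l1 k) + cos (l2 k)) * tau a b k =
      (a - b) * (\<sigma> k)\<^sup>2 - a\<^sup>2 * (sin (l1 k))\<^sup>2 + b\<^sup>2 * (sin (l2 k))\<^sup>2"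
    unfolding sig_sq tau_def by algebra
  then have "2 * (a * b) * (cos (l1 k) + cos (l2 k)) * tau a b k / (\<sigma> k)\<^sup>2 =
      ((a - b) * (\<sigma> k)\<^sup>2 - a\<^sup>2 * (sin (l1 k))\<^sup>2 + b\<^sup>2 * (sin (l2 k))\<^sup>2) / (\<sigma> k)\<^sup>2" by simp
  then show ?thesis using assms
    by (simp add: field_simps power2_eq_square)
qed

text \<open>Equal sines and cosines leave only shifts by periods, and each region contains a single
  representative of every generic class.\<close>

lemma branch_core_region:
  assumes "k \<in> branch_core \<mu> \<nu>" "k' \<in> branch_core \<mu> \<nu>" "\<mu> \<le> 1"
    and "sin (l1 k) = sin (l1 k')" "cos (l1 k) = cos (l1 k')" "sin (l2 k) = sin (l2 k')" "cos (l2 k) = cos (l2 k')"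
  shows "k = k'"
proof -
  have g: "sin (l1 k) \<noteq> 0" "sin (l2 k) \<noteq> 0" using assms(1) by (auto simp: branch_core_def generic_def)
  obtain m n :: int where mn: "l1 k' = l1 k + 2 * pi * of_int m" "l2 k' = l2 k + 2 * pi * of_int n"
    using assms(4-7) sin_cos_eq_iff[of "l1 k'" "l1 k"] sin_cos_eq_iff[of "l2 k'" "l2 k"] by (auto simp: mult_ac)
  have R: "(l1 k, l2 k) \<in> l_region \<mu>" "(l1 k', l2 k') \<in> l_region \<mu>"
    using assms(1,2) by (auto simp: branch_core_def branch_domain_iff)
  obtain i j :: int where ij: "\<And>m n. (l1 k + 2 * pi * of_int m, l2 k + 2 * pi * of_int n) \<in> l_region 0 \<longleftrightarrow> m = i \<and> n = j"
    "\<And>m n. (l1 k + 2 * pi * of_int m, l2 k + 2 * pi * of_int n) \<in> l_region 1 \<longleftrightarrow>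
      m = i - fst (quadrant_shift (l1 k) (l2 k)) \<and> n = j - snd (quadrant_shift (l1 k) (l2 k))"
    using l_region_representative[OF g] by blast
  have "m = 0 \<and> n = 0"
  proof (cases "\<mu> = 0")
    case True
    then show ?thesis using ij(1)[of 0 0] ij(1)[of m n] R by (simp add: mn)
  next
    case False
    then have "\<mu> = 1" using assms(3) by simp
    then show ?thesis using ij(2)[of 0 0] ij(2)[of m n] R by (simp add: mn)
  qed
  then have "l1 k = l1 k'" "l2 k = l2 k'" by (auto simp: mn)
  then show "k = k'" by (simp add: l1_def l2_def vec_eq_iff forall_2)
qed

text \<open>The wave vector is reconstructed from its velocity. \<open>velocity_Q\<close> and the
  sign given by \<open>\<nu>\<close> yield the quotient \<open>z\<close>,
  \<open>velocity_cot\<close> yields the cotangent of \<open>omega\<close>, and 1 + cot^2 = 1 /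
  sin^2 yields \<open>sig\<close>. Clearing denominators recovers both sines, \<open>tau\<close> and
  the sum of cosines, hence both cosines.\<close>

lemma inj_on_velocity:
  assumes "\<mu> \<le> 1"
  shows "inj_on V (branch_core \<mu> \<nu>)"
proof (rule inj_onI)
  fix k k' assume k: "k \<in> branch_core \<mu> \<nu>" and k': "k' \<in> branch_core \<mu> \<nu>" and eq: "V k = V k'"
  let ?z = "\<lambda>k. (cos (l1 k) + cos (l2 k)) / \<sigma> k"
  have \<sigma>: "0 < \<sigma> k" "0 < \<sigma> k'" using k k' by (auto simp: branch_core_def generic_def intro!: sig_pos)
  have x: "- a * sin (l1 k) / \<sigma> k = - a * sin (l1 k') / \<sigma> k'" and y: "- b * sin (l2 k) / \<sigma> k = - b * sin (l2 k') / \<sigma> k'"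
    by (simp_all only: velocity_sum_diff[symmetric] eq)
  have "a * b * (?z k)\<^sup>2 = a * b * (?z k')\<^sup>2" using velocity_Q \<sigma> x y by metis
  then have zz: "(?z k)\<^sup>2 = (?z k')\<^sup>2" using a_pos b_pos by simp
  have z: "?z k = ?z k'"
  proof (cases "\<nu> = 0")
    case True
    then have "?z k \<le> 0" "?z k' \<le> 0" using k k' \<sigma> by (auto simp: branch_core_def branch_domain_iff divide_nonpos_pos)
    then show ?thesis using zz by (auto simp: power2_eq_iff)
  next
    case False
    then have "0 \<le> ?z k" "0 \<le> ?z k'" using k k' \<sigma> by (auto simp: branch_core_def branch_domain_iff)
    then show ?thesis using zz by (auto simp: power2_eq_iff)
  qed
  have "cos (l1 k) + cos (l2 k) \<noteq> 0" using k by (auto simp: branch_core_def generic_def)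
  then have "2 * (a * b) * ?z k \<noteq> 0" using \<sigma> a_pos b_pos by auto
  moreover have "2 * (a * b) * ?z k * (tau a b k / \<sigma> k) = 2 * (a * b) * ?z k * (tau a b k' / \<sigma> k')"
    using velocity_cot[OF \<sigma>(1)] velocity_cot[OF \<sigma>(2)] unfolding x y z by (simp only:)
  ultimately have t: "tau a b k / \<sigma> k = tau a b k' / \<sigma> k'" by (metis mult_left_cancel)
  have "1 / (\<sigma> k)\<^sup>2 = 1 + (tau a b k / \<sigma> k)\<^sup>2" if "0 < \<sigma> k" for k
    using that sig_sq[of k] by (simp add: power_divide field_simps)
  then have "1 / (\<sigma> k)\<^sup>2 = 1 / (\<sigma> k')\<^sup>2" using \<sigma> t by metis
  then have s: "\<sigma> k = \<sigma> k'" using \<sigma> by (simp add: power2_eq_iff)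
  then have tau: "tau a b k = tau a b k'" using t \<sigma> by simp
  have s1: "sin (l1 k) = sin (l1 k')" and s2: "sin (l2 k) = sin (l2 k')"
    using x y s \<sigma> a_pos b_pos by simp_all
  have cs: "cos (l1 k) + cos (l2 k) = cos (l1 k') + cos (l2 k')" using z s \<sigma> by simp
  \<comment> \<open>Since \<open>a + b = 1\<close>, \<open>tau\<close> and the sum of cosines can be
    solved linearly for the individual cosines.\<close>
  have "cos (l1 k) = tau a b k + b * (cos (l1 k) + cos (l2 k))" for k
  proof -
    have "tau a b k + b * (cos (l1 k) + cos (l2 k)) = (a + b) * cos (l1 k)" unfolding tau_def by (simp add: algebra_simps)
    then show ?thesis by (simp add: ab1)
  qed
  then have c1: "cos (l1 k) = cos (l1 k')" by (metis cs tau)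
  then have c2: "cos (l2 k) = cos (l2 k')" using cs by simp
  show "k = k'" by (rule branch_core_region[OF k k' assms s1 c1 s2 c2])
qed

lemma velocity_in_ellipse_core:
  assumes "generic k"
  shows "V k \<in> ellipse_core"
proof -
  have g: "sin (l1 k) \<noteq> 0" "sin (l2 k) \<noteq> 0" "cos (l1 k) + cos (l2 k) \<noteq> 0" using assms by (auto simp: generic_def)
  have \<sigma>: "0 < \<sigma> k" by (rule sig_pos[OF g(1)])
  have "0 < Q ((V k $ 1 + V k $ 2) / 2) ((V k $ 1 - V k $ 2) / 2)"
    unfolding velocity_sum_diff velocity_Q[OF \<sigma>]
    using g \<sigma> a_pos b_pos by (intro mult_pos_pos) auto
  moreover have "(V k $ 1 + V k $ 2) / 2 \<noteq> 0" "(V k $ 1 - V k $ 2) / 2 \<noteq> 0"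
    unfolding velocity_sum_diff using g \<sigma> a_pos b_pos by auto
  ultimately show ?thesis by (simp add: ellipse_core_def)
qed

text \<open>Where \<^const>\<open>sig\<close> vanishes, division by zero makes the velocity \<open>0\<close>, which is not in
  \<open>ellipse_core\<close>. So over \<open>ellipse_core\<close> the choice made by \<^const>\<open>k_branch\<close> is never a
  degenerate wave vector.\<close>

lemma generic_if_velocity_in_ellipse_core:
  assumes "V k \<in> ellipse_core"
  shows "generic k"
proof -
  have "(V k $ 1 + V k $ 2) / 2 \<noteq> 0" "(V k $ 1 - V k $ 2) / 2 \<noteq> 0" and Q: "0 < Q ((V k $ 1 + V k $ 2) / 2) ((V k $ 1 - V k $ 2) / 2)"
    using assms by (auto simp: ellipse_core_def)
  then have s: "sin (l1 k) \<noteq> 0" "sin (l2 k) \<noteq> 0" unfolding velocity_sum_diff by auto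
  have "cos (l1 k) + cos (l2 k) \<noteq> 0" using Q unfolding velocity_sum_diff velocity_Q[OF sig_pos[OF s(1)]] by auto
  then show ?thesis using s by (simp add: generic_def)
qed

lemma exists_l_region:
  assumes "c1\<^sup>2 + s1\<^sup>2 = 1" "c2\<^sup>2 + s2\<^sup>2 = 1" "s1 \<noteq> 0" "s2 \<noteq> 0" "\<mu> \<le> 1"
  obtains k where "(l1 k, l2 k) \<in> l_region \<mu>" "cos (l1 k) = c1" "sin (l1 k) = s1" "cos (l2 k) = c2" "sin (l2 k) = s2"
proof -
  obtain y1 where y1: "c1 = cos y1" "s1 = sin y1" using sincos_total_2pi[OF assms(1)] by metis
  obtain y2 where y2: "c2 = cos y2" "s2 = sin y2" using sincos_total_2pi[OF assms(2)] by metis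
  have nz: "sin y1 \<noteq> 0" "sin y2 \<noteq> 0" using assms(3,4) y1 y2 by simp_all
  obtain i j :: int where ij: "\<And>m n. (y1 + 2 * pi * of_int m, y2 + 2 * pi * of_int n) \<in> l_region 0 \<longleftrightarrow> m = i \<and> n = j"
    "\<And>m n. (y1 + 2 * pi * of_int m, y2 + 2 * pi * of_int n) \<in> l_region 1 \<longleftrightarrow>
      m = i - fst (quadrant_shift y1 y2) \<and> n = j - snd (quadrant_shift y1 y2)"
    using l_region_representative[OF nz] by blast
  have "\<exists>m n. (y1 + 2 * pi * of_int m, y2 + 2 * pi * of_int n) \<in> l_region \<mu>"
  proof (cases "\<mu> = 0")
    case True
    then show ?thesis using ij(1)[of i j] by blast
  next
    case False
    then have "\<mu> = 1" using assms(5) by simp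
    then show ?thesis using ij(2) by blast
  qed
  then obtain m n :: int where mn: "(y1 + 2 * pi * of_int m, y2 + 2 * pi * of_int n) \<in> l_region \<mu>" by blast
  let ?p = "y1 + 2 * pi * of_int m" and ?q = "y2 + 2 * pi * of_int n"
  let ?k = "vector [(?p - ?q) / 2, (?p + ?q) / 2] :: real ^ 2"
  have "l1 ?k = ?p" "l2 ?k = ?q" by (simp_all add: l1_def l2_def field_simps)
  then show ?thesis using mn y1 y2 by (intro that[of ?k]) simp_all
qed

text \<open>The reconstruction behind injectivity is run as a construction. What has to be checked
  is that the prescribed cosines and sines lie on the unit circle.\<close>

lemma ellipse_core_subset_velocity:
  assumes v: "v \<in> ellipse_core" and \<mu>: "\<mu> \<le> 1"
  shows "\<exists>k\<in>branch_core \<mu> \<nu>. V k = v"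
proof -
  define x where "x = (v $ 1 + v $ 2) / 2"
  define y where "y = (v $ 1 - v $ 2) / 2"
  have xy: "x \<noteq> 0" "y \<noteq> 0" and Q: "0 < Q x y" using v by (auto simp: ellipse_core_def x_def y_def)
  \<comment> \<open>The value of the sum of cosines over \<open>sig\<close> forced by
    \<open>velocity_Q\<close>, with the sign that \<open>branch_domain\<close> prescribes.\<close>
  define z where "z = (if \<nu> = 0 then - sqrt (Q x y / (a * b)) else sqrt (Q x y / (a * b)))"
  have z2: "a * b * z\<^sup>2 = Q x y" and z0: "z \<noteq> 0" using Q a_pos b_pos by (auto simp: z_def)
  \<comment> \<open>The cotangent of \<open>omega\<close>, solved from \<open>velocity_cot\<close>;
    \<open>S\<close> below is the corresponding positive sine.\<close>
  define t where "t = (a - b - x\<^sup>2 + y\<^sup>2) / (2 * (a * b) * z)"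
  have t: "2 * (a * b) * z * t = a - b - x\<^sup>2 + y\<^sup>2" using z0 a_pos b_pos by (simp add: t_def)
  define S where "S = 1 / sqrt (1 + t\<^sup>2)"
  have t1: "0 < 1 + t\<^sup>2" by (smt (verit) zero_le_power2)
  have S: "0 < S" "S\<^sup>2 * (1 + t\<^sup>2) = 1" using t1 by (auto simp: S_def power_divide)
  have z2': "a * b * (a * b) * z\<^sup>2 = a * b - b * x\<^sup>2 - a * y\<^sup>2"
  proof -
    have "a * b * (a * b * z\<^sup>2) = a * b - b * x\<^sup>2 - a * y\<^sup>2" unfolding z2 Q_def using a_pos b_pos by (simp add: field_simps)
    then show ?thesis by (simp add: mult_ac)
  qed
  \<comment> \<open>The cosine solves \<open>tau = t * S\<close> together with a sum of cosines
    equal to \<open>z * S\<close>. After denominators are cleared, the relations for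
    \<open>z\<close> and \<open>t\<close> reduce the claim to a remainder with the factor
    \<open>1 - (a + b)\<close>.\<close>
  have cs1: "(t * S + b * z * S)\<^sup>2 + (- x * S / a)\<^sup>2 = 1"
  proof -
    have "a\<^sup>2 * (b * ((t + b * z)\<^sup>2 + x\<^sup>2 / a\<^sup>2)) = a\<^sup>2 * b * (t + b * z)\<^sup>2 + b * x\<^sup>2" using a_pos by (simp add: field_simps)
    also have "\<dots> = a\<^sup>2 * b * t\<^sup>2 + a * b * (2 * (a * b) * z * t) + b * (a * b * (a * b) * z\<^sup>2) + b * x\<^sup>2"
      by (simp add: power2_eq_square algebra_simps)
    also have "\<dots> = a\<^sup>2 * (b * (1 + t\<^sup>2)) + b * x\<^sup>2 * (1 - (a + b))"
      unfolding t z2' by (simp add: power2_eq_square algebra_simps)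
    also have "\<dots> = a\<^sup>2 * (b * (1 + t\<^sup>2))" by (simp add: ab1)
    finally have "(t + b * z)\<^sup>2 + x\<^sup>2 / a\<^sup>2 = 1 + t\<^sup>2" using a_pos b_pos by simp
    then have "S\<^sup>2 * ((t + b * z)\<^sup>2 + x\<^sup>2 / a\<^sup>2) = 1" using S by simp
    then show ?thesis by (simp add: power2_eq_square algebra_simps)
  qed
  have cs2: "(a * z * S - t * S)\<^sup>2 + (- y * S / b)\<^sup>2 = 1"
  proof -
    have "b\<^sup>2 * (a * ((a * z - t)\<^sup>2 + y\<^sup>2 / b\<^sup>2)) = b\<^sup>2 * a * (a * z - t)\<^sup>2 + a * y\<^sup>2" using b_pos by (simp add: field_simps)
    also have "\<dots> = b\<^sup>2 * a * t\<^sup>2 - a * b * (2 * (a * b) * z * t) + a * (a * b * (a * b) * z\<^sup>2) + a * y\<^sup>2"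
      by (simp add: power2_eq_square algebra_simps)
    also have "\<dots> = b\<^sup>2 * (a * (1 + t\<^sup>2)) + a * y\<^sup>2 * (1 - (a + b))"
      unfolding t z2' by (simp add: power2_eq_square algebra_simps)
    also have "\<dots> = b\<^sup>2 * (a * (1 + t\<^sup>2))" by (simp add: ab1)
    finally have "(a * z - t)\<^sup>2 + y\<^sup>2 / b\<^sup>2 = 1 + t\<^sup>2" using a_pos b_pos by simp
    then have "S\<^sup>2 * ((a * z - t)\<^sup>2 + y\<^sup>2 / b\<^sup>2) = 1" using S by simp
    then show ?thesis by (simp add: power2_eq_square algebra_simps)
  qed
  obtain k where k: "(l1 k, l2 k) \<in> l_region \<mu>" "cos (l1 k) = t * S + b * z * S" "sin (l1 k) = - x * S / a"
    "cos (l2 k) = a * z * S - t * S" "sin (l2 k) = - y * S / b"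
    by (rule exists_l_region[OF cs1 cs2 _ _ \<mu>]) (use xy S a_pos b_pos in auto)
  have "tau a b k = (a + b) * (t * S)" unfolding tau_def k by (simp add: algebra_simps)
  then have tau: "tau a b k = t * S" by (simp add: ab1)
  have "(\<sigma> k)\<^sup>2 = S\<^sup>2" unfolding sig_sq tau using S by (simp add: algebra_simps)
  moreover have "0 \<le> \<sigma> k" unfolding sig_def using sig_sq[of k] by (metis real_sqrt_ge_zero zero_le_power2)
  ultimately have sg: "\<sigma> k = S" using S by (simp add: power2_eq_iff)
  have "cos (l1 k) + cos (l2 k) = (a + b) * (z * S)" unfolding k by (simp add: algebra_simps)
  then have cc: "cos (l1 k) + cos (l2 k) = z * S" by (simp add: ab1)
  have "sin (l1 k) \<noteq> 0" "sin (l2 k) \<noteq> 0" using xy S a_pos b_pos by (simp_all add: k)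
  moreover have "cos (l1 k) + cos (l2 k) \<noteq> 0" using S z0 by (simp add: cc)
  ultimately have "generic k" by (simp only: generic_def simp_thms)
  moreover have "(if \<nu> = 0 then cos (l1 k) + cos (l2 k) \<le> 0 else cos (l1 k) + cos (l2 k) \<ge> 0)"
    unfolding cc using S Q a_pos b_pos by (auto simp: z_def)
  ultimately have "k \<in> branch_core \<mu> \<nu>" using k(1) by (simp add: branch_core_def branch_domain_iff)
  moreover have "V k = v"
  proof -
    have "(V k $ 1 + V k $ 2) / 2 = x" "(V k $ 1 - V k $ 2) / 2 = y"
      unfolding velocity_sum_diff sg k using S a_pos b_pos by simp_all
    then show ?thesis unfolding x_def y_def by (simp add: vec_eq_iff forall_2)
  qed
  ultimately show ?thesis by blast
qed

lemma velocity_image: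
  assumes "\<mu> \<le> 1"
  shows "V ` branch_core \<mu> \<nu> = ellipse_core"
proof
  show "V ` branch_core \<mu> \<nu> \<subseteq> ellipse_core"
    using velocity_in_ellipse_core by (auto simp: branch_core_def)
  show "ellipse_core \<subseteq> V ` branch_core \<mu> \<nu>"
    using ellipse_core_subset_velocity[OF _ assms] by fast
qed

lemma k_branch_velocity:
  assumes k: "k \<in> branch_core \<mu> \<nu>" and \<mu>: "\<mu> \<le> 1"
  shows "k_branch a b \<mu> \<nu> (V k) = k"
proof -
  have kd: "k \<in> branch_domain \<mu> \<nu>" and g: "generic k" using k by (auto simp: branch_core_def)
  let ?k = "k_branch a b \<mu> \<nu> (V k)"
  have "V k \<in> V ` branch_domain \<mu> \<nu>" using kd by blast
  then have k': "?k \<in> branch_domain \<mu> \<nu>" "V ?k = V k"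
    unfolding k_branch_def by (auto intro: inv_into_into f_inv_into_f)
  then have "generic ?k" using generic_if_velocity_in_ellipse_core velocity_in_ellipse_core[OF g] by simp
  then have "?k \<in> branch_core \<mu> \<nu>" using k' by (simp add: branch_core_def)
  then show ?thesis using inj_on_velocity[OF \<mu>] k k'(2) by (auto dest: inj_onD)
qed

lemma negligible_ellipse_minus_core: "negligible (ellipse a b - ellipse_core)"
proof -
  \<comment> \<open>This linear map stretches the unit circle to the boundary of the ellipse, which
    is therefore null; the rest of the difference lies on the two axes.\<close>
  let ?L = "\<lambda>u :: real ^ 2. vector [sqrt a * u $ 1 + sqrt b * u $ 2, sqrt a * u $ 1 - sqrt b * u $ 2] :: real ^ 2"
  have lin: "linear ?L" by (rule linearI) (simp_all add: vec_eq_iff forall_2 algebra_simps)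
  have bd: "negligible (?L ` sphere 0 1)" 
    by (rule negligible_differentiable_image_negligible[OF order_refl negligible_sphere linear_imp_differentiable_on[OF lin]])
  have nz: "vector [1, 1] \<noteq> (0 :: real ^ 2)" "vector [1, -1] \<noteq> (0 :: real ^ 2)"
    by (auto simp: vec_eq_iff forall_2)
  have "v \<in> ?L ` sphere 0 1 \<union> {v. vector [1, 1] \<bullet> v = 0} \<union> {v. vector [1, -1] \<bullet> v = 0}"
    if v: "v \<in> ellipse a b - ellipse_core" for v
  proof (cases "v $ 1 + v $ 2 = 0 \<or> v $ 1 - v $ 2 = 0")
    case True
    then show ?thesis by (auto simp: inner_vec_def sum_2)
  next
    case False
    define x where "x = (v $ 1 + v $ 2) / 2"
    define y where "y = (v $ 1 - v $ 2) / 2"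
    have "Q x y = 0" using v False unfolding x_def y_def by (auto simp: ellipse_iff ellipse_core_def)
    then have "(x / sqrt a)\<^sup>2 + (y / sqrt b)\<^sup>2 = 1" using a_pos b_pos by (simp add: Q_def power_divide)
    then have "norm (vector [x / sqrt a, y / sqrt b] :: real ^ 2) = 1"
      by (simp add: norm_vec_def L2_set_def sum_2)
    moreover have "v = ?L (vector [x / sqrt a, y / sqrt b])"
      using a_pos b_pos by (simp add: vec_eq_iff forall_2 x_def y_def field_simps)
    ultimately have "v \<in> ?L ` sphere 0 1" by (intro image_eqI[of _ _ "vector [x / sqrt a, y / sqrt b]"]) auto
    then show ?thesis by blast
  qed
  then have "ellipse a b - ellipse_core \<subseteq> ?L ` sphere 0 1 \<union> {v. vector [1, 1] \<bullet> v = 0} \<union> {v. vector [1, -1] \<bullet> v = 0}"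
    by blast
  then show ?thesis
    by (rule negligible_subset[rotated]) (intro negligible_Un bd negligible_hyperplane; use nz in blast)
qed

end

section \<open>The Jacobian of the velocity map\<close>

lemma has_derivative_l:
  "(l1 has_derivative (\<lambda>h. h $ 2 + h $ 1)) (at k within S)"
  "(l2 has_derivative (\<lambda>h. h $ 2 - h $ 1)) (at k within S)"
proof -
  have nth: "((\<lambda>k :: real ^ 2. k $ i) has_derivative (\<lambda>h. h $ i)) (at k within S)" for i
    by (rule bounded_linear_imp_has_derivative) (rule bounded_linear_vec_nth)
  show "(l1 has_derivative (\<lambda>h. h $ 2 + h $ 1)) (at k within S)"
    unfolding l1_def[abs_def] by (intro has_derivative_add nth)
  show "(l2 has_derivative (\<lambda>h. h $ 2 - h $ 1)) (at k within S)"
    unfolding l2_def[abs_def] by (intro has_derivative_diff nth)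
qed

lemma det_vector_2:
  "det (matrix (\<lambda>h :: real ^ 2. vector [p * h $ 1 + q * h $ 2, r * h $ 1 + s * h $ 2] :: real ^ 2)) = p * s - q * r"
  by (simp add: det_2 matrix_def axis_def)

text \<open>After the sines are eliminated, the Jacobian and the denominator of the density are
  expressed through the two cosines. Substituting \<open>b = 1 - a\<close> shows that both are
  governed by the same quantity \<open>a * b * (c1 + c2)\<close>.\<close>

lemma
  fixes a b c1 c2 t :: real
  assumes "a + b = 1" and t: "t = a * c1 - b * c2"
  shows jacobian_identity: "c1 * c2 * (1 - t\<^sup>2) + t * (b * c1 * (1 - c2\<^sup>2) - a * c2 * (1 - c1\<^sup>2)) = a * b * (c1 + c2)\<^sup>2"
    and complements_identity: "((1 - t\<^sup>2) + a\<^sup>2 * (1 - c1\<^sup>2) - b\<^sup>2 * (1 - c2\<^sup>2))\<^sup>2 - 4 * (1 - t\<^sup>2) * (a\<^sup>2 * (1 - c1\<^sup>2)) = 4 * (a * b * (c1 + c2))\<^sup>2"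
proof -
  have b: "b = 1 - a" using assms(1) by simp
  show "c1 * c2 * (1 - t\<^sup>2) + t * (b * c1 * (1 - c2\<^sup>2) - a * c2 * (1 - c1\<^sup>2)) = a * b * (c1 + c2)\<^sup>2"
    unfolding t b by (simp add: algebra_simps power2_eq_square)
  show "((1 - t\<^sup>2) + a\<^sup>2 * (1 - c1\<^sup>2) - b\<^sup>2 * (1 - c2\<^sup>2))\<^sup>2 - 4 * (1 - t\<^sup>2) * (a\<^sup>2 * (1 - c1\<^sup>2)) = 4 * (a * b * (c1 + c2))\<^sup>2"
    unfolding t b by (simp add: algebra_simps power2_eq_square)
qed

context coin_params
begin

text \<open>With X and Y the half sum and half difference of the velocity, these are the partial
  derivatives of X in \<open>l1\<close>, of X in \<open>l2\<close> and of Y in \<open>l2\<close>.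
  The derivative of Y in \<open>l1\<close> is \<open>- dX2\<close>.\<close>

abbreviation dX1 :: "real ^ 2 \<Rightarrow> real" where
  "dX1 k \<equiv> (- a * cos (l1 k) * (\<sigma> k)\<^sup>2 + a\<^sup>2 * (sin (l1 k))\<^sup>2 * tau a b k) / (\<sigma> k) ^ 3"
abbreviation dX2 :: "real ^ 2 \<Rightarrow> real" where
  "dX2 k \<equiv> - a * b * sin (l1 k) * sin (l2 k) * tau a b k / (\<sigma> k) ^ 3"
abbreviation dY2 :: "real ^ 2 \<Rightarrow> real" where
  "dY2 k \<equiv> (- b * cos (l2 k) * (\<sigma> k)\<^sup>2 - b\<^sup>2 * (sin (l2 k))\<^sup>2 * tau a b k) / (\<sigma> k) ^ 3"

definition dV :: "real ^ 2 \<Rightarrow> real ^ 2 \<Rightarrow> real ^ 2" where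
  "dV k h = vector
    [(dX1 k - dX2 k - dX2 k - dY2 k) * h $ 1 + (dX1 k + dX2 k - dX2 k + dY2 k) * h $ 2,
     (dX1 k - dX2 k + dX2 k + dY2 k) * h $ 1 + (dX1 k + dX2 k + dX2 k - dY2 k) * h $ 2]"

lemma has_derivative_sig:
  assumes "0 < \<sigma> k"
  shows "(\<sigma> has_derivative (\<lambda>h. (a * sin (l1 k) * (h $ 2 + h $ 1) - b * sin (l2 k) * (h $ 2 - h $ 1)) * tau a b k / \<sigma> k)) (at k within S)"
proof -
  have p: "0 < 1 - (tau a b k)\<^sup>2" using assms by (simp add: sig_def)
  have t: "(tau a b has_derivative (\<lambda>h. - a * sin (l1 k) * (h $ 2 + h $ 1) + b * sin (l2 k) * (h $ 2 - h $ 1))) (at k within S)"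
    unfolding tau_def[abs_def] by (auto intro!: derivative_eq_intros has_derivative_l)
  show ?thesis
    unfolding sig_def[abs_def]
    by (rule derivative_eq_intros refl t p)+ (use p in \<open>auto simp: fun_eq_iff field_simps\<close>)
qed

lemma has_derivative_coords:
  assumes "0 < \<sigma> k"
  shows "((\<lambda>k. - a * sin (l1 k) / \<sigma> k) has_derivative (\<lambda>h. dX1 k * (h $ 2 + h $ 1) + dX2 k * (h $ 2 - h $ 1))) (at k within S)"
    and "((\<lambda>k. - b * sin (l2 k) / \<sigma> k) has_derivative (\<lambda>h. - dX2 k * (h $ 2 + h $ 1) + dY2 k * (h $ 2 - h $ 1))) (at k within S)"
proof -
  have nz: "\<sigma> k \<noteq> 0" using assms by simp
  have n1: "((\<lambda>k. - a * sin (l1 k)) has_derivative (\<lambda>h. - a * cos (l1 k) * (h $ 2 + h $ 1))) (at k within S)"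
    by (auto intro!: derivative_eq_intros has_derivative_l)
  have n2: "((\<lambda>k. - b * sin (l2 k)) has_derivative (\<lambda>h. - b * cos (l2 k) * (h $ 2 - h $ 1))) (at k within S)"
    by (auto intro!: derivative_eq_intros has_derivative_l)
  have eq: "(N' * s - N * (Z * t / s)) / (s * s) = (N' * s\<^sup>2 - N * Z * t) / s ^ 3" if "s \<noteq> 0" for N N' Z t s :: real
    using that by (simp add: divide_simps power2_eq_square power3_eq_cube)
  have lin: "x / c * u + y / c * w = (x * u + y * w) / c" "- (x / c) * u + y / c * w = (- x * u + y * w) / c"
    for c x y u w :: real
    by (simp_all add: add_divide_distrib diff_divide_distrib)
  show "((\<lambda>k. - a * sin (l1 k) / \<sigma> k) has_derivative (\<lambda>h. dX1 k * (h $ 2 + h $ 1) + dX2 k * (h $ 2 - h $ 1))) (at k within S)"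
    by (rule has_derivative_eq_rhs[OF has_derivative_divide'[OF n1 has_derivative_sig[OF assms] nz]])
      (rule ext, unfold eq[OF nz] lin, rule arg_cong[where f = "\<lambda>x. x / \<sigma> k ^ 3"], simp add: power2_eq_square algebra_simps)
  show "((\<lambda>k. - b * sin (l2 k) / \<sigma> k) has_derivative (\<lambda>h. - dX2 k * (h $ 2 + h $ 1) + dY2 k * (h $ 2 - h $ 1))) (at k within S)"
    by (rule has_derivative_eq_rhs[OF has_derivative_divide'[OF n2 has_derivative_sig[OF assms] nz]])
      (rule ext, unfold eq[OF nz] lin, rule arg_cong[where f = "\<lambda>x. x / \<sigma> k ^ 3"], simp add: power2_eq_square algebra_simps)
qed

lemma has_derivative_velocity:
  assumes "0 < \<sigma> k"
  shows "(V has_derivative dV k) (at k within S)"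
proof -
  note xy = has_derivative_coords[OF assms, of S]
  have V: "V k $ 1 = - a * sin (l1 k) / \<sigma> k + - b * sin (l2 k) / \<sigma> k"
    "V k $ 2 = - a * sin (l1 k) / \<sigma> k - - b * sin (l2 k) / \<sigma> k" for k
    by (simp_all add: velocity_def sig_def add_divide_distrib diff_divide_distrib)
  have lin: "(x * (h2 + h1) + z * (h2 - h1)) + (- z * (h2 + h1) + y * (h2 - h1)) = (x - z - z - y) * h1 + (x + z - z + y) * h2"
    "(x * (h2 + h1) + z * (h2 - h1)) - (- z * (h2 + h1) + y * (h2 - h1)) = (x - z + z + y) * h1 + (x + z + z - y) * h2"
    for x y z h1 h2 :: real
    by (simp_all add: algebra_simps)
  have "((\<lambda>k. V k $ i) has_derivative (\<lambda>h. dV k h $ i)) (at k within S)" for i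
  proof -
    consider "i = 1" | "i = 2" using exhaust_2 by blast
    then show ?thesis
    proof cases
      case 1
      show ?thesis unfolding 1 V dV_def vector_2
        by (rule has_derivative_eq_rhs[OF has_derivative_add[OF xy]]) (rule ext, rule lin)
    next
      case 2
      show ?thesis unfolding 2 V dV_def vector_2
        by (rule has_derivative_eq_rhs[OF has_derivative_diff[OF xy]]) (rule ext, rule lin)
    qed
  qed
  then show ?thesis
    by (subst has_derivative_componentwise_within) (auto simp: Basis_vec_def inner_axis)
qed

text \<open>The factor -4 is the product of the determinants 2 and -2 of the linear changes from
  \<open>k\<close> to (\<open>l1\<close>, \<open>l2\<close>) and from the half sum and half
  difference to the velocity. The plus sign in front of the square of \<open>dX2\<close> comes from
  the opposite mixed derivatives.\<close>

lemma det_dV: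
  assumes "0 < \<sigma> k"
  shows "\<bar>det (matrix (dV k))\<bar> = 4 * (a * b * (cos (l1 k) + cos (l2 k)))\<^sup>2 / (\<sigma> k) ^ 4"
proof -
  let ?c1 = "cos (l1 k)" and ?c2 = "cos (l2 k)" and ?t = "tau a b k" and ?s = "\<sigma> k"
  have cof: "det (matrix (dV k)) = - 4 * (dX1 k * dY2 k + dX2 k * dX2 k)"
  proof -
    have "dV k = (\<lambda>h. vector
      [(dX1 k - dX2 k - dX2 k - dY2 k) * h $ 1 + (dX1 k + dX2 k - dX2 k + dY2 k) * h $ 2,
       (dX1 k - dX2 k + dX2 k + dY2 k) * h $ 1 + (dX1 k + dX2 k + dX2 k - dY2 k) * h $ 2])"
      by (simp add: dV_def fun_eq_iff)
    moreover have "(x - z - z - y) * (x + z + z - y) - (x + z - z + y) * (x - z + z + y) = - 4 * (x * y + z * z)" for x y z :: real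
      by (simp add: algebra_simps)
    ultimately show ?thesis by (simp only: det_vector_2)
  qed
  define p where "p = (sin (l1 k))\<^sup>2"
  define q where "q = (sin (l2 k))\<^sup>2"
  have p: "p = 1 - ?c1\<^sup>2" and q: "q = 1 - ?c2\<^sup>2" by (simp_all add: p_def q_def sin_squared_eq)
  have s2: "?s\<^sup>2 = 1 - ?t\<^sup>2" by (rule sig_sq)
  have X: "dX1 k = a * (- ?c1 * ?s\<^sup>2 + a * p * ?t) / ?s ^ 3" and Y: "dY2 k = b * (- ?c2 * ?s\<^sup>2 - b * q * ?t) / ?s ^ 3"
    by (simp_all add: p_def q_def algebra_simps power2_eq_square)
  have "dX2 k * dX2 k = a\<^sup>2 * b\<^sup>2 * p * q * ?t\<^sup>2 / (?s ^ 3 * ?s ^ 3)"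
    by (simp add: p_def q_def power2_eq_square algebra_simps)
  then have "dX1 k * dY2 k + dX2 k * dX2 k = (a * (- ?c1 * ?s\<^sup>2 + a * p * ?t) * (b * (- ?c2 * ?s\<^sup>2 - b * q * ?t)) + a\<^sup>2 * b\<^sup>2 * p * q * ?t\<^sup>2) / (?s ^ 3 * ?s ^ 3)"
    unfolding X Y by (simp only: add_divide_distrib times_divide_times_eq)
  \<comment> \<open>The product of the two terms containing \<open>tau\<close> cancels the square of
    \<open>dX2\<close>; everything left carries a factor \<open>sig^2\<close>.\<close>
  also have "a * (- ?c1 * ?s\<^sup>2 + a * p * ?t) * (b * (- ?c2 * ?s\<^sup>2 - b * q * ?t)) + a\<^sup>2 * b\<^sup>2 * p * q * ?t\<^sup>2
      = a * b * ?s\<^sup>2 * (?c1 * ?c2 * ?s\<^sup>2 + ?t * (b * ?c1 * q - a * ?c2 * p))"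
    by (simp add: algebra_simps power2_eq_square)
  also have "?c1 * ?c2 * ?s\<^sup>2 + ?t * (b * ?c1 * q - a * ?c2 * p) = a * b * (?c1 + ?c2)\<^sup>2"
    unfolding s2 p q by (rule jacobian_identity[OF ab1 tau_def])
  also have "a * b * ?s\<^sup>2 * (a * b * (?c1 + ?c2)\<^sup>2) / (?s ^ 3 * ?s ^ 3) = (a * b * (?c1 + ?c2))\<^sup>2 / ?s ^ 4"
  proof -
    have "A * S * (A * C) / (S * T) = A * A * C / T" if "S \<noteq> 0" for A S C T :: real
      using that by simp
    moreover have "?s ^ 3 * ?s ^ 3 = ?s\<^sup>2 * ?s ^ 4" by (simp flip: power_add)
    ultimately have "a * b * ?s\<^sup>2 * (a * b * (?c1 + ?c2)\<^sup>2) / (?s ^ 3 * ?s ^ 3) = (a * b) * (a * b) * (?c1 + ?c2)\<^sup>2 / ?s ^ 4"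
      using assms by (metis less_irrefl power_not_zero)
    then show ?thesis by (simp add: power2_eq_square mult_ac)
  qed
  finally show ?thesis unfolding cof by (simp add: abs_mult)
qed

text \<open>Multiplying the two complements leaves only squares of the sines, so the product can be
  expressed in cosines. Its value is the modulus of the Jacobian.\<close>

lemma velocity_complements:
  assumes "0 < \<sigma> k"
  shows "(1 - (V k $ 1)\<^sup>2) * (1 - (V k $ 2)\<^sup>2) = 4 * (a * b * (cos (l1 k) + cos (l2 k)))\<^sup>2 / (\<sigma> k) ^ 4"
proof -
  let ?c1 = "cos (l1 k)" and ?c2 = "cos (l2 k)" and ?t = "tau a b k" and ?s = "\<sigma> k"
  define A where "A = a * sin (l1 k)"
  define B where "B = b * sin (l2 k)"
  have A2: "A\<^sup>2 = a\<^sup>2 * (1 - ?c1\<^sup>2)" and B2: "B\<^sup>2 = b\<^sup>2 * (1 - ?c2\<^sup>2)"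
    by (simp_all add: A_def B_def power_mult_distrib sin_squared_eq)
  have s2: "?s\<^sup>2 = 1 - ?t\<^sup>2" by (rule sig_sq)
  have V: "V k $ 1 = - (A + B) / ?s" "V k $ 2 = - (A - B) / ?s"
    by (simp_all add: velocity_def sig_def A_def B_def)
  have "(1 - (V k $ 1)\<^sup>2) * (1 - (V k $ 2)\<^sup>2) = ((?s\<^sup>2 - (A + B)\<^sup>2) / ?s\<^sup>2) * ((?s\<^sup>2 - (A - B)\<^sup>2) / ?s\<^sup>2)"
    unfolding V power_divide power2_minus using assms by (simp add: diff_divide_distrib)
  also have "\<dots> = ((?s\<^sup>2 + A\<^sup>2 - B\<^sup>2)\<^sup>2 - 4 * ?s\<^sup>2 * A\<^sup>2) / ?s ^ 4"
    by (simp add: power2_eq_square power4_eq_xxxx algebra_simps)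
  also have "(?s\<^sup>2 + A\<^sup>2 - B\<^sup>2)\<^sup>2 - 4 * ?s\<^sup>2 * A\<^sup>2 = 4 * (a * b * (?c1 + ?c2))\<^sup>2"
    unfolding A2 B2 s2 by (rule complements_identity[OF ab1 tau_def])
  finally show ?thesis .
qed

lemma ellipse_core_subset: "ellipse_core \<subseteq> ellipse a b"
  by (auto simp: ellipse_iff ellipse_core_def)

text \<open>On the core the Jacobian times the density is the constant 1 / pi^2. Integrability in
  \<open>v\<close> also comes out of the change of variables theorem, which is how compositions with
  the choice \<open>k_branch\<close> are handled.\<close>

lemma branch_change_of_variables:
  fixes \<phi> :: "real ^ 2 \<Rightarrow> real ^ 2 \<Rightarrow> real"
  assumes \<mu>: "\<mu> \<le> 1" and int: "set_integrable lebesgue (branch_core \<mu> \<nu>) (\<lambda>k. \<phi> k (V k))"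
  shows "integrable lebesgue (\<lambda>v. \<phi> (k_branch a b \<mu> \<nu> v) v * f_density a b v)"
    and "(LINT v|lebesgue. \<phi> (k_branch a b \<mu> \<nu> v) v * f_density a b v) =
      (LINT k:branch_core \<mu> \<nu>|lebesgue. \<phi> k (V k)) / pi\<^sup>2"
proof -
  define H where "H v = \<phi> (k_branch a b \<mu> \<nu> v) v * f_density a b v" for v
  let ?C = "branch_core \<mu> \<nu>"
  have der: "(V has_derivative dV k) (at k within ?C)" if "k \<in> ?C" for k
    using that by (intro has_derivative_velocity sig_pos) (auto simp: branch_core_def generic_def)
  have pull: "\<bar>det (matrix (dV k))\<bar> * H (V k) = \<phi> k (V k) / pi\<^sup>2" if k: "k \<in> ?C" for k
  proof -
    have g: "generic k" using k by (simp add: branch_core_def)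
    then have \<sigma>: "0 < \<sigma> k" by (auto simp: generic_def intro: sig_pos)
    have "0 < 4 * (a * b * (cos (l1 k) + cos (l2 k)))\<^sup>2 / (\<sigma> k) ^ 4"
      using g \<sigma> a_pos b_pos by (intro divide_pos_pos mult_pos_pos) (auto simp: generic_def)
    moreover have "V k \<in> ellipse a b" using velocity_in_ellipse_core[OF g] ellipse_core_subset by blast
    moreover have "A * B * (p * (1 / (pi\<^sup>2 * A * B) * 1)) = p / pi\<^sup>2" if "0 < A * B" for A B p :: real
    proof -
      have "A \<noteq> 0" "B \<noteq> 0" using that by auto
      then show ?thesis by simp
    qed
    ultimately show ?thesis
      unfolding H_def k_branch_velocity[OF k \<mu>] det_dV[OF \<sigma>] f_density_def velocity_complements[OF \<sigma>, symmetric]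
      by (simp only: indicator_simps)
  qed
  have "(\<lambda>k. \<phi> k (V k) / pi\<^sup>2) absolutely_integrable_on ?C" using int by (rule set_integrable_divide)
  \<comment> \<open>The real integrand is carried through \<open>real ^ 1\<close> because the change
    of variables theorem is applied to vector-valued functions.\<close>
  then have 1: "(\<lambda>k. \<bar>det (matrix (dV k))\<bar> *\<^sub>R (vec (H (V k)) :: real ^ 1)) absolutely_integrable_on ?C"
    unfolding absolutely_integrable_on_1_iff
    by (rule set_integrable_cong[THEN iffD1, rotated -1]) (auto simp: pull)
  have "integral ?C (\<lambda>k. \<bar>det (matrix (dV k))\<bar> *\<^sub>R (vec (H (V k)) :: real ^ 1)) = vec (integral ?C (\<lambda>k. \<phi> k (V k) / pi\<^sup>2))"
    unfolding integral_on_1_eq by (intro arg_cong[where f = vec] Henstock_Kurzweil_Integration.integral_cong) (simp add: pull)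
  with 1 have cov: "(\<lambda>v. vec (H v) :: real ^ 1) absolutely_integrable_on V ` ?C"
    "integral (V ` ?C) (\<lambda>v. vec (H v) :: real ^ 1) = vec (integral ?C (\<lambda>k. \<phi> k (V k) / pi\<^sup>2))"
    using has_absolute_integral_change_of_variables[OF branch_core_sets[OF \<mu>] der inj_on_velocity[OF \<mu>],
        where f = "\<lambda>v. vec (H v) :: real ^ 1"] by blast+
  have H: "H absolutely_integrable_on ellipse_core" "integral ellipse_core H = integral ?C (\<lambda>k. \<phi> k (V k) / pi\<^sup>2)"
    using cov unfolding velocity_image[OF \<mu>] absolutely_integrable_on_1_iff integral_on_1_eq
    by (simp_all add: vec_eq_iff)
  \<comment> \<open>The density vanishes off the ellipse and the ellipse exceeds its core by a null
    set, so integrating over the core or over the plane gives the same value.\<close>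
  have neg: "negligible {v \<in> ellipse_core - UNIV. H v \<noteq> 0}" "negligible {v \<in> UNIV - ellipse_core. H v \<noteq> 0}"
    by (simp, rule negligible_subset[OF negligible_ellipse_minus_core])
      (auto simp: H_def f_density_def indicator_def split: if_splits)
  have HU: "H absolutely_integrable_on UNIV"
    using H(1) absolutely_integrable_spike_set_eq[OF neg] by blast
  then show "integrable lebesgue (\<lambda>v. \<phi> (k_branch a b \<mu> \<nu> v) v * f_density a b v)"
    by (simp add: H_def[abs_def] set_integrable_def)
  have "(LINT v|lebesgue. H v) = integral UNIV H"
    using set_lebesgue_integral_eq_integral(2)[OF HU] by (simp add: set_lebesgue_integral_def)
  also have "\<dots> = integral ellipse_core H" using integral_spike_set[OF neg] by simp
  also have "\<dots> = (LINT k:?C|lebesgue. \<phi> k (V k) / pi\<^sup>2)"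
    unfolding H(2) by (rule set_lebesgue_integral_eq_integral(2)[symmetric]) (rule set_integrable_divide[OF int])
  finally show "(LINT v|lebesgue. \<phi> (k_branch a b \<mu> \<nu> v) v * f_density a b v) =
      (LINT k:?C|lebesgue. \<phi> k (V k)) / pi\<^sup>2" by (simp add: H_def)
qed

end

section \<open>The limit\<close>

text \<open>Reflection is the diagonal affine map with all factors -1, whose Jacobian has modulus
  1.\<close>

lemma
  fixes f :: "'a::euclidean_space \<Rightarrow> real"
  assumes f: "integrable lebesgue f"
  shows integrable_uminus_lebesgue: "integrable lebesgue (\<lambda>x. f (- x))"
    and integral_uminus_lebesgue: "(LINT x|lebesgue. f (- x)) = (LINT x|lebesgue. f x)"
proof -
  have T: "(\<lambda>x::'a. 0 + (\<Sum>j\<in>Basis. (- 1 * (x \<bullet> j)) *\<^sub>R j)) = uminus"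
    by (simp add: sum_negf euclidean_representation fun_eq_iff)
  have m: "(uminus :: 'a \<Rightarrow> 'a) \<in> lebesgue \<rightarrow>\<^sub>M lebesgue"
    using lebesgue_affine_measurable[of "\<lambda>_. - 1" "0 :: 'a"] unfolding T by simp
  have "(lebesgue :: 'a measure) = density (distr lebesgue lebesgue uminus) (\<lambda>_. 1)"
    using lebesgue_affine_euclidean[of "\<lambda>_. - 1" "0 :: 'a"] unfolding T by simp
  then have d: "distr lebesgue lebesgue (uminus :: 'a \<Rightarrow> 'a) = lebesgue" by (simp add: density_1)
  have fm: "f \<in> borel_measurable lebesgue" using f by simp
  show "integrable lebesgue (\<lambda>x. f (- x))"
    using f integrable_distr_eq[OF m fm] by (simp add: d)
  show "(LINT x|lebesgue. f (- x)) = (LINT x|lebesgue. f x)"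
    using integral_distr[OF m fm] by (simp add: d)
qed

lemma integral_cores:
  fixes h :: "real ^ 2 \<Rightarrow> real"
  assumes "set_integrable lebesgue cores h"
  shows "(\<Sum>\<mu>\<in>{0, 1}. \<Sum>\<nu>\<in>{0, 1}. LINT k:branch_core \<mu> \<nu>|lebesgue. h k) = (LINT k:cores|lebesgue. h k)"
    and "\<mu> \<in> {0, 1} \<Longrightarrow> \<nu> \<in> {0, 1} \<Longrightarrow> set_integrable lebesgue (branch_core \<mu> \<nu>) h"
proof -
  have sub: "set_integrable lebesgue (branch_core \<mu> \<nu>) h" if "\<mu> \<in> {0, 1}" "\<nu> \<in> {0, 1}" for \<mu> \<nu>
    by (rule set_integrable_subset[OF assms]) (use that branch_core_sets in \<open>auto simp: cores_def\<close>)
  then show "\<mu> \<in> {0, 1} \<Longrightarrow> \<nu> \<in> {0, 1} \<Longrightarrow> set_integrable lebesgue (branch_core \<mu> \<nu>) h" .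
  have cores: "cores = (\<Union>p\<in>{0, 1} \<times> {0, 1}. branch_core (fst p) (snd p))" by (auto simp: cores_def)
  have "(LINT k:cores|lebesgue. h k) = (\<Sum>p\<in>{0, 1} \<times> {0, 1}. LINT k:branch_core (fst p) (snd p)|lebesgue. h k)"
    unfolding cores
  proof (rule set_integral_finite_Union)
    show "disjoint_family_on (\<lambda>p. branch_core (fst p) (snd p)) ({0, 1} \<times> {0, 1})"
      unfolding disjoint_family_on_def
    proof (intro ballI impI equals0I)
      fix p q :: "nat \<times> nat" and k
      assume "p \<in> {0, 1} \<times> {0, 1}" "q \<in> {0, 1} \<times> {0, 1}" and ne: "p \<noteq> q"
        and "k \<in> branch_core (fst p) (snd p) \<inter> branch_core (fst q) (snd q)"
      then have "fst p = fst q \<and> snd p = snd q"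
        by (intro branch_core_disjoint[of k]) (simp_all only: mem_Times_iff Int_iff)
      then show False using ne by (simp add: prod_eq_iff)
    qed
  qed (use sub branch_core_sets in auto)
  then show "(\<Sum>\<mu>\<in>{0, 1}. \<Sum>\<nu>\<in>{0, 1}. LINT k:branch_core \<mu> \<nu>|lebesgue. h k) = (LINT k:cores|lebesgue. h k)"
    by (simp add: sum.cartesian_product split_def)
qed

lemma set_integral_mono_measurable:
  fixes f g :: "'a \<Rightarrow> real"
  assumes "set_integrable M A g" "f \<in> borel_measurable M" "A \<in> sets M" "\<And>x. x \<in> A \<Longrightarrow> \<bar>f x\<bar> \<le> g x"
  shows "set_integrable M A f"
  unfolding set_integrable_def
proof (rule Bochner_Integration.integrable_bound[OF assms(1)[unfolded set_integrable_def]])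
  show "(\<lambda>x. indicator A x *\<^sub>R f x) \<in> borel_measurable M"
    using assms(2,3) by simp
  show "AE x in M. norm (indicator A x *\<^sub>R f x) \<le> norm (indicator A x *\<^sub>R g x)"
  proof (rule AE_I2)
    fix x
    show "norm (indicator A x *\<^sub>R f x) \<le> norm (indicator A x *\<^sub>R g x)"
      using assms(4)[of x] by (cases "x \<in> A") simp_all
  qed
qed

lemma nn_set_integrable:
  fixes f :: "'a \<Rightarrow> real"
  assumes [measurable]: "f \<in> borel_measurable M" "A \<in> sets M" and pos: "\<And>x. 0 \<le> f x"
    and eq: "(\<integral>\<^sup>+x\<in>A. ennreal (f x) \<partial>M) = ennreal r" and "0 \<le> r"
  shows "set_integrable M A f" and "(LINT x:A|M. f x) = r"
proof -
  have *: "(\<integral>\<^sup>+x. ennreal (indicator A x *\<^sub>R f x) \<partial>M) = ennreal r"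
    unfolding eq[symmetric] by (intro nn_integral_cong) (auto simp: indicator_def)
  show "set_integrable M A f"
    unfolding set_integrable_def by (rule integrableI_nn_integral_finite[OF _ _ *]) (use pos in \<open>auto\<close>)
  show "(LINT x:A|M. f x) = r"
    unfolding set_lebesgue_integral_def by (rule integral_eq_nn_integral[THEN trans]) (use pos * \<open>0 \<le> r\<close> in \<open>auto\<close>)
qed

lemma comp_norm_sq_nonneg: "0 \<le> comp_norm_sq \<Psi> i"
  unfolding comp_norm_sq_def by (simp add: infsum_nonneg)

lemma cores_sets: "cores \<in> sets lebesgue"
  using fundamental_domain_cores by (simp add: fundamental_domain_def)

lemma borel_measurable_fourier_nth:
  assumes "square_summable \<Psi>"
  shows "(\<lambda>k. fourier \<Psi> k $ i) \<in> borel_measurable lebesgue"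
proof -
  have "fourier \<Psi> \<in> borel_measurable lebesgue" using is_fourier_fourier[OF assms] by (simp add: is_fourier_def)
  then show ?thesis
    by (rule measurable_compose) (auto intro!: borel_measurable_continuous_onI continuous_intros)
qed

text \<open>Plancherel's identity was obtained on the box; exact periodicity of
  \<open>fourier\<close> moves the integral to the union of the branches.\<close>

lemma
  assumes sq: "square_summable \<Psi>"
  shows set_integrable_fourier_cores: "set_integrable lebesgue cores (\<lambda>k. (cmod (fourier \<Psi> k $ i))\<^sup>2)"
    and integral_fourier_cores: "(LINT k:cores|lebesgue. (cmod (fourier \<Psi> k $ i))\<^sup>2) = 4 * pi\<^sup>2 * comp_norm_sq \<Psi> i"
proof -
  note F = is_fourier_fourier[OF sq]
  have [measurable]: "(\<lambda>k. fourier \<Psi> k $ i) \<in> borel_measurable lebesgue"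
    by (rule borel_measurable_fourier_nth[OF sq])
  have per: "fourier \<Psi> (lattice_vec n + k) = fourier \<Psi> k" for n k
    by (rule periodic_lattice) (use F in \<open>simp add: is_fourier_def\<close>)
  have "(\<integral>\<^sup>+k\<in>cores. ennreal ((cmod (fourier \<Psi> k $ i))\<^sup>2) \<partial>lebesgue) = (\<integral>\<^sup>+k\<in>torus_box. ennreal ((cmod (fourier \<Psi> k $ i))\<^sup>2) \<partial>lebesgue)"
    by (rule nn_integral_fundamental_domain_eq[OF fundamental_domain_cores fundamental_domain_torus_box]) (auto simp: per)
  also have "\<dots> = ennreal (4 * pi\<^sup>2 * comp_norm_sq \<Psi> i)" by (rule plancherel_nth[OF sq F])
  finally have eq: "(\<integral>\<^sup>+k\<in>cores. ennreal ((cmod (fourier \<Psi> k $ i))\<^sup>2) \<partial>lebesgue) = ennreal (4 * pi\<^sup>2 * comp_norm_sq \<Psi> i)" .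
  show "set_integrable lebesgue cores (\<lambda>k. (cmod (fourier \<Psi> k $ i))\<^sup>2)"
    by (rule nn_set_integrable(1)[OF _ cores_sets _ eq]) (auto simp: comp_norm_sq_nonneg)
  show "(LINT k:cores|lebesgue. (cmod (fourier \<Psi> k $ i))\<^sup>2) = 4 * pi\<^sup>2 * comp_norm_sq \<Psi> i"
    by (rule nn_set_integrable(2)[OF _ cores_sets _ eq]) (auto simp: comp_norm_sq_nonneg)
qed

lemma borel_measurable_borel_lebesgue: "f \<in> borel_measurable borel \<Longrightarrow> f \<in> borel_measurable lebesgue"
  by (rule measurable_completion) simp

lemma borel_measurable_tau [measurable]: "tau a b \<in> borel_measurable borel"
  unfolding tau_def[abs_def] by measurable

lemma borel_measurable_vector_2:
  fixes f g :: "'a \<Rightarrow> real"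
  assumes [measurable]: "f \<in> borel_measurable M" "g \<in> borel_measurable M"
  shows "(\<lambda>x. vector [f x, g x] :: real ^ 2) \<in> borel_measurable M"
proof -
  have "(\<lambda>x. vector [f x, g x] :: real ^ 2) = (\<lambda>x. f x *\<^sub>R axis 1 1 + g x *\<^sub>R axis 2 1)"
    by (simp add: fun_eq_iff vec_eq_iff forall_2 axis_def)
  then show ?thesis by simp
qed

lemma borel_measurable_velocity [measurable]: "velocity a b \<in> borel_measurable borel"
  unfolding velocity_def[abs_def] by (intro borel_measurable_vector_2) measurable

text \<open>The eigenvectors in \<^const>\<open>band_weight\<close> are arbitrary choices; this expression is measurable
  in \<open>k\<close> and equals \<^const>\<open>band_weight\<close> wherever the two eigenvalues differ.\<close>

definition band_weight_formula :: "real \<Rightarrow> real \<Rightarrow> state \<Rightarrow> real \<Rightarrow> real ^ 2 \<Rightarrow> real" where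
  "band_weight_formula a b \<Psi> s k =
    (1 + s * Im (U_diag a b k) / sig a b k) / 2 * (cmod (fourier \<Psi> k $ 1))\<^sup>2
    + (1 - s * Im (U_diag a b k) / sig a b k) / 2 * (cmod (fourier \<Psi> k $ 2))\<^sup>2
    + s / sig a b k * Re (\<i> * cnj (U_offdiag a b k) * fourier \<Psi> k $ 1 * cnj (fourier \<Psi> k $ 2))"

lemma borel_measurable_band_weight_formula:
  assumes "square_summable \<Psi>"
  shows "band_weight_formula a b \<Psi> s \<in> borel_measurable lebesgue"
proof -
  note [measurable] = borel_measurable_fourier_nth[OF assms]
  have "(\<lambda>k::real^2. k $ i) \<in> borel_measurable borel" for i
    by (intro borel_measurable_continuous_onI continuous_intros)
  note nth [measurable] = this[THEN borel_measurable_borel_lebesgue]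
  note [measurable] = borel_measurable_l[THEN borel_measurable_borel_lebesgue] borel_measurable_tau[THEN borel_measurable_borel_lebesgue]
  have 1: "Im (U_diag a b k) = a * sin (l1 k) - b * sin (l2 k)" for k by (simp add: U_diag_def)
  have [measurable]: "(\<lambda>k. cnj (U_offdiag a b k)) \<in> borel_measurable lebesgue"
    unfolding U_offdiag_def
    by (intro borel_measurable_borel_lebesgue borel_measurable_continuous_onI continuous_intros)
  have [measurable]: "(\<lambda>k. cnj (fourier \<Psi> k $ 2)) \<in> borel_measurable lebesgue"
    by (rule measurable_compose[OF borel_measurable_fourier_nth[OF assms]])
      (intro borel_measurable_continuous_onI continuous_intros)
  show ?thesis unfolding band_weight_formula_def[abs_def] 1 sig_def by measurable
qed

section \<open>The integral against the density, expressed in wave vectors\<close>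

context coin_params
begin

lemma band_weight_formula_core:
  assumes "k \<in> cores" "s \<in> {1, -1}"
  shows "band_weight a b \<Psi> s k = band_weight_formula a b \<Psi> s k"
    and "band_weight a b \<Psi> s k \<le> (norm (fourier \<Psi> k))\<^sup>2"
proof -
  have s: "s = 1 \<or> s = -1" using assms by auto
  have t: "(tau a b k)\<^sup>2 < 1" using assms by (intro tau_sq_less) (auto simp: cores_iff generic_def)
  show "band_weight a b \<Psi> s k = band_weight_formula a b \<Psi> s k"
    unfolding band_weight_formula_def using a_pos b_pos by (intro band_weight_eq ab1 s t) auto
  show "band_weight a b \<Psi> s k \<le> (norm (fourier \<Psi> k))\<^sup>2"
    using a_pos b_pos by (intro band_weight_le ab1 s t) auto
qed

text \<open>The explicit formula divides by \<open>sig\<close> and gives no evident uniform bound.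
  On the cores it equals a squared inner product with a unit vector, and Cauchy-Schwarz supplies a
  dominating function independent of the parameters.\<close>

lemma band_integrand_bound:
  assumes "k \<in> cores" "s \<in> {1, -1}" "\<bar>y\<bar> \<le> B"
  shows "\<bar>y * band_weight_formula a b \<Psi> s k\<bar> \<le> B * (norm (fourier \<Psi> k))\<^sup>2"
proof -
  have "0 \<le> band_weight a b \<Psi> s k" by (simp add: band_weight_def)
  then show ?thesis
    using assms band_weight_formula_core[OF assms(1,2), of \<Psi>] by (auto simp: abs_mult intro!: mult_mono)
qed

lemma band_integrand_integrable:
  fixes g :: "real ^ 2 \<Rightarrow> real"
  assumes sq: "square_summable \<Psi>" and s: "s \<in> {1, -1}" and cont: "continuous_on UNIV g" and B: "\<And>v. \<bar>g v\<bar> \<le> B"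
  shows "set_integrable lebesgue cores (\<lambda>k. g (s *\<^sub>R V k) * band_weight_formula a b \<Psi> s k)"
    and "(\<lambda>k. g (s *\<^sub>R V k) * band_weight_formula a b \<Psi> s k) \<in> borel_measurable lebesgue"
proof -
  have "g \<in> borel_measurable borel" by (rule borel_measurable_continuous_onI[OF cont])
  then have "(\<lambda>k. g (s *\<^sub>R V k)) \<in> borel_measurable borel" by measurable
  note [measurable] = borel_measurable_borel_lebesgue[OF this] borel_measurable_band_weight_formula[OF sq]
  show m: "(\<lambda>k. g (s *\<^sub>R V k) * band_weight_formula a b \<Psi> s k) \<in> borel_measurable lebesgue" by measurable
  show "set_integrable lebesgue cores (\<lambda>k. g (s *\<^sub>R V k) * band_weight_formula a b \<Psi> s k)"
  proof (rule set_integral_mono_measurable[OF _ m cores_sets])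
    show "set_integrable lebesgue cores (\<lambda>k. B * (norm (fourier \<Psi> k))\<^sup>2)"
      unfolding norm_sq_vec2 by (intro set_integrable_mult_right set_integral_add(1) set_integrable_fourier_cores sq)
  qed (use s B in \<open>auto intro: band_integrand_bound\<close>)
qed

lemma f_density_uminus: "f_density a b (- v) = f_density a b v"
proof -
  have "- v \<in> ellipse a b \<longleftrightarrow> v \<in> ellipse a b"
    by (simp add: ellipse_def power2_commute[of "v $ 2"] power2_commute[of "- (v $ 1)"]) (simp add: power2_eq_square algebra_simps)
  then show ?thesis by (simp add: f_density_def indicator_def)
qed

text \<open>The constant combines 1 / 4 from \<open>w_plus\<close> with 1 / pi^2 from the change of
  variables.\<close>

lemma integral_rho:
  fixes g :: "real ^ 2 \<Rightarrow> real"
  assumes sq: "square_summable \<Psi>" and cont: "continuous_on UNIV g" and B: "\<And>v. \<bar>g v\<bar> \<le> B"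
  shows "(LINT v|lebesgue. g v * rho \<Psi> a b v) =
    (\<Sum>s\<in>{1, -1}. LINT k:cores|lebesgue. g (s *\<^sub>R V k) * band_weight_formula a b \<Psi> s k) / (4 * pi\<^sup>2)"
proof -
  \<comment> \<open>The reflection is put into \<open>g\<close> instead of \<open>k_branch\<close>.
    Since the density is even, substituting \<open>s *\<^sub>R v\<close> gives back the summand of
    \<open>w_plus\<close>, and reflection does not change the integral.\<close>
  define T where "T s \<mu> \<nu> v = g (s *\<^sub>R v) * band_weight a b \<Psi> s (k_branch a b \<mu> \<nu> v) * f_density a b v" for s \<mu> \<nu> v
  have T: "integrable lebesgue (T s \<mu> \<nu>)"
    "(LINT v|lebesgue. T s \<mu> \<nu> v) = (LINT k:branch_core \<mu> \<nu>|lebesgue. g (s *\<^sub>R V k) * band_weight_formula a b \<Psi> s k) / pi\<^sup>2"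
    if st: "s \<in> {1, -1}" "\<mu> \<in> {0, 1}" "\<nu> \<in> {0, 1}" for s \<mu> \<nu>
  proof -
    have \<mu>: "\<mu> \<le> 1" using st by auto
    have eq: "g (s *\<^sub>R V k) * band_weight_formula a b \<Psi> s k = g (s *\<^sub>R V k) * band_weight a b \<Psi> s k" if "k \<in> branch_core \<mu> \<nu>" for k
      using that st by (subst band_weight_formula_core(1)) (auto simp: cores_def)
    have meas: "branch_core \<mu> \<nu> \<in> sets lebesgue" by (rule branch_core_sets[OF \<mu>])
    have int: "set_integrable lebesgue (branch_core \<mu> \<nu>) (\<lambda>k. g (s *\<^sub>R V k) * band_weight a b \<Psi> s k)"
      using integral_cores(2)[OF band_integrand_integrable(1)[OF sq st(1) cont B] st(2,3)]
      by (rule set_integrable_cong[THEN iffD1, rotated -1]) (auto simp: eq)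
    from branch_change_of_variables[OF \<mu>, of \<nu> "\<lambda>k v. g (s *\<^sub>R v) * band_weight a b \<Psi> s k", OF int]
    show "integrable lebesgue (T s \<mu> \<nu>)"
      "(LINT v|lebesgue. T s \<mu> \<nu> v) = (LINT k:branch_core \<mu> \<nu>|lebesgue. g (s *\<^sub>R V k) * band_weight_formula a b \<Psi> s k) / pi\<^sup>2"
      using set_lebesgue_integral_cong[OF meas, of "\<lambda>k. g (s *\<^sub>R V k) * band_weight_formula a b \<Psi> s k" "\<lambda>k. g (s *\<^sub>R V k) * band_weight a b \<Psi> s k"] eq
      by (simp_all add: T_def[abs_def])
  qed
  have flip: "integrable lebesgue (\<lambda>v. T s \<mu> \<nu> (s *\<^sub>R v))" "(LINT v|lebesgue. T s \<mu> \<nu> (s *\<^sub>R v)) = (LINT v|lebesgue. T s \<mu> \<nu> v)"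
    if st: "s \<in> {1, -1}" "\<mu> \<in> {0, 1}" "\<nu> \<in> {0, 1}" for s \<mu> \<nu>
    using T(1)[OF st] integrable_uminus_lebesgue[OF T(1)[OF st]] integral_uminus_lebesgue[OF T(1)[OF st]] st(1) by auto
  have expand: "g v * rho \<Psi> a b v = 1 / 4 * (\<Sum>s\<in>{1, -1}. \<Sum>\<mu>\<in>{0, 1}. \<Sum>\<nu>\<in>{0, 1}. T s \<mu> \<nu> (s *\<^sub>R v))" for v
    by (simp add: rho_def w_plus_def T_def f_density_uminus algebra_simps)
  have "(LINT v|lebesgue. g v * rho \<Psi> a b v) =
    1 / 4 * (\<Sum>s\<in>{1, -1}. \<Sum>\<mu>\<in>{0, 1}. \<Sum>\<nu>\<in>{0, 1}. LINT v|lebesgue. T s \<mu> \<nu> (s *\<^sub>R v))"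
    (is "_ = 1 / 4 * ?R")
  proof -
    have "(LINT v|lebesgue. (\<Sum>s\<in>{1, -1}. \<Sum>\<mu>\<in>{0, 1}. \<Sum>\<nu>\<in>{0, 1}. T s \<mu> \<nu> (s *\<^sub>R v))) =
      (\<Sum>s\<in>{1, -1}. LINT v|lebesgue. (\<Sum>\<mu>\<in>{0, 1}. \<Sum>\<nu>\<in>{0, 1}. T s \<mu> \<nu> (s *\<^sub>R v)))"
      by (intro Bochner_Integration.integral_sum Bochner_Integration.integrable_sum flip(1))
    also have "\<dots> = (\<Sum>s\<in>{1, -1}. \<Sum>\<mu>\<in>{0, 1}. LINT v|lebesgue. (\<Sum>\<nu>\<in>{0, 1}. T s \<mu> \<nu> (s *\<^sub>R v)))"
      by (intro sum.cong refl Bochner_Integration.integral_sum Bochner_Integration.integrable_sum flip(1))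
    also have "\<dots> = ?R"
      by (intro sum.cong refl Bochner_Integration.integral_sum flip(1))
    finally show ?thesis unfolding expand integral_mult_right_zero by (rule arg_cong)
  qed
  also have "\<dots> = 1 / 4 * (\<Sum>s\<in>{1, -1}. \<Sum>\<mu>\<in>{0, 1}. \<Sum>\<nu>\<in>{0, 1}.
      (LINT k:branch_core \<mu> \<nu>|lebesgue. g (s *\<^sub>R V k) * band_weight_formula a b \<Psi> s k) / pi\<^sup>2)"
    by (intro arg_cong[where f = "\<lambda>x. 1 / 4 * x"] sum.cong refl) (simp only: flip(2) T(2))
  also have "\<dots> = 1 / 4 * (\<Sum>s\<in>{1, -1}. (LINT k:cores|lebesgue. g (s *\<^sub>R V k) * band_weight_formula a b \<Psi> s k) / pi\<^sup>2)"
    unfolding sum_divide_distrib[symmetric]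
    by (intro arg_cong[where f = "\<lambda>x. 1 / 4 * (x / pi\<^sup>2)"] sum.cong refl integral_cores(1) band_integrand_integrable(1)[OF sq _ cont B])
  finally show ?thesis by (simp add: sum_divide_distrib[symmetric] mult_ac)
qed

end

section \<open>The limit of the integrals\<close>

lemma tendsto_vector_2:
  assumes "(f \<longlongrightarrow> x) F" "(h \<longlongrightarrow> y) F"
  shows "((\<lambda>b. vector [f b, h b] :: real ^ 2) \<longlongrightarrow> vector [x, y]) F"
proof (rule vec_tendstoI)
  fix i :: 2
  show "((\<lambda>b. (vector [f b, h b] :: real ^ 2) $ i) \<longlongrightarrow> vector [x, y] $ i) F"
    using exhaust_2[of i] assms by auto
qed

text \<open>In the limit \<open>tau\<close> is \<open>cos (l1 k)\<close> and \<open>sig\<close> is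
  the modulus of \<open>sin (l1 k)\<close>, which the hypothesis keeps away from 0. Bands are
  labelled by the sign of the imaginary part of the eigenvalue rather than by spin, so
  \<open>sgn (sin (l1 k))\<close> tells which band settles on which component.\<close>

lemma band_quantities_tendsto:
  assumes "sin (l1 k) \<noteq> 0"
  shows "((\<lambda>b. velocity (1 - b) b k) \<longlongrightarrow> vector [- sgn (sin (l1 k)), - sgn (sin (l1 k))]) (at_right 0)"
    and "((\<lambda>b. band_weight_formula (1 - b) b \<Psi> s k) \<longlongrightarrow>
      (1 + s * sgn (sin (l1 k))) / 2 * (cmod (fourier \<Psi> k $ 1))\<^sup>2
      + (1 - s * sgn (sin (l1 k))) / 2 * (cmod (fourier \<Psi> k $ 2))\<^sup>2) (at_right 0)"
proof -
  let ?s = "sin (l1 k)"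
  have b: "((\<lambda>b. b) \<longlongrightarrow> (0::real)) (at_right 0)" by (rule tendsto_ident_at)
  have "((\<lambda>b. tau (1 - b) b k) \<longlongrightarrow> (1 - 0) * cos (l1 k) - 0 * cos (l2 k)) (at_right 0)"
    unfolding tau_def by (intro tendsto_intros b)
  then have "((\<lambda>b. sig (1 - b) b k) \<longlongrightarrow> sqrt (1 - ((1 - 0) * cos (l1 k) - 0 * cos (l2 k))\<^sup>2)) (at_right 0)"
    unfolding sig_def by (intro tendsto_intros)
  then have sig: "((\<lambda>b. sig (1 - b) b k) \<longlongrightarrow> \<bar>?s\<bar>) (at_right 0)" by (simp flip: sin_squared_eq)
  have nz: "\<bar>?s\<bar> \<noteq> 0" using assms by simp
  have sgn: "sgn ?s = ?s / \<bar>?s\<bar>" by (rule real_sgn_eq)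
  have "((\<lambda>b. - ((1 - b) * ?s + b * sin (l2 k)) / sig (1 - b) b k) \<longlongrightarrow> - ((1 - 0) * ?s + 0 * sin (l2 k)) / \<bar>?s\<bar>) (at_right 0)"
    "((\<lambda>b. - ((1 - b) * ?s - b * sin (l2 k)) / sig (1 - b) b k) \<longlongrightarrow> - ((1 - 0) * ?s - 0 * sin (l2 k)) / \<bar>?s\<bar>) (at_right 0)"
    by (intro tendsto_intros b sig nz)+
  from tendsto_vector_2[OF this]
  show "((\<lambda>b. velocity (1 - b) b k) \<longlongrightarrow> vector [- sgn ?s, - sgn ?s]) (at_right 0)"
    by (simp add: velocity_def sig_def sgn)
  have im: "Im (U_diag a b k) = a * ?s - b * sin (l2 k)" for a b by (simp add: U_diag_def)
  have "((\<lambda>b. Im (U_diag (1 - b) b k) / sig (1 - b) b k) \<longlongrightarrow> ((1 - 0) * ?s - 0 * sin (l2 k)) / \<bar>?s\<bar>) (at_right 0)"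
    unfolding im by (intro tendsto_intros b sig nz)
  then have h: "((\<lambda>b. s * (Im (U_diag (1 - b) b k) / sig (1 - b) b k)) \<longlongrightarrow> s * sgn ?s) (at_right 0)"
    by (intro tendsto_intros) (simp add: sgn)
  have "((\<lambda>b. U_offdiag (1 - b) b k) \<longlongrightarrow> of_real (2 * sqrt ((1 - 0) * 0) * cos (k $ 1)) * cis (k $ 2)) (at_right 0)"
    unfolding U_offdiag_def by (intro tendsto_intros b)
  then have off: "((\<lambda>b. U_offdiag (1 - b) b k) \<longlongrightarrow> 0) (at_right 0)" by simp
  have "((\<lambda>b. band_weight_formula (1 - b) b \<Psi> s k) \<longlongrightarrow>
      (1 + s * sgn ?s) / 2 * (cmod (fourier \<Psi> k $ 1))\<^sup>2
      + (1 - s * sgn ?s) / 2 * (cmod (fourier \<Psi> k $ 2))\<^sup>2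
      + s / \<bar>?s\<bar> * Re (\<i> * cnj 0 * fourier \<Psi> k $ 1 * cnj (fourier \<Psi> k $ 2))) (at_right 0)"
    unfolding band_weight_formula_def times_divide_eq_right[symmetric, of s]
    by (intro tendsto_intros h off sig nz) auto
  then show "((\<lambda>b. band_weight_formula (1 - b) b \<Psi> s k) \<longlongrightarrow>
      (1 + s * sgn ?s) / 2 * (cmod (fourier \<Psi> k $ 1))\<^sup>2
      + (1 - s * sgn ?s) / 2 * (cmod (fourier \<Psi> k $ 2))\<^sup>2) (at_right 0)" by simp
qed

text \<open>The factor 4 pi^2 of Plancherel's identity cancels the prefactor, so that exactly the
  component norms remain as masses.\<close>

lemma integral_rho_tendsto:
  fixes g :: "real ^ 2 \<Rightarrow> real"
  assumes sq: "square_summable \<Psi>" and cont: "continuous_on UNIV g" and bdd: "bounded (range g)"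
  shows "((\<lambda>b. LINT v|lebesgue. g v * rho \<Psi> (1 - b) b v) \<longlongrightarrow>
    comp_norm_sq \<Psi> 1 * g (vector [-1, -1]) + comp_norm_sq \<Psi> 2 * g (vector [1, 1])) (at_right 0)"
proof -
  obtain B where B: "\<bar>g v\<bar> \<le> B" for v using bdd by (auto simp: bounded_iff)
  let ?F = "\<lambda>i k. (cmod (fourier \<Psi> k $ i))\<^sup>2"
  define h where "h s b k = g (s *\<^sub>R velocity (1 - b) b k) * band_weight_formula (1 - b) b \<Psi> s k" for s b k
  define G where "G k = g (vector [-1, -1]) * ?F 1 k + g (vector [1, 1]) * ?F 2 k" for k
  have h_int: "set_integrable lebesgue cores (h s b)" and h_meas: "h s b \<in> borel_measurable lebesgue"
    and h_bound: "k \<in> cores \<Longrightarrow> \<bar>h s b k\<bar> \<le> B * (norm (fourier \<Psi> k))\<^sup>2"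
    if "s \<in> {1, -1}" "0 < b" "b < 1" for s b k
  proof -
    interpret coin_params "1 - b" b using that by unfold_locales auto
    show "set_integrable lebesgue cores (h s b)" "h s b \<in> borel_measurable lebesgue"
      unfolding h_def[abs_def] by (rule band_integrand_integrable[OF sq that(1) cont B])+
    show "k \<in> cores \<Longrightarrow> \<bar>h s b k\<bar> \<le> B * (norm (fourier \<Psi> k))\<^sup>2"
      unfolding h_def by (rule band_integrand_bound[OF _ that(1) B])
  qed
  have rho: "(LINT v|lebesgue. g v * rho \<Psi> (1 - b) b v) = (LINT k:cores|lebesgue. h 1 b k + h (-1) b k) / (4 * pi\<^sup>2)"
    if b: "0 < b" "b < 1" for b
  proof -
    interpret coin_params "1 - b" b using b by unfold_locales auto
    show ?thesis
      using integral_rho[OF sq cont B] set_integral_add(2)[OF h_int[of 1 b] h_int[of "-1" b]] b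
      by (simp add: h_def)
  qed
  have lim: "((\<lambda>b. h 1 b k + h (-1) b k) \<longlongrightarrow> G k) (at_right 0)" if k: "k \<in> cores" for k
  proof -
    have s0: "sin (l1 k) \<noteq> 0" using k by (auto simp: cores_iff generic_def)
    let ?e = "sgn (sin (l1 k))"
    have gc: "isCont g v" for v using cont by (simp add: continuous_on_eq_continuous_at)
    have "((\<lambda>b. h s b k) \<longlongrightarrow> g (s *\<^sub>R vector [- ?e, - ?e]) * ((1 + s * ?e) / 2 * ?F 1 k + (1 - s * ?e) / 2 * ?F 2 k)) (at_right 0)" for s
      unfolding h_def
      by (intro tendsto_mult isCont_tendsto_compose[OF gc] tendsto_scaleR tendsto_const band_quantities_tendsto s0)
    from tendsto_add[OF this[of 1] this[of "-1"]]
    have "((\<lambda>b. h 1 b k + h (-1) b k) \<longlongrightarrow>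
      g (1 *\<^sub>R vector [- ?e, - ?e]) * ((1 + 1 * ?e) / 2 * ?F 1 k + (1 - 1 * ?e) / 2 * ?F 2 k) +
      g ((-1) *\<^sub>R vector [- ?e, - ?e]) * ((1 + (-1) * ?e) / 2 * ?F 1 k + (1 - (-1) * ?e) / 2 * ?F 2 k)) (at_right 0)" .
    \<comment> \<open>A change of sign of \<open>?e\<close> exchanges the two bands, in their
      weights as well as in their limiting velocities, so both cases yield the same
      \<open>G\<close>.\<close>
    moreover have "?e = 1 \<or> ?e = -1" using s0 by (auto simp: sgn_real_def)
    moreover have "- vector [x, y] = (vector [- x, - y] :: real ^ 2)" for x y by (simp add: vec_eq_iff forall_2)
    ultimately show ?thesis by (auto simp: G_def algebra_simps)
  qed
  note [measurable] = borel_measurable_fourier_nth[OF sq] cores_sets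
  have "((\<lambda>b. LINT v|lebesgue. g v * rho \<Psi> (1 - b) b v) \<longlongrightarrow> (LINT k:cores|lebesgue. G k) / (4 * pi\<^sup>2)) (at_right 0)"
  \<comment> \<open>Dominated convergence works along sequences, which are taken in (0, 1) so that
    both parameters stay positive.\<close>
  proof (rule tendsto_at_right_sequentially[of 0 1])
    fix S :: "nat \<Rightarrow> real" assume S: "\<And>n. 0 < S n" "\<And>n. S n < 1" "S \<longlonglongrightarrow> 0"
    have S0: "filterlim S (at_right 0) sequentially"
    proof -
      have "S n \<noteq> 0" for n using S(1)[of n] by simp
      then show ?thesis using S by (auto simp: filterlim_at)
    qed
    have "(\<lambda>n. LINT k:cores|lebesgue. h 1 (S n) k + h (-1) (S n) k) \<longlonglongrightarrow> (LINT k:cores|lebesgue. G k)"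
      unfolding set_lebesgue_integral_def
    proof (rule integral_dominated_convergence)
      show "(\<lambda>k. indicator cores k *\<^sub>R G k) \<in> borel_measurable lebesgue" unfolding G_def by measurable
      show "(\<lambda>k. indicator cores k *\<^sub>R (h 1 (S n) k + h (-1) (S n) k)) \<in> borel_measurable lebesgue" for n
        using h_meas[of 1 "S n"] h_meas[of "-1" "S n"] S by measurable
      show "integrable lebesgue (\<lambda>k. indicator cores k *\<^sub>R (2 * B * (norm (fourier \<Psi> k))\<^sup>2))"
        unfolding norm_sq_vec2 set_integrable_def[symmetric]
        by (intro set_integrable_mult_right set_integral_add(1) set_integrable_fourier_cores sq)
      show "AE k in lebesgue. (\<lambda>n. indicator cores k *\<^sub>R (h 1 (S n) k + h (-1) (S n) k)) \<longlonglongrightarrow> indicator cores k *\<^sub>R G k"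
      proof (rule AE_I2)
        fix k
        show "(\<lambda>n. indicator cores k *\<^sub>R (h 1 (S n) k + h (-1) (S n) k)) \<longlonglongrightarrow> indicator cores k *\<^sub>R G k"
          using filterlim_compose[OF lim S0, of k] by (cases "k \<in> cores") auto
      qed
      show "AE k in lebesgue. norm (indicator cores k *\<^sub>R (h 1 (S n) k + h (-1) (S n) k)) \<le> indicator cores k *\<^sub>R (2 * B * (norm (fourier \<Psi> k))\<^sup>2)" for n
      proof (rule AE_I2)
        fix k
        show "norm (indicator cores k *\<^sub>R (h 1 (S n) k + h (-1) (S n) k)) \<le> indicator cores k *\<^sub>R (2 * B * (norm (fourier \<Psi> k))\<^sup>2)"
          using h_bound[of 1 "S n" k] h_bound[of "-1" "S n" k] S(1,2)[of n] by (cases "k \<in> cores") auto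
      qed
    qed
    then show "(\<lambda>n. LINT v|lebesgue. g v * rho \<Psi> (1 - S n) (S n) v) \<longlonglongrightarrow> (LINT k:cores|lebesgue. G k) / (4 * pi\<^sup>2)"
      unfolding rho[OF S(1,2)] by (intro tendsto_divide tendsto_const) auto
  qed simp
  also have "(LINT k:cores|lebesgue. G k) = g (vector [-1, -1]) * (4 * pi\<^sup>2 * comp_norm_sq \<Psi> 1) + g (vector [1, 1]) * (4 * pi\<^sup>2 * comp_norm_sq \<Psi> 2)"
    unfolding G_def using set_integrable_fourier_cores[OF sq]
    by (simp add: set_integral_add integral_fourier_cores[OF sq])
  also have "\<dots> / (4 * pi\<^sup>2) = comp_norm_sq \<Psi> 1 * g (vector [-1, -1]) + comp_norm_sq \<Psi> 2 * g (vector [1, 1])"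
    by (simp add: field_simps)
  finally show ?thesis .
qed

section \<open>The limit measure\<close>

lemma
  assumes C: "0 \<le> C" "0 \<le> D"
  shows sets_two_diracs: "sets (two_diracs C D) = sets borel"
    and emeasure_two_diracs: "A \<in> sets borel \<Longrightarrow>
      emeasure (two_diracs C D) A = ennreal C * indicator A (-1) + ennreal D * indicator A 1"
    and finite_measure_two_diracs: "finite_measure (two_diracs C D)"
proof -
  show sets: "sets (two_diracs C D) = sets borel"
    unfolding two_diracs_def using sets.sets_measure_of_eq[of "borel :: real measure"] by simp
  show em: "emeasure (two_diracs C D) A = ennreal C * indicator A (-1) + ennreal D * indicator A 1"
    if "A \<in> sets borel" for A
  proof -
    let ?\<mu> = "\<lambda>A. ennreal C * emeasure (return borel (-1 :: real)) A + ennreal D * emeasure (return borel 1) A"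
    have "emeasure (two_diracs C D) A = ?\<mu> A"
    proof (rule emeasure_measure_of[OF two_diracs_def])
      \<comment> \<open>\<open>measure_of\<close> falls back to the zero measure for a function that
        is not a measure, so additivity has to be settled before the values can be read off.\<close>
      show "countably_additive (sets (two_diracs C D)) ?\<mu>"
      proof (rule countably_additiveI)
        fix X :: "nat \<Rightarrow> real set"
        assume X: "range X \<subseteq> sets (two_diracs C D)" "disjoint_family X" "\<Union> (range X) \<in> sets (two_diracs C D)"
        then have "(\<Sum>i. emeasure (return borel z) (X i)) = emeasure (return borel z) (\<Union> (range X))" for z :: real
          using sets by (intro suminf_emeasure) auto
        then show "(\<Sum>i. ?\<mu> (X i)) = ?\<mu> (\<Union> (range X))"
          by (simp add: suminf_add[symmetric] ennreal_suminf_cmult)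
      qed
    qed (use that sets in \<open>auto simp: positive_def\<close>)
    then show ?thesis using that by simp
  qed
  have "space (two_diracs C D) = UNIV" using sets_eq_imp_space_eq[OF sets] by simp
  then show "finite_measure (two_diracs C D)"
    by (intro finite_measureI) (simp add: em ennreal_mult_eq_top_iff)
qed

text \<open>The complement of the two atoms is null, so the integrand may be replaced by a
  combination of their indicators. Both atoms are endpoints of the closed interval and are counted
  in full.\<close>

lemma integral_two_diracs:
  fixes f :: "real \<Rightarrow> real"
  assumes C: "0 \<le> C" "0 \<le> D" and f: "f \<in> borel_measurable borel"
  shows "(LINT u:{-1..1}|two_diracs C D. f u) = C * f (-1) + D * f 1"
proof -
  let ?M = "two_diracs C D"
  interpret finite_measure ?M by (rule finite_measure_two_diracs[OF C])
  have sets: "sets ?M = sets borel" by (rule sets_two_diracs[OF C])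
  have bm: "borel_measurable ?M = (borel_measurable borel :: (real \<Rightarrow> real) set)"
    by (rule measurable_cong_sets[OF sets refl])
  have m: "measure ?M {z} = (if z = -1 then C else if z = 1 then D else 0)" for z
    using C by (simp add: measure_def emeasure_two_diracs indicator_def)
  have "emeasure ?M (- {-1, 1}) = 0" using C by (subst emeasure_two_diracs) auto
  then have AE: "AE u in ?M. u \<in> {-1, 1}"
    by (intro AE_I'[of "- {-1, 1}"]) (auto simp: null_sets_def sets)
  have "(LINT u:{-1..1}|?M. f u) = (LINT u|?M. f (-1) * indicator {-1} u + f 1 * indicator {1} u)"
    unfolding set_lebesgue_integral_def
  proof (rule integral_cong_AE)
    show "(\<lambda>u. indicator {-1..1} u *\<^sub>R f u) \<in> borel_measurable ?M"
      "(\<lambda>u. f (-1) * indicator {-1} u + f 1 * indicator {1} u) \<in> borel_measurable ?M"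
      unfolding bm using f by measurable
    show "AE u in ?M. indicator {-1..1} u *\<^sub>R f u = f (-1) * indicator {-1} u + f 1 * indicator {1} u"
      using AE by eventually_elim auto
  qed
  also have "\<dots> = f (-1) * measure ?M {-1} + f 1 * measure ?M {1}"
    by (subst Bochner_Integration.integral_add) (auto simp: sets less_top[symmetric])
  finally show ?thesis by (simp add: m)
qed

theorem theorem10:
  fixes \<Psi>\<^sub>0 :: state
  assumes "normalized \<Psi>\<^sub>0"
  shows "has_1D_limit (rho \<Psi>\<^sub>0) (two_diracs (comp_norm_sq \<Psi>\<^sub>0 1) (comp_norm_sq \<Psi>\<^sub>0 2)) \<and>
    (\<forall>g :: real ^ 2 \<Rightarrow> real. continuous_on UNIV g \<longrightarrow> bounded (range g) \<longrightarrow>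
      ((\<lambda>b. LINT v:ellipse (1 - b) b|lebesgue. g v * rho \<Psi>\<^sub>0 (1 - b) b v) \<longlongrightarrow>
        comp_norm_sq \<Psi>\<^sub>0 1 * g (vector [-1, -1]) + comp_norm_sq \<Psi>\<^sub>0 2 * g (vector [1, 1]))
      (at_right 0))"
proof
  have sq: "square_summable \<Psi>\<^sub>0"
    using assms by (auto simp: normalized_def square_summable_def summable_on_def)
  note C = comp_norm_sq_nonneg[of \<Psi>\<^sub>0 1] comp_norm_sq_nonneg[of \<Psi>\<^sub>0 2]
  show "has_1D_limit (rho \<Psi>\<^sub>0) (two_diracs (comp_norm_sq \<Psi>\<^sub>0 1) (comp_norm_sq \<Psi>\<^sub>0 2))"
    unfolding has_1D_limit_def
  proof (intro conjI allI impI)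
    show "emeasure (two_diracs (comp_norm_sq \<Psi>\<^sub>0 1) (comp_norm_sq \<Psi>\<^sub>0 2)) (- {-1..1}) = 0"
      by (subst emeasure_two_diracs[OF C]) auto
    fix g :: "real ^ 2 \<Rightarrow> real"
    assume g: "continuous_on UNIV g" "bounded (range g)"
    have "(\<lambda>u. vector [u, u] :: real ^ 2) \<in> borel_measurable borel"
      by (rule borel_measurable_vector_2) auto
    then have "(\<lambda>u. g (vector [u, u])) \<in> borel_measurable borel"
      using borel_measurable_continuous_onI[OF g(1)] by (rule measurable_compose)
    from integral_two_diracs[OF C this] integral_rho_tendsto[OF sq g]
    show "((\<lambda>b. LINT v|lebesgue. g v * rho \<Psi>\<^sub>0 (1 - b) b v) \<longlongrightarrow>
        (LINT u:{-1..1}|two_diracs (comp_norm_sq \<Psi>\<^sub>0 1) (comp_norm_sq \<Psi>\<^sub>0 2). g (vector [u, u]))) (at_right 0)"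
      by simp
  qed (rule finite_measure_two_diracs[OF C] sets_two_diracs[OF C])+
  \<comment> \<open>The indicator inside \<open>f_density\<close> already restricts the integrand,
    so the integral over the ellipse is the integral over the plane.\<close>
  have "indicator (ellipse a b) v *\<^sub>R (g v * rho \<Psi>\<^sub>0 a b v) = g v * rho \<Psi>\<^sub>0 a b v" for g a b v
    by (simp add: rho_def f_density_def indicator_def)
  note ind = this
  show "\<forall>g :: real ^ 2 \<Rightarrow> real. continuous_on UNIV g \<longrightarrow> bounded (range g) \<longrightarrow>
      ((\<lambda>b. LINT v:ellipse (1 - b) b|lebesgue. g v * rho \<Psi>\<^sub>0 (1 - b) b v) \<longlongrightarrow>
        comp_norm_sq \<Psi>\<^sub>0 1 * g (vector [-1, -1]) + comp_norm_sq \<Psi>\<^sub>0 2 * g (vector [1, 1]))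
      (at_right 0)"
    unfolding set_lebesgue_integral_def ind using integral_rho_tendsto[OF sq] by blast
qed

end
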